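(* Let $R>0$, let $p$ satisfy the standing assumptions listed in the context, and let $\rho_0$ be a radial non-rotating solution supported on $\overline{B_R}$ as described in the context. Let $s\mapsto M(s)$ be the total mass as a function of the central density, defined in the context for $s$ near $\rho_0(0)$. Then $M'(\rho_0(0))\neq0$ if either (a) $p(s)=s^\gamma$ with $\gamma\in(\frac65,2)$, $\gamma\neq\frac43$ (these $p$ satisfy the standing assumptions), or (b) $p$ satisfies the standing assumptions and in addition $p'(s)<h(s)\le 2p'(s)$ for all $s>0$.
   Context: $B_R=\{x\in\mathbb{R}^3:|x|<R\}$. Standing assumptions on the pressure $p$: $p\in C^3(0,\infty)$, $p'>0$; there is $\gamma\in(1,2)$ with $\lim_{s\to0^+}s^{3-\gamma}p'''(s)=-c_0<0$; there is $\gamma^*\in(\frac65,2)$ with $\lim_{s\to\infty}s^{1-\gamma^*}p'(s)=c_1>0$. The specific enthalpy $h(\rho)=\int_0^\rho\frac{p'(\alpha)}{\alpha}\,d\alpha$ is assumed finite (equivalently $p'(0^+)=0$); then $h:[0,\infty)\to[0,\infty)$ is an increasing bijection, and $h^{-1}$ is extended by $0$ to negative arguments. Radial solution: for every $R>0$ it is known that there exists $\rho_0$ which is radial, positive in $B_R$, zero in $\mathbb{R}^3\setminus B_R$, belongs to $C^2(B_R)\cap C^{1,\alpha}(\mathbb{R}^3)$ with $\alpha=\min(\frac{2-\gamma}{\gamma-1},1)$, and satisfies $\nabla\left(\int_{\mathbb{R}^3}\frac{\rho_0(x')}{|x-x'|}dx'-h(\rho_0(x))\right)=0$ in $B_R$.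 Fix such a $\rho_0$. Mass function: for $a>0$ let $v(r;a)$ solve $v''+\frac2rv'+4\pi h^{-1}(v)=0$, $v(0)=a$, $v'(0)=0$. For $s$ close to $\rho_0(0)$ and $a=h(s)$, $v(\cdot;a)$ has a first zero $R(a)$ near $R$, and $h^{-1}(v(|x|;a))$ on $B_{R(a)}$, extended by zero, is the unique radial non-rotating solution with central density $s$. Its total mass is $M(s)=\int_0^{R(a)}4\pi h^{-1}(v(r;a))r^2\,dr$ with $a=h(s)$. The prime in $M'$ denotes the derivative in $s$. *)

theory Defs
  imports "HOL-Analysis.Analysis"
begin

text \<open>The pressure \<open>p\<close> is a function on \<open>(0, \<infinity>)\<close>; its values elsewhere are never used
  (in the enthalpy, the point \<open>\<alpha> = 0\<close> is a null set).\<close>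

definition enthalpy :: "(real \<Rightarrow> real) \<Rightarrow> real \<Rightarrow> real" where
  "enthalpy p \<rho> = integral {0..\<rho>} (\<lambda>\<alpha>. deriv p \<alpha> / \<alpha>)"

definition enthalpy_inv :: "(real \<Rightarrow> real) \<Rightarrow> real \<Rightarrow> real" where
  "enthalpy_inv p y = (if y < 0 then 0 else the_inv_into {0..} (enthalpy p) y)"

text \<open>Finiteness of the enthalpy is the \<open>integrable_on\<close> clause: as the integrand is
  nonnegative, Henstock-Kurzweil integrability up to \<open>0\<close> is absolute integrability.
  The exponent \<open>\<gamma>\<close> is a parameter because the regularity of the radial solution refers to it;
  it is determined by \<open>p\<close>.\<close>

definition admissible_pressure :: "(real \<Rightarrow> real) \<Rightarrow> real \<Rightarrow> bool" where
  "admissible_pressure p \<gamma> \<longleftrightarrow>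
     (\<forall>k<3. ((deriv ^^ k) p) differentiable_on {0<..}) \<and>
     continuous_on {0<..} ((deriv ^^ 3) p) \<and>
     (\<forall>s>0. deriv p s > 0) \<and>
     1 < \<gamma> \<and> \<gamma> < 2 \<and>
     (\<exists>c\<^sub>0>0. ((\<lambda>s. s powr (3 - \<gamma>) * (deriv ^^ 3) p s) \<longlongrightarrow> - c\<^sub>0) (at_right 0)) \<and>
     (\<exists>\<gamma>s c\<^sub>1. 6/5 < \<gamma>s \<and> \<gamma>s < 2 \<and> c\<^sub>1 > 0 \<and>
        ((\<lambda>s. s powr (1 - \<gamma>s) * deriv p s) \<longlongrightarrow> c\<^sub>1) at_top) \<and>
     (\<forall>\<rho>>0. (\<lambda>\<alpha>. deriv p \<alpha> / \<alpha>) integrable_on {0..\<rho>})"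

text \<open>Meant for open \<open>S\<close>: \<open>g\<close> is the gradient and \<open>H\<close> the Hessian matrix.\<close>

definition C2_on :: "(real^3) set \<Rightarrow> (real^3 \<Rightarrow> real) \<Rightarrow> bool" where
  "C2_on S f \<longleftrightarrow> (\<exists>(g :: real^3 \<Rightarrow> real^3) (H :: real^3 \<Rightarrow> real^3^3).
     (\<forall>x\<in>S. (f has_derivative (\<lambda>u. g x \<bullet> u)) (at x) \<and>
            (g has_derivative (\<lambda>u. H x *v u)) (at x)) \<and>
     continuous_on S H)"

definition C1_Holder :: "real \<Rightarrow> (real^3 \<Rightarrow> real) \<Rightarrow> bool" where
  "C1_Holder \<alpha> f \<longleftrightarrow> (\<exists>(g :: real^3 \<Rightarrow> real^3).
     (\<forall>x. (f has_derivative (\<lambda>u. g x \<bullet> u)) (at x)) \<and>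
     bounded (range f) \<and> bounded (range g) \<and>
     (\<exists>L. \<forall>x y. norm (g x - g y) \<le> L * norm (x - y) powr \<alpha>))"

definition newton_potential :: "(real^3 \<Rightarrow> real) \<Rightarrow> real^3 \<Rightarrow> real" where
  "newton_potential \<rho> x = (LINT y|lborel. \<rho> y / norm (x - y))"

definition radial_solution ::
    "(real \<Rightarrow> real) \<Rightarrow> real \<Rightarrow> real \<Rightarrow> (real^3 \<Rightarrow> real) \<Rightarrow> bool" where
  "radial_solution p \<gamma> R \<rho> \<longleftrightarrow>
     (\<forall>x y. norm x = norm y \<longrightarrow> \<rho> x = \<rho> y) \<and>
     (\<forall>x\<in>ball 0 R. \<rho> x > 0) \<and>
     (\<forall>x. x \<notin> ball 0 R \<longrightarrow> \<rho> x = 0) \<and>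
     C2_on (ball 0 R) \<rho> \<and>
     C1_Holder (min ((2 - \<gamma>) / (\<gamma> - 1)) 1) \<rho> \<and>
     (\<forall>x\<in>ball 0 R.
        ((\<lambda>z. newton_potential \<rho> z - enthalpy p (\<rho> z)) has_derivative (\<lambda>u. 0)) (at x))"

text \<open>The initial value problem is posed on all of \<open>[0, \<infinity>)\<close>, which is possible because
  \<open>enthalpy_inv\<close> is defined for negative arguments; at \<open>0\<close> the derivative is one-sided.\<close>

definition solves_profile_ivp :: "(real \<Rightarrow> real) \<Rightarrow> real \<Rightarrow> (real \<Rightarrow> real) \<Rightarrow> bool" where
  "solves_profile_ivp p a v \<longleftrightarrow> (\<exists>v' v''.
     (\<forall>r\<ge>0. (v has_real_derivative v' r) (at r within {0..})) \<and>
     (\<forall>r>0. (v' has_real_derivative v'' r) (at r) \<and>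
            v'' r + 2 / r * v' r + 4 * pi * enthalpy_inv p (v r) = 0) \<and>
     v 0 = a \<and> v' 0 = 0)"

text \<open>A solution is unique on \<open>[0, \<infinity>)\<close>, and only its values there enter below.\<close>

definition profile :: "(real \<Rightarrow> real) \<Rightarrow> real \<Rightarrow> real \<Rightarrow> real" where
  "profile p a = (SOME v. solves_profile_ivp p a v)"

definition star_radius :: "(real \<Rightarrow> real) \<Rightarrow> real \<Rightarrow> real" where
  "star_radius p a = (LEAST r. r > 0 \<and> profile p a r = 0)"

definition total_mass :: "(real \<Rightarrow> real) \<Rightarrow> real \<Rightarrow> real" where
  "total_mass p s =
     (let a = enthalpy p s
      in integral {0..star_radius p a} (\<lambda>r. 4 * pi * enthalpy_inv p (profile p a r) * r\<^sup>2))"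

end

theory Submission
  imports Defs
begin

text \<open>Write \<open>f = 4 \<pi> h\<^bsup>-1\<^esup>\<close>, extended by \<open>0\<close>; it is \<open>C\<^sup>1\<close> on the whole line. Since \<open>f\<close> vanishes on negative
  arguments, \<open>- r\<^sup>2 v'(r; a)\<close> is constant beyond the star, so the mass is \<open>- T\<^sup>2 v'(T; a)\<close> for a fixed
  \<open>T\<close> slightly larger than \<open>R\<close>. Its derivative in \<open>a\<close> is \<open>- T\<^sup>2 w'(T) = - R\<^sup>2 w'(R)\<close>, where
  \<open>w\<close> solves the linearized problem \<open>w'' + (2 / r) w' + f'(v) w = 0\<close>, \<open>w(0) = 1\<close>, \<open>w'(0) = 0\<close>;
  what has to be shown is \<open>w'(R) \<noteq> 0\<close>.

  For a power law \<open>w\<close> is a multiple of \<open>r v' + k v\<close> with \<open>k = 2 (\<gamma> - 1) / (2 - \<gamma>)\<close>, whose derivative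
  at \<open>R\<close> is \<open>(k - 1) v'(R)\<close>, and \<open>k = 1\<close> exactly for \<open>\<gamma> = 4 / 3\<close>.

  In case (b), \<open>f(v) < v f'(v) \<le> 2 f(v)\<close>. Let \<open>m = - r\<^sup>2 v'\<close>. As long as \<open>w > 0\<close>, \<open>r\<^sup>2 w'\<close> decreases. If
  \<open>w\<close> has a first zero \<open>c < R\<close>, comparison with \<open>r v' + 2 v\<close> gives \<open>m(c) \<ge> 2 c v(c)\<close>, and
  this forces \<open>m(R) \<le> 2 m(c)\<close>. With that bound \<open>r v' + (m(c) - m(R)) / c + m(R) / r\<close> is a comparison
  function on \<open>[c, R]\<close> which prevents \<open>w'\<close> from returning to \<open>0\<close>.\<close>

section \<open>Radial initial value problems\<close>

text \<open>The obstacle in case (b) is the range beyond a zero of \<open>w\<close>: there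
  \<open>r^2 w'\<close> increases, and nothing elementary keeps it from reaching 0 exactly at
  \<open>R\<close>. The power law escapes because scaling solves its linearized equation; without
  scaling one needs functions on which the linearized operator \<open>L\<close> has a sign.
  \<open>r v' + 2 v\<close> generates the scaling of the quadratic law \<open>f(v) = v^2\<close>,
  the borderline case of \<open>v f'(v) \<le> 2 f(v)\<close>. The second function starts from
  \<open>L (r v') = - 2 f(v)\<close>: adding a harmonic \<open>A = \<alpha> + \<beta> / r\<close>
  gives \<open>f'(v) A - 2 f(v)\<close>, and the two constants are fixed by requiring the sum to
  vanish at \<open>c\<close> and its derivative to vanish at \<open>R\<close>. The factor 2 in the
  mass bound is what makes \<open>A - 2 v\<close> nondecreasing, its derivative being
  \<open>(2 m - m(R)) / r^2\<close>. Evaluating the mass at a fixed \<open>T\<close> avoids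
  differentiating the moving radius \<open>R(a)\<close>. Since the mass is defined through a chosen
  solution of a singular problem and the given density through its potential, existence, uniqueness,
  differentiable dependence and the shell theorem all enter the proof.\<close>

definition radial_sol :: "real \<Rightarrow> (real \<Rightarrow> real) \<Rightarrow> (real \<Rightarrow> real) \<Rightarrow> (real \<Rightarrow> real) \<Rightarrow> bool" where
  "radial_sol T S v v' \<longleftrightarrow>
     continuous_on {0..<T} v \<and> continuous_on {0..<T} v' \<and> v' 0 = 0 \<and>
     (\<forall>r. 0 < r \<and> r < T \<longrightarrow> (v has_real_derivative v' r) (at r) \<and>
        (v' has_real_derivative - (2 / r * v' r) - S r) (at r))"

text \<open>The source is a function of the radius alone, so the nonlinear problem, its
  linearization and differences of solutions are all instances of \<open>radial_sol\<close>; only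
  the expression for the source has to be exchanged. Continuity up to 0 excludes a component
  \<open>1 / r\<close>.\<close>

lemma radial_sol_cong:
  "radial_sol T S v v' \<Longrightarrow> (\<And>r. 0 < r \<Longrightarrow> r < T \<Longrightarrow> S r = S' r) \<Longrightarrow> radial_sol T S' v v'"
  by (auto simp: radial_sol_def)

lemma radial_sol_diff:
  assumes "radial_sol T S v v'" "radial_sol T Q w w'"
  shows "radial_sol T (\<lambda>r. S r - c * Q r) (\<lambda>r. v r - c * w r) (\<lambda>r. v' r - c * w' r)"
  unfolding radial_sol_def
proof (intro conjI allI impI)
  fix r assume "0 < r \<and> r < T"
  with assms show "((\<lambda>r. v r - c * w r) has_real_derivative v' r - c * w' r) (at r)"
    "((\<lambda>r. v' r - c * w' r) has_real_derivative
        - (2 / r * (v' r - c * w' r)) - (S r - c * Q r)) (at r)"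
    by (auto simp: radial_sol_def field_simps intro!: derivative_eq_intros)
qed (use assms in \<open>auto simp: radial_sol_def intro!: continuous_intros\<close>)

text \<open>Differentiating \<open>d\<^sup>2 + d'\<^sup>2\<close>, the singular term \<open>- (4 / r) d'\<^sup>2\<close> has the favourable sign.\<close>

lemma radial_energy:
  assumes sol: "radial_sol T S d d'" and nonneg: "0 \<le> L" "0 \<le> e" and r: "0 \<le> r" "r < T"
    and S: "\<And>t. 0 < t \<Longrightarrow> t < T \<Longrightarrow> \<bar>S t\<bar> \<le> L * \<bar>d t\<bar> + e"
  shows "(d r)\<^sup>2 + (d' r)\<^sup>2 \<le> exp ((2 + L) * r) * ((d 0)\<^sup>2 + e\<^sup>2)"
proof -
  \<comment> \<open>The constant \<open>e^2\<close> is kept inside the energy so that the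
    exponential rate absorbs the forcing as well. The rate collects 1 from \<open>2 d d'\<close>,
    \<open>L\<close> from the Lipschitz part of \<open>S\<close>, and 1 from splitting
    \<open>2 d' e\<close>.\<close>
  define E where "E = (\<lambda>t. ((d t)\<^sup>2 + (d' t)\<^sup>2 + e\<^sup>2) * exp (- ((2 + L) * t)))"
  have cont: "continuous_on {0..r} d" "continuous_on {0..r} d'"
    using sol r by (auto simp: radial_sol_def intro: continuous_on_subset)
  have "E r \<le> E 0"
  proof (rule DERIV_nonpos_imp_decreasing_open[OF r(1)])
    fix t assume "0 < t" "t < r"
    then have t: "0 < t" "t < T" using r by auto
    have der: "(d has_real_derivative d' t) (at t)"
      "(d' has_real_derivative - (2 / t * d' t) - S t) (at t)"
      using sol t by (auto simp: radial_sol_def)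
    have "(E has_real_derivative
        (2 * d t * d' t + 2 * d' t * (- (2 / t * d' t) - S t)
          - (2 + L) * ((d t)\<^sup>2 + (d' t)\<^sup>2 + e\<^sup>2)) * exp (- ((2 + L) * t))) (at t)"
      unfolding E_def by (auto intro!: derivative_eq_intros der simp: algebra_simps)
    moreover have "2 * d t * d' t + 2 * d' t * (- (2 / t * d' t) - S t)
          - (2 + L) * ((d t)\<^sup>2 + (d' t)\<^sup>2 + e\<^sup>2) \<le> 0"
    proof -
      have "2 * d t * d' t \<le> (d t)\<^sup>2 + (d' t)\<^sup>2" by (rule sum_squares_bound)
      moreover have "- (2 * d' t * S t) \<le> L * ((d t)\<^sup>2 + (d' t)\<^sup>2) + ((d' t)\<^sup>2 + e\<^sup>2)"
      proof -
        have "- (2 * d' t * S t) \<le> 2 * \<bar>d' t\<bar> * \<bar>S t\<bar>"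
          by (metis abs_ge_minus_self abs_mult abs_numeral)
        also have "\<dots> \<le> 2 * \<bar>d' t\<bar> * (L * \<bar>d t\<bar> + e)"
          using S[OF t] by (intro mult_left_mono) auto
        also have "\<dots> = L * (2 * \<bar>d t\<bar> * \<bar>d' t\<bar>) + 2 * \<bar>d' t\<bar> * e" by (simp add: algebra_simps)
        also have "\<dots> \<le> L * ((d t)\<^sup>2 + (d' t)\<^sup>2) + ((d' t)\<^sup>2 + e\<^sup>2)"
          using sum_squares_bound[of "\<bar>d t\<bar>" "\<bar>d' t\<bar>"] sum_squares_bound[of "\<bar>d' t\<bar>" e] nonneg
          by (intro add_mono mult_left_mono) auto
        finally show ?thesis .
      qed
      moreover have "2 * d' t * (- (2 / t * d' t)) \<le> 0"
        using t by (simp add: field_simps)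
      moreover have "(d t)\<^sup>2 \<ge> 0" "L * e\<^sup>2 \<ge> 0" "e\<^sup>2 \<ge> 0" using nonneg by auto
      moreover have "2 * d t * d' t + 2 * d' t * (- (2 / t * d' t) - S t)
          - (2 + L) * ((d t)\<^sup>2 + (d' t)\<^sup>2 + e\<^sup>2)
        = 2 * d t * d' t + 2 * d' t * (- (2 / t * d' t)) + - (2 * d' t * S t)
          - (2 * (d t)\<^sup>2 + 2 * (d' t)\<^sup>2 + 2 * e\<^sup>2 + L * ((d t)\<^sup>2 + (d' t)\<^sup>2) + L * e\<^sup>2)"
        by (simp add: algebra_simps)
      ultimately show ?thesis by linarith
    qed
    ultimately show "\<exists>y. (E has_real_derivative y) (at t) \<and> y \<le> 0"
      by (intro exI conjI) (auto simp: mult_le_0_iff)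
  qed (auto simp: E_def intro!: continuous_intros cont)
  then have "E r * exp ((2 + L) * r) \<le> E 0 * exp ((2 + L) * r)" by (simp add: mult_right_mono)
  also have "E r * exp ((2 + L) * r) = (d r)\<^sup>2 + (d' r)\<^sup>2 + e\<^sup>2"
    by (simp add: E_def mult.assoc flip: exp_add)
  also have "E 0 * exp ((2 + L) * r) = exp ((2 + L) * r) * ((d 0)\<^sup>2 + e\<^sup>2)"
    using sol by (simp add: E_def radial_sol_def)
  finally have "((d r)\<^sup>2 + (d' r)\<^sup>2 + e\<^sup>2) \<le> exp ((2 + L) * r) * ((d 0)\<^sup>2 + e\<^sup>2)" .
  then show ?thesis using zero_le_power2[of e] by linarith
qed

lemma radial_unique:
  assumes "radial_sol T S d d'" "d 0 = 0" "0 \<le> r" "r < T"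
    and "\<And>t. 0 < t \<Longrightarrow> t < T \<Longrightarrow> \<bar>S t\<bar> \<le> L * \<bar>d t\<bar>"
  shows "d r = 0" "d' r = 0"
proof -
  have "\<bar>S t\<bar> \<le> \<bar>L\<bar> * \<bar>d t\<bar> + 0" if "0 < t" "t < T" for t
    using assms(5)[OF that] mult_right_mono[of L "\<bar>L\<bar>" "\<bar>d t\<bar>"] by linarith
  then have "(d r)\<^sup>2 + (d' r)\<^sup>2 \<le> exp ((2 + \<bar>L\<bar>) * r) * ((d 0)\<^sup>2 + 0\<^sup>2)"
    using assms by (intro radial_energy[OF assms(1)]) auto
  then show "d r = 0" "d' r = 0" using assms(2) by (simp_all add: sum_power2_le_zero_iff)
qed

lemma continuous_on_Icc_bounded:
  fixes g :: "real \<Rightarrow> real"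
  assumes "continuous_on {a..b} g"
  obtains B where "B > 0" "\<And>s. a \<le> s \<Longrightarrow> s \<le> b \<Longrightarrow> \<bar>g s\<bar> \<le> B"
proof -
  have "bounded (g ` {a..b})"
    by (intro compact_imp_bounded compact_continuous_image assms compact_Icc)
  then obtain B where "B > 0" "\<forall>y\<in>g ` {a..b}. norm y \<le> B" unfolding bounded_pos by blast
  then show thesis using that[of B] by simp
qed

lemma at_within_halfline: "r > 0 \<Longrightarrow> at r within {0..} = at (r::real)"
  by (rule at_within_nhd[of _ "{0<..}"]) auto

section \<open>The integral operator that inverts the radial Laplacian\<close>

definition ball_mass :: "(real \<Rightarrow> real) \<Rightarrow> real \<Rightarrow> real" where
  "ball_mass g t = integral {0..t} (\<lambda>s. s\<^sup>2 * g s)"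

text \<open>The value of the integrand at \<open>0\<close> is \<open>0 / 0 = 0\<close>, which is its limit.\<close>

definition radial_potential :: "(real \<Rightarrow> real) \<Rightarrow> real \<Rightarrow> real" where
  "radial_potential g r = integral {0..r} (\<lambda>t. ball_mass g t / t\<^sup>2)"

text \<open>Continuity is local. Composing with \<open>max 0\<close> extends \<open>g\<close> to the
  whole line, where continuity at a point, the origin included, can be read off from open
  intervals.\<close>

lemma continuous_on_halfline:
  fixes g :: "real \<Rightarrow> real"
  assumes "\<And>T. continuous_on {0..T} g" shows "continuous_on {0..} g"
proof -
  have "isCont (\<lambda>x. g (max 0 x)) r" for r
  proof -
    have "continuous_on {-1..\<bar>r\<bar> + 1} (\<lambda>x. g (max 0 x))"
      by (rule continuous_on_compose2[OF assms[of "\<bar>r\<bar> + 1"]]) (auto intro!: continuous_intros)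
    then have "continuous_on {-1<..<\<bar>r\<bar> + 1} (\<lambda>x. g (max 0 x))"
      by (rule continuous_on_subset) auto
    moreover have "continuous_on {..<0} (\<lambda>x. g (max 0 x))"
      by (rule continuous_on_eq[of _ "\<lambda>_. g 0"]) auto
    ultimately show ?thesis
      by (cases "r < 0") (auto simp: continuous_on_eq_continuous_at)
  qed
  then have "continuous_on {0..} (\<lambda>x. g (max 0 x))"
    by (simp add: continuous_at_imp_continuous_on)
  then show ?thesis by (rule continuous_on_eq) (auto simp: max_def)
qed

lemma integral_exp_le: "(K::real) > 0 \<Longrightarrow> 0 \<le> t \<Longrightarrow> integral {0..t} (\<lambda>s. exp (K * s)) \<le> exp (K * t) / K"
proof -
  assume "K > 0" "0 \<le> t"
  then have "((\<lambda>s. exp (K * s)) has_integral exp (K * t) / K - exp (K * 0) / K) {0..t}"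
    by (intro fundamental_theorem_of_calculus[where f = "\<lambda>s. exp (K * s) / K"])
      (auto intro!: derivative_eq_intros simp: has_real_derivative_iff_has_vector_derivative[symmetric])
  then show ?thesis using \<open>K > 0\<close> by (simp add: integral_unique)
qed

context
  fixes g :: "real \<Rightarrow> real"
  assumes g: "continuous_on {0..} g"
begin

lemma ball_mass_integrable: "(\<lambda>s. s\<^sup>2 * g s) integrable_on {0..t}"
  by (auto intro!: integrable_continuous_interval continuous_intros continuous_on_subset[OF g])

lemma ball_mass_deriv:
  assumes "t > 0" shows "(ball_mass g has_real_derivative t\<^sup>2 * g t) (at t)"
proof -
  have "(ball_mass g has_real_derivative t\<^sup>2 * g t) (at t within {0..t + 1})"
    unfolding ball_mass_def
    by (rule integral_has_real_derivative)
      (use assms in \<open>auto intro!: continuous_intros continuous_on_subset[OF g]\<close>)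
  then show ?thesis using assms by (simp add: at_within_Icc_at)
qed

lemma ball_mass_bound:
  assumes "0 \<le> t" "0 \<le> B" "\<And>s. 0 \<le> s \<Longrightarrow> s \<le> t \<Longrightarrow> \<bar>g s\<bar> \<le> B"
  shows "\<bar>ball_mass g t\<bar> \<le> B * t ^ 3"
proof -
  have "norm (ball_mass g t) \<le> (B * t\<^sup>2) * (t - 0)"
    unfolding ball_mass_def
    by (rule integral_bound[OF assms(1)])
      (use assms in \<open>auto intro!: continuous_intros continuous_on_subset[OF g] mult_mono power_mono
          simp: abs_mult mult.commute[of "_\<^sup>2"]\<close>)
  then show ?thesis by (simp add: power2_eq_square power3_eq_cube mult.assoc)
qed

text \<open>At the origin the cubic bound on \<open>ball_mass\<close> leaves \<open>B t\<close>
  after division by \<open>t^2\<close>; elsewhere this is a quotient of continuous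
  functions.\<close>

lemma slope_continuous: "continuous_on {0..} (\<lambda>t. ball_mass g t / t\<^sup>2)"
proof -
  have "continuous (at t within {0..}) (\<lambda>t. ball_mass g t / t\<^sup>2)" if "t \<ge> 0" for t
  proof (cases "t = 0")
    case True
    have "continuous_on {0..1} g" by (auto intro: continuous_on_subset[OF g])
    then obtain B where B: "B > 0" "\<And>s. 0 \<le> s \<Longrightarrow> s \<le> 1 \<Longrightarrow> \<bar>g s\<bar> \<le> B"
      using continuous_on_Icc_bounded by blast
    have "((\<lambda>t. B * t) \<longlongrightarrow> B * 0) (at 0 within {0..})" by (intro tendsto_intros)
    then have "((\<lambda>t. B * t) \<longlongrightarrow> 0) (at 0 within {0..})" by simp
    moreover have "\<forall>\<^sub>F t in at 0 within {0..}. norm (ball_mass g t / t\<^sup>2) \<le> B * t"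
      unfolding eventually_at
    proof (intro exI[of _ "1::real"] conjI ballI impI)
      fix t :: real assume t: "t \<in> {0..}" "t \<noteq> 0 \<and> dist t 0 < 1"
      then have "\<bar>ball_mass g t\<bar> \<le> B * t ^ 3" using B by (intro ball_mass_bound) auto
      then show "norm (ball_mass g t / t\<^sup>2) \<le> B * t"
        using t by (simp add: divide_le_eq power2_eq_square power3_eq_cube mult.assoc)
    qed simp
    ultimately have "((\<lambda>t. ball_mass g t / t\<^sup>2) \<longlongrightarrow> 0) (at 0 within {0..})"
      by (rule Lim_null_comparison[rotated])
    then show ?thesis using True by (simp add: continuous_within ball_mass_def)
  next
    case False
    have "isCont (\<lambda>t. ball_mass g t / t\<^sup>2) t"
      using DERIV_isCont[OF ball_mass_deriv[of t]] that False
      by (intro isCont_divide isCont_power) auto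
    then show ?thesis by (rule continuous_at_imp_continuous_at_within)
  qed
  then show ?thesis by (simp add: continuous_on_eq_continuous_within)
qed

lemma radial_potential_deriv:
  assumes "0 \<le> r" shows "(radial_potential g has_real_derivative ball_mass g r / r\<^sup>2) (at r within {0..})"
proof -
  have "(radial_potential g has_real_derivative ball_mass g r / r\<^sup>2) (at r within {0..r + 1})"
    unfolding radial_potential_def
    by (rule integral_has_real_derivative)
      (use assms in \<open>auto intro!: continuous_on_subset[OF slope_continuous]\<close>)
  moreover have "at r within {0..r + 1} = at r within {0..}"
    by (rule at_within_nhd[of _ "{..<r + 1}"]) auto
  ultimately show ?thesis by simp
qed

lemma radial_potential_continuous: "continuous_on {0..} (radial_potential g)"
  using radial_potential_deriv by (auto simp: continuous_on_eq_continuous_within intro!: DERIV_continuous)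

text \<open>The flux \<open>r^2 v'\<close> equals \<open>- ball_mass g r\<close>, with derivative
  \<open>- r^2 g r\<close>; dividing by \<open>r^2\<close> produces the singular term. A fixed point
  of the integral equation is thereby a solution of the differential equation.\<close>

lemma radial_potential_sol:
  "radial_sol T (\<lambda>r. g r) (\<lambda>r. a - radial_potential g r) (\<lambda>r. - (ball_mass g r / r\<^sup>2))"
  unfolding radial_sol_def
proof (intro conjI allI impI)
  show "continuous_on {0..<T} (\<lambda>r. a - radial_potential g r)"
    by (intro continuous_intros continuous_on_subset[OF radial_potential_continuous]) auto
  show "continuous_on {0..<T} (\<lambda>r. - (ball_mass g r / r\<^sup>2))"
    by (intro continuous_on_minus continuous_on_subset[OF slope_continuous]) auto
  fix r assume r: "0 < r \<and> r < T"
  then have "(radial_potential g has_real_derivative ball_mass g r / r\<^sup>2) (at r)"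
    using radial_potential_deriv[of r] at_within_halfline[of r] by (metis less_imp_le)
  then show "((\<lambda>r. a - radial_potential g r) has_real_derivative - (ball_mass g r / r\<^sup>2)) (at r)"
    by (auto intro!: derivative_eq_intros)
  show "((\<lambda>r. - (ball_mass g r / r\<^sup>2)) has_real_derivative
      - (2 / r * - (ball_mass g r / r\<^sup>2)) - g r) (at r)"
    using r by (auto intro!: derivative_eq_intros ball_mass_deriv
        simp: field_simps power2_eq_square)
qed simp

text \<open>Each of the two integrations of \<open>exp (K s)\<close> costs a factor
  \<open>1 / K\<close>. In the inner one \<open>s^2 \<le> t^2\<close> cancels the denominator
  \<open>t^2\<close>, so the bound has no singularity at the origin.\<close>

lemma radial_potential_bound:
  assumes K: "K > 0" and B: "0 \<le> B" "\<And>s. 0 \<le> s \<Longrightarrow> s \<le> T \<Longrightarrow> \<bar>g s\<bar> \<le> B * exp (K * s)"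
    and r: "0 \<le> r" "r \<le> T"
  shows "\<bar>radial_potential g r\<bar> \<le> B * exp (K * r) / K\<^sup>2"
proof -
  have exp_int: "(\<lambda>s. c * exp (K * s)) integrable_on {0..t}" for c t :: real
    by (auto intro!: integrable_continuous_interval continuous_intros)
  have mass: "\<bar>ball_mass g t\<bar> \<le> t\<^sup>2 * (B * exp (K * t) / K)" if t: "0 \<le> t" "t \<le> T" for t
  proof -
    have "norm (ball_mass g t) \<le> integral {0..t} (\<lambda>s. (t\<^sup>2 * B) * exp (K * s))"
      unfolding ball_mass_def
    proof (rule integral_norm_bound_integral[OF ball_mass_integrable exp_int])
      fix s assume s: "s \<in> {0..t}"
      have "s\<^sup>2 * \<bar>g s\<bar> \<le> t\<^sup>2 * (B * exp (K * s))"
        using B s t by (intro mult_mono power_mono) auto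
      then show "norm (s\<^sup>2 * g s) \<le> t\<^sup>2 * B * exp (K * s)" by (simp add: abs_mult mult.assoc)
    qed
    also have "\<dots> \<le> (t\<^sup>2 * B) * (exp (K * t) / K)"
      using mult_left_mono[OF integral_exp_le[OF K t(1)], of "t\<^sup>2 * B"] B by simp
    finally show ?thesis by simp
  qed
  have "norm (radial_potential g r) \<le> integral {0..r} (\<lambda>t. (B / K) * exp (K * t))"
    unfolding radial_potential_def
  proof (rule integral_norm_bound_integral[OF _ exp_int])
    show "(\<lambda>t. ball_mass g t / t\<^sup>2) integrable_on {0..r}"
      by (rule integrable_continuous_interval) (auto intro: continuous_on_subset[OF slope_continuous])
    fix t assume t: "t \<in> {0..r}"
    show "norm (ball_mass g t / t\<^sup>2) \<le> B / K * exp (K * t)"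
    proof (cases "t = 0")
      case False
      then show ?thesis using mass[of t] t r
        by (simp add: divide_le_eq abs_mult) (simp add: mult_ac)
    qed (use B K in simp)
  qed
  also have "\<dots> \<le> (B / K) * (exp (K * r) / K)"
    using mult_left_mono[OF integral_exp_le[OF K r(1)], of "B / K"] B K by simp
  finally show ?thesis by (simp add: power2_eq_square)
qed

end

lemma radial_potential_diff:
  assumes "continuous_on {0..} g" "continuous_on {0..} h" "r \<ge> 0"
  shows "radial_potential g r - radial_potential h r = radial_potential (\<lambda>s. g s - h s) r"
proof -
  have int: "(\<lambda>t. ball_mass u t / t\<^sup>2) integrable_on {0..r}" if "continuous_on {0..} u" for u
    by (rule integrable_continuous_interval) (auto intro: continuous_on_subset[OF slope_continuous[OF that]])
  have "ball_mass (\<lambda>s. g s - h s) t = ball_mass g t - ball_mass h t" for t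
    unfolding ball_mass_def
    by (subst integral_diff[symmetric])
      (simp_all add: ball_mass_integrable assms right_diff_distrib)
  then show ?thesis
    unfolding radial_potential_def
    by (subst integral_diff[symmetric]) (auto intro!: int assms simp: diff_divide_distrib)
qed

text \<open>Picard iteration in the norm weighted with \<open>exp (- K r)\<close>, \<open>K = 1 + L\<close>, for which the
  integral operator contracts by the factor \<open>L / K\<^sup>2 \<le> 1 / 2\<close>.\<close>

lemma radial_fixed_point:
  fixes G :: "real \<Rightarrow> real \<Rightarrow> real"
  assumes G_cont: "\<And>x. continuous_on {0..} x \<Longrightarrow> continuous_on {0..} (\<lambda>r. G r (x r))"
    and lip: "\<And>r x y. r \<ge> 0 \<Longrightarrow> \<bar>G r x - G r y\<bar> \<le> L * \<bar>x - y\<bar>"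
  obtains v where "continuous_on {0..} v"
    "\<And>r. r \<ge> 0 \<Longrightarrow> v r = a - radial_potential (\<lambda>s. G s (v s)) r"
proof -
  define P where "P = (\<lambda>x r. a - radial_potential (\<lambda>s. G s (x s)) r)"
  define \<phi> where "\<phi> = (\<lambda>n. (P ^^ n) (\<lambda>_. a))"
  have \<phi>_Suc: "\<phi> (Suc n) = P (\<phi> n)" for n by (simp add: \<phi>_def)
  have L0: "L \<ge> 0" using lip[of 0 1 0] by simp
  define K where "K = 1 + L"
  have K: "K > 0" using L0 by (simp add: K_def)
  have "2 * L \<le> K\<^sup>2" by (simp add: K_def power2_sum)
  then have half: "L / K\<^sup>2 \<le> 1 / 2" using K by (simp add: field_simps)
  have P_cont: "continuous_on {0..} (P x)" if "continuous_on {0..} x" for x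
    unfolding P_def by (intro continuous_intros radial_potential_continuous G_cont that)
  have \<phi>_cont: "continuous_on {0..} (\<phi> n)" for n
    by (induction n) (auto simp: \<phi>_Suc P_cont, simp add: \<phi>_def)
  have contract: "\<bar>P x r - P y r\<bar> \<le> B / 2 * exp (K * r)"
    if xy: "continuous_on {0..} x" "continuous_on {0..} y"
      and B: "B \<ge> 0" "\<And>s. 0 \<le> s \<Longrightarrow> s \<le> T \<Longrightarrow> \<bar>x s - y s\<bar> \<le> B * exp (K * s)"
      and r: "0 \<le> r" "r \<le> T" for x y B r T
  proof -
    have "P x r - P y r = - radial_potential (\<lambda>s. G s (x s) - G s (y s)) r"
      using radial_potential_diff[OF G_cont[OF xy(1)] G_cont[OF xy(2)] r(1)] by (simp add: P_def)
    moreover have "\<bar>radial_potential (\<lambda>s. G s (x s) - G s (y s)) r\<bar> \<le> (L * B) * exp (K * r) / K\<^sup>2"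
    proof (rule radial_potential_bound[OF _ K _ _ r])
      show "continuous_on {0..} (\<lambda>s. G s (x s) - G s (y s))"
        by (intro continuous_intros G_cont xy)
      fix s assume "0 \<le> s" "s \<le> T"
      then show "\<bar>G s (x s) - G s (y s)\<bar> \<le> L * B * exp (K * s)"
        using lip[of s "x s" "y s"] mult_left_mono[OF B(2)[of s] L0] by (simp add: mult.assoc)
    qed (use L0 B in simp)
    moreover have "(L * B) * exp (K * r) / K\<^sup>2 \<le> B / 2 * exp (K * r)"
      using mult_right_mono[OF half, of "B * exp (K * r)"] B by (simp add: ac_simps)
    ultimately show ?thesis by linarith
  qed
  \<comment> \<open>\<open>D\<close> bounds the first increment, which is bounded only on compact
    intervals; hence the restriction to \<open>{0..T}\<close>. On each of them the increments decay
    geometrically in the weighted norm.\<close>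
  have tail: "\<exists>D\<ge>0. \<forall>n k r. 0 \<le> r \<and> r \<le> T \<longrightarrow> \<bar>\<phi> (n + k) r - \<phi> n r\<bar> \<le> 2 * D * (1/2) ^ n * exp (K * r)" for T
  proof -
    have "continuous_on {0..T} (\<lambda>r. \<phi> 1 r - \<phi> 0 r)"
      by (intro continuous_intros continuous_on_subset[OF \<phi>_cont]) auto
    then obtain D where D: "D > 0" "\<And>r. 0 \<le> r \<Longrightarrow> r \<le> T \<Longrightarrow> \<bar>\<phi> 1 r - \<phi> 0 r\<bar> \<le> D"
      using continuous_on_Icc_bounded by blast
    have step: "\<bar>\<phi> (Suc n) r - \<phi> n r\<bar> \<le> D * (1/2) ^ n * exp (K * r)" if "0 \<le> r" "r \<le> T" for n r
      using that
    proof (induction n arbitrary: r)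
      case 0
      have "D * 1 \<le> D * exp (K * r)" using D(1) K 0 by (intro mult_left_mono) auto
      then show ?case using D(2)[of r] 0 by simp
    next
      case (Suc n)
      then show ?case
        using contract[OF \<phi>_cont \<phi>_cont, of "D * (1/2) ^ n" T "Suc n" n r] D(1) by (simp add: \<phi>_Suc)
    qed
    \<comment> \<open>The factor \<open>1 - (1/2) ^ k\<close> is the partial geometric sum; it makes
      the estimate inductive and is dropped afterwards.\<close>
    have "\<bar>\<phi> (n + k) r - \<phi> n r\<bar> \<le> 2 * D * (1/2) ^ n * exp (K * r) * (1 - (1/2) ^ k)"
      if r: "0 \<le> r" "r \<le> T" for n k r
    proof (induction k)
      case (Suc k)
      have "\<bar>\<phi> (n + Suc k) r - \<phi> n r\<bar> \<le> D * (1/2) ^ (n + k) * exp (K * r)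
          + 2 * D * (1/2) ^ n * exp (K * r) * (1 - (1/2) ^ k)"
        using step[OF r, of "n + k"] Suc by simp
      also have "\<dots> = 2 * D * (1/2) ^ n * exp (K * r) * (1 - (1/2) ^ Suc k)"
        by (simp add: power_add algebra_simps)
      finally show ?case .
    qed simp
    moreover have "2 * D * (1/2) ^ n * exp (K * r) * (1 - (1/2) ^ k) \<le> 2 * D * (1/2) ^ n * exp (K * r)" for n k r
      using D(1) by (intro mult_right_le_one_le) (auto simp: power_le_one)
    ultimately have "\<bar>\<phi> (n + k) r - \<phi> n r\<bar> \<le> 2 * D * (1/2) ^ n * exp (K * r)"
      if "0 \<le> r" "r \<le> T" for n k r
      using that order_trans by blast
    then show ?thesis using D(1) by (intro exI[of _ D]) auto
  qed
  define v where "v = (\<lambda>r. lim (\<lambda>n. \<phi> n r))"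
  have lim: "(\<lambda>n. \<phi> n r) \<longlonglongrightarrow> v r" if r: "r \<ge> 0" for r
  proof -
    obtain D where D: "\<And>n k. \<bar>\<phi> (n + k) r - \<phi> n r\<bar> \<le> 2 * D * (1/2) ^ n * exp (K * r)"
      using tail[of r] r by (metis order_refl)
    have "Cauchy (\<lambda>n. \<phi> n r)"
    proof (rule CauchyI')
      fix e :: real assume "e > 0"
      have "(\<lambda>n. 2 * D * (1/2) ^ n * exp (K * r)) \<longlonglongrightarrow> 2 * D * 0 * exp (K * r)"
        by (intro tendsto_intros LIMSEQ_power_zero) auto
      then have "\<forall>\<^sub>F n in sequentially. 2 * D * (1/2) ^ n * exp (K * r) < e"
        using \<open>e > 0\<close> by (intro order_tendstoD(2)) auto
      then obtain M where M: "\<And>n. n \<ge> M \<Longrightarrow> 2 * D * (1/2) ^ n * exp (K * r) < e"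
        by (auto simp: eventually_sequentially)
      show "\<exists>M. \<forall>m\<ge>M. \<forall>n>m. dist (\<phi> m r) (\<phi> n r) < e"
      proof (intro exI[of _ M] allI impI)
        fix m n :: nat assume "m \<ge> M" "n > m"
        then show "dist (\<phi> m r) (\<phi> n r) < e"
          using D[of m "n - m"] M[of m] by (simp add: dist_real_def abs_minus_commute)
      qed
    qed
    then show ?thesis unfolding v_def by (simp add: Cauchy_convergent_iff convergent_LIMSEQ_iff)
  qed
  have close: "\<exists>D\<ge>0. \<forall>n r. 0 \<le> r \<and> r \<le> T \<longrightarrow> \<bar>v r - \<phi> n r\<bar> \<le> 2 * D * (1/2) ^ n * exp (K * r)" for T
  proof -
    obtain D where D: "D \<ge> 0" and bound: "\<forall>n k r. 0 \<le> r \<and> r \<le> T \<longrightarrow> \<bar>\<phi> (n + k) r - \<phi> n r\<bar> \<le> 2 * D * (1/2) ^ n * exp (K * r)"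
      using tail[of T] by blast
    have "\<bar>v r - \<phi> n r\<bar> \<le> 2 * D * (1/2) ^ n * exp (K * r)" if r: "0 \<le> r" "r \<le> T" for n r
    proof (rule LIMSEQ_le_const2)
      show "(\<lambda>k. \<bar>\<phi> (k + n) r - \<phi> n r\<bar>) \<longlonglongrightarrow> \<bar>v r - \<phi> n r\<bar>"
        by (intro tendsto_intros LIMSEQ_ignore_initial_segment lim r)
      show "\<exists>N. \<forall>k\<ge>N. \<bar>\<phi> (k + n) r - \<phi> n r\<bar> \<le> 2 * D * (1/2) ^ n * exp (K * r)"
        using bound r by (metis add.commute)
    qed
    with D show ?thesis by blast
  qed
  have "continuous_on {0..T} v" for T
  proof -
    obtain D where D: "D \<ge> 0" "\<And>n r. 0 \<le> r \<Longrightarrow> r \<le> T \<Longrightarrow> \<bar>v r - \<phi> n r\<bar> \<le> 2 * D * (1/2) ^ n * exp (K * r)"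
      using close[of T] by blast
    have null: "(\<lambda>n. 2 * D * (1/2) ^ n * exp (K * T)) \<longlonglongrightarrow> 2 * D * 0 * exp (K * T)"
      by (intro tendsto_intros LIMSEQ_power_zero) auto
    have "uniform_limit {0..T} \<phi> v sequentially"
    proof (rule uniform_limitI)
      fix e :: real assume "e > 0"
      then have "\<forall>\<^sub>F n in sequentially. 2 * D * (1/2) ^ n * exp (K * T) < e"
        using null by (intro order_tendstoD(2)) auto
      then show "\<forall>\<^sub>F n in sequentially. \<forall>x\<in>{0..T}. dist (\<phi> n x) (v x) < e"
      proof eventually_elim
        case (elim n)
        have "2 * D * (1/2) ^ n * exp (K * x) \<le> 2 * D * (1/2) ^ n * exp (K * T)" if "x \<le> T" for x
          using that K D(1) by (intro mult_left_mono) auto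
        then show ?case using D(2)[of _ n] elim
          by (fastforce simp: dist_real_def abs_minus_commute)
      qed
    qed
    then show ?thesis
      by (rule uniform_limit_theorem[rotated]) (auto intro!: always_eventually continuous_on_subset[OF \<phi>_cont])
  qed
  then have v_cont: "continuous_on {0..} v" by (rule continuous_on_halfline)
  have "v r = P v r" if r: "r \<ge> 0" for r
  proof -
    obtain D where D: "D \<ge> 0" "\<And>n s. 0 \<le> s \<Longrightarrow> s \<le> r \<Longrightarrow> \<bar>v s - \<phi> n s\<bar> \<le> 2 * D * (1/2) ^ n * exp (K * s)"
      using close[of r] by blast
    have "\<bar>\<phi> (Suc n) r - P v r\<bar> \<le> D * (1/2) ^ n * exp (K * r)" for n
      using contract[OF v_cont \<phi>_cont, of "2 * D * (1/2) ^ n" r n r] D r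
      by (simp add: \<phi>_Suc abs_minus_commute)
    then have bound: "\<forall>\<^sub>F n in sequentially. norm (\<phi> (Suc n) r - P v r) \<le> D * (1/2) ^ n * exp (K * r)"
      by simp
    have "(\<lambda>n. D * (1/2) ^ n * exp (K * r)) \<longlonglongrightarrow> D * 0 * exp (K * r)"
      by (intro tendsto_intros LIMSEQ_power_zero) auto
    then have "(\<lambda>n. D * (1/2) ^ n * exp (K * r)) \<longlonglongrightarrow> 0" by simp
    then have "(\<lambda>n. \<phi> (Suc n) r - P v r) \<longlonglongrightarrow> 0"
      by (rule Lim_null_comparison[OF bound])
    then have "(\<lambda>n. \<phi> (Suc n) r) \<longlonglongrightarrow> P v r" by (simp add: LIM_zero_iff)
    moreover have "(\<lambda>n. \<phi> (Suc n) r) \<longlonglongrightarrow> v r" using lim[OF r] by (rule LIMSEQ_Suc)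
    ultimately show ?thesis using LIMSEQ_unique by blast
  qed
  with v_cont show thesis by (intro that[of v]) (auto simp: P_def)
qed

lemma radial_ivp_exists:
  fixes G :: "real \<Rightarrow> real \<Rightarrow> real"
  assumes G_cont: "\<And>x. continuous_on {0..} x \<Longrightarrow> continuous_on {0..} (\<lambda>r. G r (x r))"
    and lip: "\<And>r x y. r \<ge> 0 \<Longrightarrow> \<bar>G r x - G r y\<bar> \<le> L * \<bar>x - y\<bar>"
  obtains v v' where "v 0 = a" "\<And>T. radial_sol T (\<lambda>r. G r (v r)) v v'"
    "\<And>r. r \<ge> 0 \<Longrightarrow> (v has_real_derivative v' r) (at r within {0..})"
proof -
  obtain x where x: "continuous_on {0..} x"
    "\<And>r. r \<ge> 0 \<Longrightarrow> x r = a - radial_potential (\<lambda>s. G s (x s)) r"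
    using radial_fixed_point[of G L a, OF G_cont lip] by blast
  let ?g = "\<lambda>s. G s (x s)"
  \<comment> \<open>The fixed point equals this expression only for \<open>r \<ge> 0\<close>. Taking
    the expression itself as the solution makes the derivative rules apply directly; the source is
    then exchanged on positive radii.\<close>
  define v where "v = (\<lambda>r. a - radial_potential ?g r)"
  have g: "continuous_on {0..} ?g" using G_cont[OF x(1)] .
  show thesis
  proof (rule that)
    show "v 0 = a" by (simp add: v_def radial_potential_def)
    show "radial_sol T (\<lambda>r. G r (v r)) v (\<lambda>r. - (ball_mass ?g r / r\<^sup>2))" for T
      using radial_potential_sol[OF g, of T a] unfolding v_def
      by (rule radial_sol_cong) (use x(2) in simp)
    show "(v has_real_derivative - (ball_mass ?g r / r\<^sup>2)) (at r within {0..})" if "r \<ge> 0" for r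
      unfolding v_def using radial_potential_deriv[OF g that]
      by (auto intro!: derivative_eq_intros)
  qed
qed

section \<open>Flux and monotonicity of radial solutions\<close>

lemma radial_sol_flux_deriv:
  assumes "radial_sol T S v v'" "0 < r" "r < T"
  shows "((\<lambda>r. r\<^sup>2 * v' r) has_real_derivative - (r\<^sup>2 * S r)) (at r)"
proof -
  have "(v' has_real_derivative - (2 / r * v' r) - S r) (at r)"
    using assms by (auto simp: radial_sol_def)
  from DERIV_mult[OF DERIV_power[OF DERIV_ident, of 2] this] show ?thesis
    by (rule DERIV_cong) (use assms in \<open>simp add: field_simps power2_eq_square\<close>)
qed

lemma radial_sol_flux_cont:
  assumes "radial_sol T S v v'" "A \<subseteq> {0..<T}"
  shows "continuous_on A (\<lambda>r. r\<^sup>2 * v' r)"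
  using assms by (auto simp: radial_sol_def intro!: continuous_intros intro: continuous_on_subset)

text \<open>\<open>r^2\<close> is the integrating factor: the flux \<open>r^2 v'\<close> starts at 0
  and has derivative \<open>- r^2 S\<close>, so a nonnegative source makes it, and with it
  \<open>v'\<close>, nonpositive.\<close>

lemma radial_sol_decreasing:
  assumes sol: "radial_sol T S v v'" and S: "\<And>r. 0 < r \<Longrightarrow> r < T \<Longrightarrow> S r \<ge> 0"
  shows "0 \<le> r \<Longrightarrow> r < T \<Longrightarrow> v' r \<le> 0"
    and "0 \<le> x \<Longrightarrow> x \<le> y \<Longrightarrow> y < T \<Longrightarrow> v y \<le> v x"
proof -
  show neg: "v' r \<le> 0" if "0 \<le> r" "r < T" for r
  proof (cases "r = 0")
    case False
    then have r: "0 < r" "r < T" using that by auto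
    have "(\<lambda>r. r\<^sup>2 * v' r) r \<le> (\<lambda>r. r\<^sup>2 * v' r) 0"
    proof (rule DERIV_nonpos_imp_decreasing_open[of 0 r "\<lambda>r. r\<^sup>2 * v' r"])
      fix t assume "0 < t" "t < r"
      then show "\<exists>d. ((\<lambda>r. r\<^sup>2 * v' r) has_real_derivative d) (at t) \<and> d \<le> 0"
        using radial_sol_flux_deriv[OF sol, of t] S[of t] r
        by (intro exI[of _ "- (t\<^sup>2 * S t)"]) auto
    qed (use r in \<open>auto intro: radial_sol_flux_cont[OF sol]\<close>)
    then show ?thesis using r by (simp add: mult_le_0_iff)
  qed (use sol in \<open>simp add: radial_sol_def\<close>)
  show "v y \<le> v x" if "0 \<le> x" "x \<le> y" "y < T" for x y
  proof (rule DERIV_nonpos_imp_decreasing_open[OF that(2)])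
    fix t assume "x < t" "t < y"
    then show "\<exists>d. (v has_real_derivative d) (at t) \<and> d \<le> 0"
      using sol neg[of t] that by (intro exI[of _ "v' t"]) (auto simp: radial_sol_def)
  next
    show "continuous_on {x..y} v"
      by (rule continuous_on_subset[of "{0..<T}"]) (use sol that in \<open>auto simp: radial_sol_def\<close>)
  qed
qed

text \<open>A solution differentiable at the origin has no \<open>1 / r\<close> component, so \<open>v'\<close> is continuous
  at \<open>0\<close>.\<close>

lemma radial_sol_of_derivs:
  assumes v: "\<And>r. r \<ge> 0 \<Longrightarrow> (v has_real_derivative v' r) (at r within {0..})" and v'0: "v' 0 = 0"
    and v': "\<And>r. r > 0 \<Longrightarrow> (v' has_real_derivative - (2 / r * v' r) - S r) (at r)"
    and S: "continuous_on {0..} S"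
  shows "radial_sol T S v v'"
proof -
  have v1: "(v has_real_derivative v' r) (at r)" if "r > 0" for r
    using v[of r] at_within_halfline[OF that] that by simp
  define q where "q = (\<lambda>r. r\<^sup>2 * v' r)"
  have q_deriv: "(q has_real_derivative - (r\<^sup>2 * S r)) (at r)" if "r > 0" for r
    unfolding q_def using DERIV_mult[OF DERIV_power[OF DERIV_ident, of 2] v'[OF that]]
    by (rule DERIV_cong) (use that in \<open>simp add: field_simps power2_eq_square\<close>)
  have "continuous_on {0..1} S" by (auto intro: continuous_on_subset[OF S])
  then obtain B where B: "B > 0" "\<And>s. 0 \<le> s \<Longrightarrow> s \<le> 1 \<Longrightarrow> \<bar>S s\<bar> \<le> B"
    using continuous_on_Icc_bounded by blast
  have q_diff: "\<bar>q r - q s\<bar> \<le> B * r ^ 3" if s: "0 < s" "s < r" "r \<le> 1" for r s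
  proof -
    obtain z where z: "s < z" "z < r" "q r - q s = (r - s) * - (z\<^sup>2 * S z)"
      using MVT2[of s r q "\<lambda>z. - (z\<^sup>2 * S z)"] q_deriv s by force
    have "\<bar>q r - q s\<bar> = (r - s) * (z\<^sup>2 * \<bar>S z\<bar>)" using z s by (simp add: abs_mult)
    also have "\<dots> \<le> r * (r\<^sup>2 * B)"
      using z s B(2)[of z] by (intro mult_mono power_mono) auto
    finally show ?thesis by (simp add: power2_eq_square power3_eq_cube ac_simps)
  qed
  \<comment> \<open>The limit of \<open>q\<close> at 0 is not known yet, but together with
    \<open>q_diff\<close> it suffices that \<open>q\<close> is small at some points near 0.
    Differentiability of \<open>v\<close> at 0 bounds its increment over \<open>[t/2, t]\<close> by
    \<open>3 t / 2\<close>, and the mean value theorem yields a point with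
    \<open>\<bar>v'\<bar> \<le> 3\<close>.\<close>
  have q_small: "\<exists>s. 0 < s \<and> s < r \<and> \<bar>q s\<bar> < e" if "e > 0" "r > 0" for e r
  proof -
    have "(v has_derivative (\<lambda>h. 0)) (at 0 within {0..})"
      using v[of 0] v'0 by (simp add: has_field_derivative_def lambda_zero)
    then obtain d where d: "d > 0" "\<And>t. t \<ge> 0 \<Longrightarrow> t < d \<Longrightarrow> \<bar>v t - v 0\<bar> \<le> t"
      unfolding has_derivative_within_alt by (auto dest!: spec[of _ 1])
    \<comment> \<open>\<open>t < 1\<close> gives \<open>z^2 \<le> t\<close>, and
      \<open>t \<le> e / 6\<close> then gives \<open>3 t < e\<close>.\<close>
    define t where "t = min (min (d / 2) (r / 2)) (min (e / 6) (1 / 2))"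
    have t: "0 < t" "t < d" "t < r" "t \<le> e / 6" "t < 1" using d that by (auto simp: t_def)
    obtain z where z: "t / 2 < z" "z < t" "v t - v (t / 2) = (t - t / 2) * v' z"
      using MVT2[of "t / 2" t v v'] v1 t by force
    have "(t / 2) * \<bar>v' z\<bar> = \<bar>v t - v (t / 2)\<bar>"
      unfolding z(3) abs_mult using t by simp
    also have "\<dots> \<le> 3 / 2 * t" using d(2)[of t] d(2)[of "t / 2"] t by linarith
    finally have vz: "\<bar>v' z\<bar> \<le> 3" using t by (simp add: field_simps)
    have "\<bar>q z\<bar> = z\<^sup>2 * \<bar>v' z\<bar>" by (simp add: q_def abs_mult)
    also have "\<dots> \<le> t * 3"
    proof -
      have "z * z \<le> t * 1" using z t by (intro mult_mono) auto
      then show ?thesis using vz t by (intro mult_mono) (auto simp: power2_eq_square)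
    qed
    also have "\<dots> < e" using t that by linarith
    finally show ?thesis using z t by (intro exI[of _ z]) auto
  qed
  have q_bound: "\<bar>q r\<bar> \<le> B * r ^ 3" if r: "0 < r" "r \<le> 1" for r
  proof (rule field_le_epsilon)
    fix e :: real assume "e > 0"
    then obtain s where s: "0 < s" "s < r" "\<bar>q s\<bar> < e" using q_small[of e r] r by auto
    show "\<bar>q r\<bar> \<le> B * r ^ 3 + e" using q_diff[of s r] s r by linarith
  qed
  have "continuous (at r within {0..}) v'" if "r \<ge> 0" for r
  proof (cases "r = 0")
    case True
    have "((\<lambda>t. B * t) \<longlongrightarrow> B * 0) (at 0 within {0..})" by (intro tendsto_intros)
    then have lim: "((\<lambda>t. B * t) \<longlongrightarrow> 0) (at 0 within {0..})" by simp
    have "\<forall>\<^sub>F t in at 0 within {0..}. norm (v' t) \<le> B * t"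
      unfolding eventually_at
    proof (intro exI[of _ "1::real"] conjI ballI impI)
      fix t :: real assume t: "t \<in> {0..}" "t \<noteq> 0 \<and> dist t 0 < 1"
      then have "t\<^sup>2 * \<bar>v' t\<bar> \<le> t\<^sup>2 * (B * t)"
        using q_bound[of t] by (simp add: q_def abs_mult power2_eq_square power3_eq_cube mult.assoc mult.left_commute)
      then show "norm (v' t) \<le> B * t" using t by simp
    qed simp
    then have "(v' \<longlongrightarrow> 0) (at 0 within {0..})" by (rule Lim_null_comparison[OF _ lim])
    then show ?thesis using True v'0 by (simp add: continuous_within)
  next
    case False
    then show ?thesis using that DERIV_isCont[OF v'[of r]]
      by (simp add: continuous_at_imp_continuous_at_within)
  qed
  then have "continuous_on {0..} v'" by (simp add: continuous_on_eq_continuous_within)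
  moreover have "continuous_on {0..} v"
    using v by (auto simp: continuous_on_eq_continuous_within intro!: DERIV_continuous)
  ultimately show ?thesis
    unfolding radial_sol_def using v1 v' v'0 by (auto intro: continuous_on_subset)
qed

section \<open>The linearized problem\<close>

lemma first_zero:
  fixes g :: "real \<Rightarrow> real"
  assumes "continuous_on {a..b} g" "a \<le> b" "g a > 0" "g b \<le> 0"
  obtains c where "a < c" "c \<le> b" "g c = 0" "\<And>x. a \<le> x \<Longrightarrow> x < c \<Longrightarrow> g x > 0"
proof -
  define Z where "Z = {x \<in> {a..b}. g x = 0}"
  have "closed Z"
    unfolding Z_def using continuous_closed_preimage_constant[OF assms(1)] by simp
  moreover have "Z \<subseteq> {a..b}" by (auto simp: Z_def)
  ultimately have "compact Z"
    using compact_eq_bounded_closed bounded_subset bounded_closed_interval by metis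
  moreover have "Z \<noteq> {}"
    using IVT2'[of g b 0 a] assms by (force simp: Z_def)
  ultimately obtain c where c: "c \<in> Z" "\<And>x. x \<in> Z \<Longrightarrow> c \<le> x"
    using compact_attains_inf by metis
  have "g x > 0" if x: "a \<le> x" "x < c" for x
  proof (rule ccontr)
    assume "\<not> g x > 0"
    then have "g x \<le> 0" by simp
    moreover have "continuous_on {a..x} g"
      using assms(1) by (rule continuous_on_subset) (use that c in \<open>auto simp: Z_def\<close>)
    ultimately obtain y where "a \<le> y" "y \<le> x" "g y = 0"
      using IVT2'[of g x 0 a] assms(3) x(1) by auto
    then show False using c(2)[of y] that c(1) by (auto simp: Z_def)
  qed
  moreover have "a \<noteq> c" using c(1) assms(3) by (auto simp: Z_def)
  ultimately show thesis using c(1) by (intro that[of c]) (auto simp: Z_def)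
qed

text \<open>The structure equation in first-order form: \<open>m = - r^2 v'\<close> is the mass
  inside radius \<open>r\<close> when \<open>f\<close> is \<open>4 \<pi>\<close> times the density.
  \<open>f_superlinear\<close> is the condition \<open>p' < h\<close> transported to the inverse of
  the enthalpy.\<close>

locale star_profile =
  fixes f f' v m :: "real \<Rightarrow> real" and R :: real
  assumes R_pos: "R > 0"
    and f_deriv: "\<And>y. (f has_real_derivative f' y) (at y)"
    and f_zero: "f 0 = 0"
    and f_pos: "\<And>y. y > 0 \<Longrightarrow> f y > 0"
    and f_superlinear: "\<And>y. y > 0 \<Longrightarrow> f y < y * f' y"
    and v_cont: "continuous_on {0..R} v"
    and m_cont: "continuous_on {0..R} m"
    and m_zero: "m 0 = 0"
    and v_deriv: "\<And>r. 0 < r \<Longrightarrow> r < R \<Longrightarrow> (v has_real_derivative - m r / r\<^sup>2) (at r)"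
    and m_deriv: "\<And>r. 0 < r \<Longrightarrow> r < R \<Longrightarrow> (m has_real_derivative r\<^sup>2 * f (v r)) (at r)"
    and v_pos: "\<And>r. 0 \<le> r \<Longrightarrow> r < R \<Longrightarrow> v r > 0"
    and v_end: "v R = 0"
begin

section \<open>Monotonicity and mass estimates for the unperturbed star\<close>

lemma f'_pos: "y > 0 \<Longrightarrow> f' y > 0"
  using f_superlinear[of y] f_pos[of y] by (meson less_trans zero_less_mult_pos)

lemma f_cont: "continuous_on A f"
  by (meson DERIV_isCont continuous_at_imp_continuous_on f_deriv)

lemma f_mono: "0 \<le> x \<Longrightarrow> x \<le> y \<Longrightarrow> f x \<le> f y"
  by (rule DERIV_nonneg_imp_increasing_open)
    (auto intro!: f_cont exI[of _ "f' _"] f_deriv less_imp_le f'_pos)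

text \<open>This compares \<open>f\<close> with the linear law of slope
  \<open>f (v c) / v c\<close>: since \<open>v\<close> decreases, \<open>f(v)\<close> lies above it
  inside radius \<open>c\<close> and below it outside.\<close>

lemma f_ratio_mono:
  assumes "0 < x" "x \<le> y" shows "f x / x \<le> f y / y"
proof (rule DERIV_nonneg_imp_nondecreasing[OF assms(2)])
  fix t assume "x \<le> t" "t \<le> y"
  then have "t > 0" using assms by simp
  then have "((\<lambda>t. f t / t) has_real_derivative (f' t * t - f t) / (t * t)) (at t)"
    by (auto intro!: derivative_eq_intros f_deriv)
  moreover have "(f' t * t - f t) / (t * t) \<ge> 0"
    using f_superlinear[OF \<open>t > 0\<close>] by (simp add: mult.commute)
  ultimately show "\<exists>y. ((\<lambda>t. f t / t) has_real_derivative y) (at t) \<and> 0 \<le> y" by blast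
qed

lemma v_nonneg: "0 \<le> r \<Longrightarrow> r \<le> R \<Longrightarrow> v r \<ge> 0"
  using v_pos[of r] v_end by (cases "r = R") auto

lemma m_mono: assumes "0 \<le> x" "x \<le> y" "y \<le> R" shows "m x \<le> m y"
proof (rule DERIV_nonneg_imp_increasing_open[OF assms(2)])
  fix t assume "x < t" "t < y"
  then show "\<exists>d. (m has_real_derivative d) (at t) \<and> 0 \<le> d"
    using m_deriv[of t] v_nonneg[of t] assms f_pos[of "v t"] v_pos[of t]
    by (intro exI[of _ "t\<^sup>2 * f (v t)"]) auto
qed (use assms in \<open>auto intro: continuous_on_subset[OF m_cont]\<close>)

lemma m_nonneg: "0 \<le> x \<Longrightarrow> x \<le> R \<Longrightarrow> m x \<ge> 0"
  using m_mono[of 0 x] m_zero by simp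

lemma v_antimono: assumes "0 \<le> x" "x \<le> y" "y \<le> R" shows "v y \<le> v x"
proof (rule DERIV_nonpos_imp_decreasing_open[OF assms(2)])
  fix t assume "x < t" "t < y"
  then show "\<exists>d. (v has_real_derivative d) (at t) \<and> d \<le> 0"
    using v_deriv[of t] m_nonneg[of t] assms
    by (intro exI[of _ "- m t / t\<^sup>2"]) auto
qed (use assms in \<open>auto intro: continuous_on_subset[OF v_cont]\<close>)

lemma fv_cont: "continuous_on {0..R} (\<lambda>r. f (v r))"
  using continuous_on_compose2[OF f_cont v_cont] by blast

lemma fv_deriv: "0 < r \<Longrightarrow> r < R \<Longrightarrow>
    ((\<lambda>r. f (v r)) has_real_derivative f' (v r) * (- m r / r\<^sup>2)) (at r)"
  using DERIV_chain2[OF f_deriv v_deriv] by auto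

text \<open>A crude bound without the factor 1/3; its purpose is that \<open>m / r\<close>, that is
  \<open>- r v'\<close>, tends to 0 at the centre, so that Wronskians can be started there.\<close>

lemma m_upper: assumes "0 \<le> r" "r \<le> R" shows "m r \<le> f (v 0) * r ^ 3"
proof -
  have "(\<lambda>r. f (v 0) * r ^ 3 - m r) 0 \<le> (\<lambda>r. f (v 0) * r ^ 3 - m r) r"
  proof (rule DERIV_nonneg_imp_increasing_open[OF assms(1)])
    fix t assume t: "0 < t" "t < r"
    have "f (v t) \<le> f (v 0)" "0 \<le> f (v t)"
      using t assms v_nonneg[of t] v_antimono[of 0 t] f_pos[of "v t"] v_pos[of t]
      by (auto intro!: f_mono)
    then have "t\<^sup>2 * f (v t) \<le> t\<^sup>2 * f (v 0)" "0 \<le> t\<^sup>2 * f (v 0)"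
      by (auto intro!: mult_left_mono)
    then have "f (v 0) * (3 * t\<^sup>2) - t\<^sup>2 * f (v t) \<ge> 0" by (simp add: mult.commute)
    moreover have "((\<lambda>r. f (v 0) * r ^ 3 - m r) has_real_derivative
        f (v 0) * (3 * t\<^sup>2) - t\<^sup>2 * f (v t)) (at t)"
      using t assms by (auto intro!: derivative_eq_intros m_deriv)
    ultimately show "\<exists>d. ((\<lambda>r. f (v 0) * r ^ 3 - m r) has_real_derivative d) (at t) \<and> 0 \<le> d"
      by blast
  qed (use assms in \<open>auto intro!: continuous_intros continuous_on_subset[OF m_cont]\<close>)
  then show ?thesis by (simp add: m_zero)
qed

lemma m_div_cont: "continuous_on {0..R} (\<lambda>r. m r / r)"
proof -
  have "continuous (at r within {0..R}) (\<lambda>r. m r / r)" if "r \<in> {0..R}" for r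
  proof (cases "r = 0")
    case True
    have "((\<lambda>r. f (v 0) * r\<^sup>2) \<longlongrightarrow> f (v 0) * 0\<^sup>2) (at 0 within {0..R})"
      by (intro tendsto_intros)
    then have lim: "((\<lambda>r. f (v 0) * r\<^sup>2) \<longlongrightarrow> 0) (at 0 within {0..R})" by simp
    have "((\<lambda>r. m r / r) \<longlongrightarrow> 0) (at 0 within {0..R})"
    proof (rule Lim_null_comparison[OF _ lim])
      have "norm (m r / r) \<le> f (v 0) * r\<^sup>2" if "0 < r" "r \<le> R" for r
        using m_upper[of r] m_nonneg[of r] that
        by (simp add: divide_le_eq power2_eq_square power3_eq_cube ac_simps)
      then show "\<forall>\<^sub>F r in at 0 within {0..R}. norm (m r / r) \<le> f (v 0) * r\<^sup>2"
        by (auto simp: eventually_at_filter intro!: always_eventually)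
    qed
    then show ?thesis using True by (simp add: continuous_within m_zero)
  next
    case False
    have "continuous (at r within {0..R}) m"
      using m_cont that by (auto simp: continuous_on_eq_continuous_within)
    with False show ?thesis by (intro continuous_intros)
  qed
  then show ?thesis by (simp add: continuous_on_eq_continuous_within)
qed

text \<open>The density decreases outward, so its value at the boundary of a ball is at most its
  mean over the ball; that is \<open>le\<close>. The derivative of the mean is a positive multiple
  of the difference of the two.\<close>

lemma mean_density: assumes "0 < r" "r \<le> c" "c \<le> R" shows "m c / c ^ 3 \<le> m r / r ^ 3"
proof -
  have le: "t ^ 3 * f (v t) \<le> 3 * m t" if "0 \<le> t" "t \<le> R" for t
  proof -
    have "(\<lambda>t. 3 * m t - t ^ 3 * f (v t)) 0 \<le> (\<lambda>t. 3 * m t - t ^ 3 * f (v t)) t"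
    proof (rule DERIV_nonneg_imp_increasing_open[OF that(1)])
      fix s assume s: "0 < s" "s < t"
      have "((\<lambda>t. 3 * m t - t ^ 3 * f (v t)) has_real_derivative s * f' (v s) * m s) (at s)"
        using s that
        by (auto intro!: derivative_eq_intros m_deriv fv_deriv
            simp: field_simps power2_eq_square power3_eq_cube)
      moreover have "s * f' (v s) * m s \<ge> 0"
        using s that m_nonneg[of s] f'_pos[of "v s"] v_pos[of s] by simp
      ultimately show "\<exists>d. ((\<lambda>t. 3 * m t - t ^ 3 * f (v t)) has_real_derivative d) (at s) \<and> 0 \<le> d"
        by blast
    qed (use that in \<open>auto intro!: continuous_intros continuous_on_subset[OF m_cont]
        continuous_on_subset[OF fv_cont]\<close>)
    then show ?thesis by (simp add: m_zero)
  qed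
  show ?thesis
  proof (rule DERIV_nonpos_imp_decreasing_open[OF assms(2)])
    fix t assume t: "r < t" "t < c"
    have "((\<lambda>r. m r / r ^ 3) has_real_derivative
        (t\<^sup>2 * f (v t) * t ^ 3 - m t * (3 * t\<^sup>2)) / (t ^ 3 * t ^ 3)) (at t)"
      using t assms by (auto intro!: derivative_eq_intros m_deriv)
    moreover have "t\<^sup>2 * f (v t) * t ^ 3 - m t * (3 * t\<^sup>2) = t\<^sup>2 * (t ^ 3 * f (v t) - 3 * m t)"
      by (simp add: algebra_simps)
    moreover have "\<dots> \<le> 0"
      using le[of t] t assms by (intro mult_nonneg_nonpos) auto
    ultimately show "\<exists>d. ((\<lambda>r. m r / r ^ 3) has_real_derivative d) (at t) \<and> d \<le> 0"
      using t assms by (metis divide_nonpos_nonneg zero_le_power2 power2_eq_square)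
  qed (use assms in \<open>auto intro!: continuous_intros continuous_on_subset[OF m_cont]\<close>)
qed

text \<open>The mean density bounds \<open>- v'\<close> below by \<open>D r\<close>, hence
  \<open>v\<close> below by a parabola through \<open>v c\<close>; \<open>f(v)\<close> is at least
  \<open>lam * v\<close>. Integrating \<open>r^2\<close> times this bound over \<open>[0, c]\<close>
  gives the left side, with \<open>1/15 = (1/3 - 1/5) / 2\<close>. Read backwards, it bounds
  \<open>lam * c^2\<close> from above.\<close>

lemma inner_mass_lower:
  assumes "0 < c" "c < R"
  shows "f (v c) / v c * (v c * c ^ 3 / 3 + m c * c\<^sup>2 / 15) \<le> m c"
proof -
  define lam where "lam = f (v c) / v c"
  define D where "D = m c / c ^ 3"
  have vc: "v c > 0" using v_pos assms by simp
  have lower: "v c + D * (c\<^sup>2 - r\<^sup>2) / 2 \<le> v r" if "0 < r" "r \<le> c" for r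
  proof -
    have "(\<lambda>r. v r + D * r\<^sup>2 / 2) c \<le> (\<lambda>r. v r + D * r\<^sup>2 / 2) r"
    proof (rule DERIV_nonpos_imp_decreasing_open[OF that(2)])
      fix t assume t: "r < t" "t < c"
      have "((\<lambda>r. v r + D * r\<^sup>2 / 2) has_real_derivative - m t / t\<^sup>2 + D * t) (at t)"
        using t that assms by (auto intro!: derivative_eq_intros v_deriv)
      moreover have "D * t \<le> m t / t\<^sup>2"
        using mean_density[of t c] t that assms
        by (simp add: D_def field_simps power2_eq_square power3_eq_cube)
      ultimately show "\<exists>d. ((\<lambda>r. v r + D * r\<^sup>2 / 2) has_real_derivative d) (at t) \<and> d \<le> 0"
        by (intro exI conjI) auto
    qed (use assms that in \<open>auto intro!: continuous_intros continuous_on_subset[OF v_cont]\<close>)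
    then show ?thesis by (simp add: field_simps)
  qed
  \<comment> \<open>The mass minus the integral up to \<open>r\<close> of the parabolic lower
    bound.\<close>
  define K where "K = (\<lambda>r. m r - lam * (v c * r ^ 3 / 3 + D * (c\<^sup>2 * r ^ 3 / 3 - r ^ 5 / 5) / 2))"
  have "K 0 \<le> K c"
  proof (rule DERIV_nonneg_imp_increasing_open[of 0 c K])
    fix t assume t: "0 < t" "t < c"
    have "(K has_real_derivative t\<^sup>2 * f (v t) - lam * (v c * t\<^sup>2 + D * (c\<^sup>2 * t\<^sup>2 - t ^ 4) / 2)) (at t)"
      unfolding K_def using t assms by (auto intro!: derivative_eq_intros m_deriv)
    moreover have "t\<^sup>2 * f (v t) - lam * (v c * t\<^sup>2 + D * (c\<^sup>2 * t\<^sup>2 - t ^ 4) / 2)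
        = t\<^sup>2 * (f (v t) - lam * (v c + D * (c\<^sup>2 - t\<^sup>2) / 2))"
      by (simp add: algebra_simps power4_eq_xxxx power2_eq_square)
    moreover have "lam * (v c + D * (c\<^sup>2 - t\<^sup>2) / 2) \<le> f (v t)"
    proof -
      have "lam \<ge> 0" using vc f_pos[of "v c"] by (simp add: lam_def)
      then have "lam * (v c + D * (c\<^sup>2 - t\<^sup>2) / 2) \<le> lam * v t"
        using lower[of t] t by (intro mult_left_mono) auto
      also have "\<dots> \<le> f (v t) / v t * v t"
        unfolding lam_def using t assms vc v_pos[of t] v_antimono[of t c]
        by (intro mult_right_mono f_ratio_mono) auto
      also have "\<dots> = f (v t)" using v_pos[of t] t assms by simp
      finally show ?thesis .
    qed
    ultimately show "\<exists>d. (K has_real_derivative d) (at t) \<and> 0 \<le> d"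
      by (metis diff_ge_0_iff_ge mult_nonneg_nonneg zero_le_power2)
  qed (use assms in \<open>auto simp: K_def intro!: continuous_intros continuous_on_subset[OF m_cont]\<close>)
  moreover have "v c * c ^ 3 / 3 + D * (c\<^sup>2 * c ^ 3 / 3 - c ^ 5 / 5) / 2
      = v c * c ^ 3 / 3 + m c * c\<^sup>2 / 15"
    using assms by (simp add: D_def field_simps power2_eq_square power3_eq_cube eval_nat_numeral)
  ultimately show ?thesis using m_zero by (simp add: K_def lam_def)
qed

text \<open>The function \<open>u = r v\<close> satisfies \<open>u'' = - r f(v)\<close> and decreases on \<open>[c, R]\<close>. The energy
  \<open>u'\<^sup>2 + (f(v(c)) / v(c)) u\<^sup>2\<close> is nonincreasing there, which bounds \<open>u'(R)\<close>; and \<open>r f(v)\<close> is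
  nonincreasing, so \<open>- u'\<close> lies above its chord, which bounds \<open>R - c\<close>.\<close>

lemma mass_le_twice:
  assumes c: "0 < c" "c < R" and large: "2 * c * v c \<le> m c"
  shows "m R \<le> 2 * m c"
proof -
  define lam where "lam = f (v c) / v c"
  \<comment> \<open>\<open>p\<close> is minus the derivative of \<open>r v\<close>. Because
    \<open>v R = 0\<close>, its end value \<open>p R\<close> is \<open>m R / R\<close>, the quantity
    to be bounded.\<close>
  define p where "p = (\<lambda>r. m r / r - v r)"
  have vc: "v c > 0" using v_pos c by simp
  have lam0: "lam \<ge> 0" using vc f_pos[of "v c"] by (simp add: lam_def)
  have u_deriv: "((\<lambda>r. r * v r) has_real_derivative - p r) (at r)" if "c < r" "r < R" for r
    using that c by (auto intro!: derivative_eq_intros v_deriv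
        simp: p_def field_simps power2_eq_square)
  have p_deriv: "(p has_real_derivative r * f (v r)) (at r)" if "c < r" "r < R" for r
    unfolding p_def using that c
    by (auto intro!: derivative_eq_intros v_deriv m_deriv simp: field_simps power2_eq_square)
  have p_cont: "continuous_on {x..y} p" if "c \<le> x" "y \<le> R" for x y
    unfolding p_def using that c
    by (auto intro!: continuous_intros continuous_on_subset[OF m_cont] continuous_on_subset[OF v_cont])
  have v_cont': "continuous_on {x..y} v" if "c \<le> x" "y \<le> R" for x y
    using that c by (auto intro!: continuous_on_subset[OF v_cont])
  have fv: "f (v r) \<ge> 0" if "c \<le> r" "r < R" for r
    using f_pos[of "v r"] v_pos[of r] that c by simp
  have p_mono: "p x \<le> p y" if "c \<le> x" "x \<le> y" "y \<le> R" for x y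
  proof (rule DERIV_nonneg_imp_increasing_open[OF that(2) _ p_cont])
    fix t assume "x < t" "t < y"
    then show "\<exists>d. (p has_real_derivative d) (at t) \<and> 0 \<le> d"
      using p_deriv[of t] fv[of t] that c by (intro exI[of _ "t * f (v t)"]) auto
  qed (use that in auto)
  have pc: "v c \<le> p c" using large c by (simp add: p_def field_simps)
  have p_pos: "p r \<ge> 0" if "c \<le> r" "r \<le> R" for r
    using p_mono[of c r] pc vc that by simp
  have energy: "(p R)\<^sup>2 \<le> (p c)\<^sup>2 + lam * (c * v c)\<^sup>2"
  proof -
    have "(\<lambda>r. (p r)\<^sup>2 + lam * (r * v r)\<^sup>2) R \<le> (\<lambda>r. (p r)\<^sup>2 + lam * (r * v r)\<^sup>2) c"
    proof (rule DERIV_nonpos_imp_decreasing_open[of c R])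
      fix t assume t: "c < t" "t < R"
      have "((\<lambda>r. (p r)\<^sup>2 + lam * (r * v r)\<^sup>2) has_real_derivative
          2 * p t * (t * f (v t)) + lam * (2 * (t * v t) * (- p t))) (at t)"
        using DERIV_add[OF DERIV_power[OF p_deriv[OF t], of 2]
            DERIV_cmult[OF DERIV_power[OF u_deriv[OF t], of 2], of lam]]
        by (simp add: mult_ac)
      moreover have "2 * p t * (t * f (v t)) + lam * (2 * (t * v t) * (- p t))
          = 2 * p t * t * (f (v t) - lam * v t)" by (simp add: algebra_simps)
      moreover have "f (v t) \<le> lam * v t"
        using f_ratio_mono[of "v t" "v c"] v_pos[of t] v_antimono[of c t] t c
        by (simp add: lam_def field_simps)
      ultimately show "\<exists>d. ((\<lambda>r. (p r)\<^sup>2 + lam * (r * v r)\<^sup>2) has_real_derivative d) (at t) \<and> d \<le> 0"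
        using p_pos[of t] t c by (intro exI[of _ "2 * p t * t * (f (v t) - lam * v t)"])
          (auto intro!: mult_nonneg_nonpos)
    qed (use c in \<open>auto intro!: continuous_intros p_cont v_cont'\<close>)
    then show ?thesis by (simp add: v_end)
  qed
  have chord: "(R - c) * (p c + p R) \<le> 2 * (c * v c)"
  proof -
    \<comment> \<open>Twice the integral of \<open>p\<close> over \<open>[c, r]\<close> minus twice
      the trapezoid. The derivative \<open>p r - p c - (r - c) p'(r)\<close> is nonnegative because
      \<open>p\<close> is concave.\<close>
    define G where "G = (\<lambda>r. 2 * (c * v c - r * v r) - (r - c) * (p c + p r))"
    have "G c \<le> G R"
    proof (rule DERIV_nonneg_imp_increasing_open[of c R G])
      fix r assume r: "c < r" "r < R"
      have "(G has_real_derivative p r - p c - (r - c) * (r * f (v r))) (at r)"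
        unfolding G_def
        using DERIV_diff[OF DERIV_cmult[OF DERIV_diff[OF DERIV_const[of "c * v c"] u_deriv[OF r]], of 2]
            DERIV_mult[OF DERIV_diff[OF DERIV_ident DERIV_const[of c]]
              DERIV_add[OF DERIV_const[of "p c"] p_deriv[OF r]]]]
        by (rule DERIV_cong) (simp add: algebra_simps)
      moreover have "(r - c) * (r * f (v r)) \<le> p r - p c"
      proof -
        obtain x where x: "c < x" "x < r" "p r - p c = (r - c) * (x * f (v x))"
        proof -
          obtain l x where x: "c < x" "x < r" "(p has_real_derivative l) (at x)" "p r - p c = (r - c) * l"
            using MVT[OF r(1), of p] p_cont[of c r] p_deriv r by (force simp: real_differentiable_def)
          moreover have "l = x * f (v x)"
            using DERIV_unique[OF x(3) p_deriv] x r by auto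
          ultimately show ?thesis using that by blast
        qed
        have u_anti: "r * v r \<le> x * v x"
        proof (rule DERIV_nonpos_imp_decreasing_open[of x r "\<lambda>r. r * v r"])
          fix t assume "x < t" "t < r"
          then show "\<exists>d. ((\<lambda>r. r * v r) has_real_derivative d) (at t) \<and> d \<le> 0"
            using u_deriv[of t] p_pos[of t] x r by (intro exI[of _ "- p t"]) auto
        qed (use x r in \<open>auto intro!: continuous_intros v_cont'\<close>)
        have pos: "v r > 0" "v x > 0" "v r \<le> v x"
          using v_pos[of r] v_pos[of x] v_antimono[of x r] x r c by auto
        \<comment> \<open>The derivative of \<open>p\<close> is the product of the two nonincreasing
          factors \<open>f(v) / v\<close> and \<open>r v\<close>.\<close>
        have "r * f (v r) = f (v r) / v r * (r * v r)" using pos by simp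
        also have "\<dots> \<le> f (v x) / v x * (x * v x)"
          using u_anti f_ratio_mono[of "v r" "v x"] pos f_pos[of "v x"] r c
          by (intro mult_mono[of "f (v r) / v r"]) auto
        also have "\<dots> = x * f (v x)" using pos by simp
        finally show ?thesis using x r by (simp add: mult_left_mono)
      qed
      ultimately show "\<exists>d. (G has_real_derivative d) (at r) \<and> 0 \<le> d"
        by (intro exI conjI) auto
    qed (use c in \<open>auto simp: G_def intro!: continuous_intros p_cont v_cont'\<close>)
    then show ?thesis by (simp add: G_def v_end)
  qed
  \<comment> \<open>In units of \<open>v c\<close> and \<open>c\<close> the masses are
    \<open>m c = c v(c) (1 + k)\<close> and \<open>m R = R v(c) x\<close>, so the goal becomes
    \<open>R x \<le> 2 c (1 + k)\<close>, an inequality about \<open>k\<close>, \<open>x\<close> and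
    \<open>\<rho>\<close>.\<close>
  define k x where "k = p c / v c" and "x = p R / v c"
  define \<rho> where "\<rho> = lam * c\<^sup>2"
  have k1: "k \<ge> 1" using pc vc by (simp add: k_def)
  have mc: "m c = c * v c * (1 + k)" using c vc by (simp add: k_def p_def field_simps)
  have mR: "m R = R * v c * x" using c vc by (simp add: x_def p_def v_end field_simps)
  have xk: "x \<ge> k" using p_mono[of c R] c vc by (simp add: x_def k_def divide_right_mono)
  have "lam * (v c * c ^ 3 / 3 + m c * c\<^sup>2 / 15) \<le> m c"
    using inner_mass_lower[OF c] by (simp add: lam_def)
  also have "lam * (v c * c ^ 3 / 3 + m c * c\<^sup>2 / 15) = (c * v c) * (\<rho> * (1 / 3 + (1 + k) / 15))"
    unfolding mc \<rho>_def by (simp add: field_simps power2_eq_square power3_eq_cube)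
  finally have "\<rho> * (1 / 3 + (1 + k) / 15) \<le> 1 + k"
    unfolding mc using c vc by simp
  \<comment> \<open>With \<open>k \<ge> 1\<close> the coefficient is at least 7/15, so
    \<open>\<rho> \<le> 15 (1 + k) / 7 \<le> 30 k / 7\<close>, rounded up to \<open>5 k\<close>. The
    further weakening to \<open>3 k^2 + 2 k\<close> is what the case \<open>x > 2 k\<close> below
    can afford.\<close>
  moreover have "\<rho> * (1 / 3 + (1 + 1) / 15) \<le> \<rho> * (1 / 3 + (1 + k) / 15)"
    using k1 lam0 by (intro mult_left_mono) (auto simp: \<rho>_def)
  ultimately have "\<rho> \<le> 5 * k" using k1 by simp
  moreover have "k \<le> k * k" using k1 mult_left_mono[of 1 k k] by simp
  ultimately have rho: "\<rho> \<le> 3 * (k * k) + 2 * k" by linarith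
  have "x\<^sup>2 \<le> k\<^sup>2 + \<rho>"
  proof -
    have "(p R)\<^sup>2 / (v c)\<^sup>2 \<le> ((p c)\<^sup>2 + lam * (c * v c)\<^sup>2) / (v c)\<^sup>2"
      using energy by (intro divide_right_mono) auto
    also have "\<dots> = k\<^sup>2 + \<rho>"
      using vc by (simp add: k_def \<rho>_def field_simps power2_eq_square)
    finally show ?thesis by (simp add: x_def power_divide)
  qed
  then have x2: "x * x \<le> 4 * (k * k) + 2 * k" using rho by (simp add: power2_eq_square)
  have quad: "x * x - k * x \<le> 2 * k + 2 * (k * k)"
  proof (cases "x \<le> 2 * k")
    case True
    have "x * (x - k) \<le> (2 * k) * k" using True xk k1 by (intro mult_mono) auto
    then show ?thesis using k1 by (simp add: algebra_simps)
  next
    case False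
    then have "k * (2 * k) \<le> k * x" using k1 by (intro mult_left_mono) auto
    then show ?thesis using x2 by linarith
  qed
  have "(R - c) * (k + x) \<le> 2 * c"
  proof -
    have "(R - c) * (k + x) = (R - c) * (p c + p R) / v c"
      by (simp add: k_def x_def add_divide_distrib[symmetric])
    also have "\<dots> \<le> 2 * (c * v c) / v c" using chord vc by (intro divide_right_mono) auto
    finally show ?thesis using vc by simp
  qed
  then have "x * ((R - c) * (k + x)) \<le> x * (2 * c)" using xk k1 by (intro mult_left_mono) auto
  then have "R * x * (k + x) \<le> c * (x * (k + x) + 2 * x)" by (simp add: algebra_simps)
  also have "\<dots> \<le> c * (2 * (1 + k) * (k + x))"
    using quad c by (intro mult_left_mono) (auto simp: algebra_simps)
  finally have "(R * x) * (k + x) \<le> (2 * c * (1 + k)) * (k + x)" by (simp add: mult.assoc mult.left_commute)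
  then have "R * x \<le> 2 * c * (1 + k)" using xk k1 by simp
  then have "(R * x) * v c \<le> (2 * c * (1 + k)) * v c" using vc by simp
  then show ?thesis unfolding mc mR by (simp add: ac_simps)
qed

end

text \<open>\<open>w\<close> solves the linearized equation and \<open>\<mu> = r^2 w'\<close> is its
  flux. \<open>f_subquadratic\<close> is the condition \<open>h \<le> 2 p'\<close> transported to
  the inverse of the enthalpy.\<close>

locale star_variation = star_profile +
  fixes w \<mu> :: "real \<Rightarrow> real"
  assumes f_subquadratic: "\<And>y. y > 0 \<Longrightarrow> y * f' y \<le> 2 * f y"
    and w_cont: "continuous_on {0..R} w"
    and mu_cont: "continuous_on {0..R} \<mu>"
    and w_zero: "w 0 > 0"
    and mu_zero: "\<mu> 0 = 0"
    and w_deriv: "\<And>r. 0 < r \<Longrightarrow> r < R \<Longrightarrow> (w has_real_derivative \<mu> r / r\<^sup>2) (at r)"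
    and mu_deriv: "\<And>r. 0 < r \<Longrightarrow> r < R \<Longrightarrow> (\<mu> has_real_derivative - (r\<^sup>2 * f' (v r) * w r)) (at r)"
begin

section \<open>The flux of the linearized solution\<close>

lemma mu_neg:
  assumes "0 < c" "c \<le> R" and pos: "\<And>r. 0 \<le> r \<Longrightarrow> r < c \<Longrightarrow> w r > 0"
  shows "\<mu> c < 0"
proof -
  have "\<mu> c < \<mu> 0"
  proof (rule DERIV_neg_imp_decreasing_open[of 0 c \<mu>])
    fix t assume t: "0 < t" "t < c"
    then have "t\<^sup>2 * f' (v t) * w t > 0"
      using assms v_pos[of t] by (auto intro!: mult_pos_pos f'_pos)
    then show "\<exists>d. (\<mu> has_real_derivative d) (at t) \<and> d < 0"
      using mu_deriv[of t] t assms by (intro exI[of _ "- (t\<^sup>2 * f' (v t) * w t)"]) auto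
  qed (use assms in \<open>auto intro: continuous_on_subset[OF mu_cont]\<close>)
  then show ?thesis by (simp add: mu_zero)
qed

text \<open>With \<open>z = r v' + 2 v\<close> and \<open>L = \<Delta> + f'(v)\<close> one has \<open>L z = 2 (f'(v) v - 2 f(v)) \<le> 0\<close>,
  so the Wronskian of \<open>w\<close> and \<open>z\<close> is monotone up to the first zero of \<open>w\<close>.\<close>

lemma first_zero_late:
  assumes c: "0 < c" "c < R" and wc: "w c = 0"
    and pos: "\<And>r. 0 \<le> r \<Longrightarrow> r < c \<Longrightarrow> w r > 0"
  shows "2 * c * v c \<le> m c"
proof -
  \<comment> \<open>\<open>r^2\<close> times the Wronskian \<open>z w' - w z'\<close> for
    \<open>z = 2 v - m / r\<close>, whose flux is \<open>r^2 z' = - (m + r^3 f(v))\<close>.\<close>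
  define W where "W = (\<lambda>r. w r * (m r + r ^ 3 * f (v r)) + (2 * v r - m r / r) * \<mu> r)"
  have "W 0 \<le> W c"
  proof (rule DERIV_nonneg_imp_increasing_open[of 0 c W])
    fix t assume t: "0 < t" "t < c"
    have t0: "0 < t" "t < R" using t c by auto
    have quot: "((\<lambda>r. m r / r) has_real_derivative (t * f (v t) - m t / t\<^sup>2)) (at t)"
      using t0 by (auto intro!: derivative_eq_intros m_deriv simp: field_simps power2_eq_square)
    have "(W has_real_derivative 2 * t\<^sup>2 * w t * (2 * f (v t) - v t * f' (v t))) (at t)"
      unfolding W_def
      using DERIV_add[OF
          DERIV_mult[OF w_deriv[OF t0] DERIV_add[OF m_deriv[OF t0] DERIV_mult[OF DERIV_pow[of 3] fv_deriv[OF t0]]]]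
          DERIV_mult[OF DERIV_diff[OF DERIV_cmult[OF v_deriv[OF t0], of 2] quot] mu_deriv[OF t0]]]
      by (rule DERIV_cong) (use t0 in \<open>simp add: field_simps power2_eq_square power3_eq_cube\<close>)
    moreover have "2 * t\<^sup>2 * w t * (2 * f (v t) - v t * f' (v t)) \<ge> 0"
      using t c pos[of t] v_pos[of t] f_subquadratic[of "v t"] by (intro mult_nonneg_nonneg) auto
    ultimately show "\<exists>d. (W has_real_derivative d) (at t) \<and> 0 \<le> d" by blast
  qed (use c in \<open>auto simp: W_def intro!: continuous_intros
      continuous_on_subset[OF m_div_cont] continuous_on_subset[OF m_cont] continuous_on_subset[OF v_cont]
      continuous_on_subset[OF fv_cont] continuous_on_subset[OF w_cont] continuous_on_subset[OF mu_cont]\<close>)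
  \<comment> \<open>At \<open>c\<close> only the term with \<open>z\<close> survives; since the flux
    of \<open>w\<close> is negative there, \<open>z\<close> must be nonpositive, which is the
    claim.\<close>
  then have "0 \<le> (2 * v c - m c / c) * \<mu> c"
    by (simp add: W_def wc mu_zero m_zero)
  moreover have "\<mu> c < 0" using mu_neg[of c] c pos by auto
  ultimately have "2 * v c - m c / c \<le> 0" by (simp add: zero_le_mult_iff)
  then show ?thesis using c by (simp add: field_simps)
qed

text \<open>Beyond the first zero \<open>c\<close> of \<open>w\<close> the comparison function is
  \<open>g = r v' + (m(c) - m(R)) / c + m(R) / r\<close>. It vanishes at \<open>c\<close>, is nonincreasing, and satisfies
  \<open>L g = f'(v) A - 2 f(v)\<close> with \<open>A = (m(c) - m(R)) / c + m(R) / r\<close>; the bound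
  \<open>m(R) \<le> 2 m(c)\<close> gives \<open>A \<ge> 2 v\<close>, whence \<open>L g > 0\<close>.\<close>

lemma mu_end_nonzero: "\<mu> R \<noteq> 0"
proof (cases "\<forall>r. 0 \<le> r \<and> r < R \<longrightarrow> w r > 0")
  case True
  then show ?thesis using mu_neg[of R] R_pos by auto
next
  case False
  then obtain b where b: "0 \<le> b" "b < R" "w b \<le> 0" by force
  have "continuous_on {0..b} w" using b by (auto intro: continuous_on_subset[OF w_cont])
  then obtain c where c: "0 < c" "c \<le> b" "w c = 0" and pos: "\<And>x. 0 \<le> x \<Longrightarrow> x < c \<Longrightarrow> w x > 0"
    using first_zero[of 0 b w] b w_zero by blast
  have cR: "c < R" using b c by simp
  have mc: "2 * c * v c \<le> m c" using first_zero_late c cR pos by simp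
  have dbl: "m R \<le> 2 * m c" using mass_le_twice c cR mc by simp
  have muc: "\<mu> c < 0" using mu_neg[of c] c cR pos by simp
  define A where "A = (\<lambda>r. (m c - m R) / c + m R / r)"
  have A_ge: "2 * v r \<le> A r" if "c \<le> r" "r \<le> R" for r
  proof -
    have "(\<lambda>r. A r - 2 * v r) c \<le> (\<lambda>r. A r - 2 * v r) r"
    proof (rule DERIV_nonneg_imp_increasing_open[OF that(1)])
      fix t assume t: "c < t" "t < r"
      have "((\<lambda>r. A r - 2 * v r) has_real_derivative (2 * m t - m R) / t\<^sup>2) (at t)"
        unfolding A_def using t c that
        by (auto intro!: derivative_eq_intros v_deriv simp: field_simps power2_eq_square)
      moreover have "2 * m t - m R \<ge> 0" using m_mono[of c t] t c that dbl by simp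
      ultimately show "\<exists>d. ((\<lambda>r. A r - 2 * v r) has_real_derivative d) (at t) \<and> 0 \<le> d"
        by (intro exI conjI) auto
    qed (use c that in \<open>auto simp: A_def intro!: continuous_intros continuous_on_subset[OF v_cont]\<close>)
    moreover have "A c - 2 * v c \<ge> 0"
      using mc c by (simp add: A_def field_simps)
    ultimately show ?thesis by simp
  qed
  show ?thesis
  proof
    assume end0: "\<mu> R = 0"
    have "continuous_on {c..R} (\<lambda>r. - \<mu> r)"
      using c by (auto intro!: continuous_intros continuous_on_subset[OF mu_cont])
    \<comment> \<open>\<open>d\<close> is the first radius at which the flux returns to 0. Up to
      \<open>d\<close> it is negative, so \<open>w\<close> keeps falling below its zero at
      \<open>c\<close> and is negative on \<open>(c, d]\<close>.\<close>
    then obtain d where d: "c < d" "d \<le> R" "\<mu> d = 0" and mneg: "\<And>x. c \<le> x \<Longrightarrow> x < d \<Longrightarrow> \<mu> x < 0"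
      using first_zero[of c R "\<lambda>r. - \<mu> r"] muc cR end0 by auto
    have w_neg: "w r < 0" if "c < r" "r \<le> d" for r
    proof -
      have "w r < w c"
      proof (rule DERIV_neg_imp_decreasing_open[of c r w])
        fix t assume t: "c < t" "t < r"
        then have "\<mu> t / t\<^sup>2 < 0" using mneg[of t] that c by (simp add: divide_neg_pos)
        then show "\<exists>d. (w has_real_derivative d) (at t) \<and> d < 0"
          using w_deriv[of t] t that d c by (intro exI[of _ "\<mu> t / t\<^sup>2"]) auto
      qed (use that c d in \<open>auto intro: continuous_on_subset[OF w_cont]\<close>)
      then show ?thesis by (simp add: c)
    qed
    \<comment> \<open>\<open>r^2\<close> times the Wronskian \<open>w g' - g w'\<close> for
      \<open>g = A - m / r\<close>, with \<open>r^2 g' = m - m(R) - r^3 f(v)\<close>. It starts at 0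
      because both \<open>w\<close> and \<open>g\<close> vanish at \<open>c\<close>.\<close>
    define W where "W = (\<lambda>r. w r * (m r - m R - r ^ 3 * f (v r)) - (A r - m r / r) * \<mu> r)"
    have "W d < W c"
    proof (rule DERIV_neg_imp_decreasing_open[of c d W])
      fix t assume t: "c < t" "t < d"
      have t0: "0 < t" "t < R" using t c d by auto
      have quot: "((\<lambda>r. m r / r) has_real_derivative (t * f (v t) - m t / t\<^sup>2)) (at t)"
        using t0 by (auto intro!: derivative_eq_intros m_deriv simp: field_simps power2_eq_square)
      have A_deriv: "(A has_real_derivative - m R / t\<^sup>2) (at t)"
        unfolding A_def using t0
        by (auto intro!: derivative_eq_intros simp: power2_eq_square)
      have "(W has_real_derivative t\<^sup>2 * w t * (A t * f' (v t) - 2 * f (v t))) (at t)"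
        unfolding W_def
        using DERIV_diff[OF
            DERIV_mult[OF w_deriv[OF t0] DERIV_diff[OF DERIV_diff[OF m_deriv[OF t0] DERIV_const[of "m R"]]
              DERIV_mult[OF DERIV_pow[of 3] fv_deriv[OF t0]]]]
            DERIV_mult[OF DERIV_diff[OF A_deriv quot] mu_deriv[OF t0]]]
        by (rule DERIV_cong) (use t0 in \<open>simp add: field_simps power2_eq_square power3_eq_cube\<close>)
      moreover have "t\<^sup>2 * w t * (A t * f' (v t) - 2 * f (v t)) < 0"
      proof -
        have vt: "v t > 0" using v_pos t0 by simp
        have "2 * f (v t) < 2 * (v t * f' (v t))" using f_superlinear[OF vt] by simp
        also have "\<dots> \<le> A t * f' (v t)"
          using mult_right_mono[OF A_ge[of t], of "f' (v t)"] f'_pos[OF vt] t t0 by simp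
        finally show ?thesis
          using w_neg[of t] t t0 by (intro mult_neg_pos mult_pos_neg) auto
      qed
      ultimately show "\<exists>d. (W has_real_derivative d) (at t) \<and> d < 0" by blast
    next
      show "continuous_on {c..d} W" unfolding W_def A_def using c d
        by (auto intro!: continuous_intros continuous_on_subset[OF m_cont] continuous_on_subset[OF fv_cont]
            continuous_on_subset[OF w_cont] continuous_on_subset[OF mu_cont])
    qed (use d in auto)
    moreover have "W c = 0" using c by (simp add: W_def A_def field_simps)
    \<comment> \<open>The assumed return of the flux removes the second term. What remains is a
      product of two nonpositive factors, against the strict decrease of \<open>W\<close> from
      0.\<close>
    moreover have "W d \<ge> 0"
    proof -
      have "f (v d) \<ge> 0" using f_mono[of 0 "v d"] f_zero v_nonneg[of d] c d by simp
      then have "m d - m R - d ^ 3 * f (v d) \<le> 0"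
        using m_mono[of d R] c d by (smt (verit) mult_nonneg_nonneg zero_le_power)
      then show ?thesis
        using w_neg[of d] d by (simp add: W_def mult_nonpos_nonpos)
    qed
    ultimately show False by simp
  qed
qed

end

section \<open>The enthalpy\<close>

text \<open>The common ground of both cases: \<open>K\<close> is 2 in case (b) and
  \<open>1 / (\<gamma> - 1)\<close> for power laws. \<open>ratio_null\<close> says that
  \<open>1 / h'\<close> vanishes at zero density, which makes the inverse of the enthalpy
  continuously differentiable across 0.\<close>

locale soft_pressure =
  fixes p :: "real \<Rightarrow> real" and K :: real
  assumes dp_pos: "\<And>s. s > 0 \<Longrightarrow> deriv p s > 0"
    and dp_cont: "continuous_on {0<..} (deriv p)"
    and enthalpy_integrable: "\<And>\<rho>. \<rho> > 0 \<Longrightarrow> (\<lambda>\<alpha>. deriv p \<alpha> / \<alpha>) integrable_on {0..\<rho>}"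
    and dp_less: "\<And>s. s > 0 \<Longrightarrow> deriv p s < enthalpy p s"
    and enthalpy_le: "\<And>s. s > 0 \<Longrightarrow> enthalpy p s \<le> K * deriv p s"
    and enthalpy_unbounded: "filterlim (enthalpy p) at_top at_top"
    and ratio_null: "((\<lambda>s. s / deriv p s) \<longlongrightarrow> 0) (at_right 0)"
begin

abbreviation "h \<equiv> enthalpy p"
abbreviation "F \<equiv> enthalpy_inv p"

text \<open>The positive branch is \<open>1 / h'\<close> at \<open>F y\<close>, because
  \<open>h'(s) = p'(s) / s\<close>.\<close>

definition F' :: "real \<Rightarrow> real" where
  "F' y = (if y \<le> 0 then 0 else F y / deriv p (F y))"

lemma enthalpy_0: "h 0 = 0"
  by (simp add: enthalpy_def)

text \<open>The integrand may be unbounded at 0. Splitting the integral at \<open>s / 2\<close>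
  leaves a continuous integrand around \<open>s\<close> for the fundamental theorem of
  calculus.\<close>

lemma enthalpy_deriv: assumes "s > 0" shows "(h has_real_derivative deriv p s / s) (at s)"
proof -
  have "continuous_on {s/2..s+1} (\<lambda>\<alpha>. deriv p \<alpha> / \<alpha>)"
    using assms by (intro continuous_intros continuous_on_subset[OF dp_cont]) auto
  then have "((\<lambda>x. integral {s/2..x} (\<lambda>\<alpha>. deriv p \<alpha> / \<alpha>)) has_real_derivative deriv p s / s)
      (at s within {s/2..s+1})"
    by (rule integral_has_real_derivative) (use assms in auto)
  then have "((\<lambda>x. integral {s/2..x} (\<lambda>\<alpha>. deriv p \<alpha> / \<alpha>)) has_real_derivative deriv p s / s) (at s)"
    using assms by (simp add: at_within_Icc_at)
  then have "((\<lambda>x. h (s/2) + integral {s/2..x} (\<lambda>\<alpha>. deriv p \<alpha> / \<alpha>)) has_real_derivative deriv p s / s) (at s)"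
    by (auto intro!: derivative_eq_intros)
  then show ?thesis
  proof (rule has_field_derivative_transform_within_open[of _ _ _ "{s/2<..}"])
    fix x assume x: "x \<in> {s/2<..}"
    show "h (s/2) + integral {s/2..x} (\<lambda>\<alpha>. deriv p \<alpha> / \<alpha>) = h x"
      unfolding enthalpy_def
      by (rule Henstock_Kurzweil_Integration.integral_combine) (use x assms enthalpy_integrable[of x] in auto)
  qed (use assms in auto)
qed

lemma enthalpy_cont: "continuous_on {0..} h"
proof -
  have "continuous (at x within {0..}) h" if "x \<ge> 0" for x
  proof -
    have "continuous_on {0..x+1} h"
      unfolding enthalpy_def using enthalpy_integrable[of "x+1"] that
      by (intro indefinite_integral_continuous_1) auto
    then have "continuous (at x within {0..x+1}) h"
      using that by (auto simp: continuous_on_eq_continuous_within)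
    moreover have "at x within {0..x+1} = at x within {0..}"
      by (rule at_within_nhd[of _ "{..<x + 1}"]) auto
    ultimately show ?thesis by (simp add: continuous_within)
  qed
  then show ?thesis by (simp add: continuous_on_eq_continuous_within)
qed

lemma enthalpy_strict_mono: assumes "0 \<le> x" "x < y" shows "h x < h y"
proof (rule DERIV_pos_imp_increasing_open[OF assms(2)])
  fix t assume t: "x < t" "t < y"
  then show "\<exists>d. (h has_real_derivative d) (at t) \<and> d > 0"
    using enthalpy_deriv[of t] dp_pos[of t] assms by (intro exI[of _ "deriv p t / t"]) auto
qed (use assms in \<open>auto intro: continuous_on_subset[OF enthalpy_cont]\<close>)

lemma enthalpy_less_iff: "0 \<le> x \<Longrightarrow> 0 \<le> y \<Longrightarrow> h x < h y \<longleftrightarrow> x < y"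
  by (metis enthalpy_strict_mono linorder_neqE_linordered_idom order_less_asym)

lemma enthalpy_pos: "s > 0 \<Longrightarrow> h s > 0"
  using enthalpy_strict_mono[of 0 s] enthalpy_0 by simp

lemma enthalpy_nonneg: "s \<ge> 0 \<Longrightarrow> h s \<ge> 0"
  using enthalpy_pos[of s] enthalpy_0 by (cases "s = 0") auto

lemma enthalpy_inj: "inj_on h {0..}"
  by (auto simp: inj_on_def) (metis enthalpy_less_iff less_irrefl linorder_neqE_linordered_idom)

section \<open>The inverse of the enthalpy on the whole line\<close>

lemma F_h: "s \<ge> 0 \<Longrightarrow> F (h s) = s"
  using enthalpy_nonneg[of s] by (simp add: enthalpy_inv_def the_inv_into_f_f[OF enthalpy_inj])

lemma enthalpy_surj: assumes "y \<ge> 0" obtains s where "s \<ge> 0" "h s = y"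
proof -
  obtain b where b: "\<And>s. s \<ge> b \<Longrightarrow> h s \<ge> y"
    using enthalpy_unbounded by (auto simp: filterlim_at_top eventually_at_top_linorder)
  have "continuous_on {0..max 0 b} h" by (auto intro: continuous_on_subset[OF enthalpy_cont])
  then have "\<exists>s\<ge>0. s \<le> max 0 b \<and> h s = y"
    by (intro IVT') (use b[of "max 0 b"] assms enthalpy_0 in auto)
  then show thesis using that by blast
qed

lemma h_F: "y \<ge> 0 \<Longrightarrow> h (F y) = y"
  by (metis enthalpy_surj F_h)

lemma F_nonneg: "F y \<ge> 0"
  by (metis enthalpy_inv_def enthalpy_surj F_h not_less order_refl)

lemma F_nonpos: "y \<le> 0 \<Longrightarrow> F y = 0"
  using F_h[of 0] by (cases "y = 0") (auto simp: enthalpy_0 enthalpy_inv_def)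

lemma F_pos: "y > 0 \<Longrightarrow> F y > 0"
  using h_F[of y] F_nonneg[of y] enthalpy_0 by (cases "F y = 0") auto

lemma F_less: "0 \<le> y \<Longrightarrow> 0 \<le> e \<Longrightarrow> y < h e \<Longrightarrow> F y < e"
  using h_F[of y] enthalpy_less_iff[of "F y" e] F_nonneg[of y] by simp

lemma F_deriv_pos: assumes "y > 0" shows "(F has_real_derivative F y / deriv p (F y)) (at y)"
proof -
  have s: "F y > 0" using F_pos assms .
  have cont: "isCont F (h (F y))"
    by (rule isCont_inverse_function2[of "F y / 2" _ "F y + 1"])
      (use s in \<open>auto intro!: F_h DERIV_isCont[OF enthalpy_deriv]\<close>)
  have "(F has_real_derivative inverse (deriv p (F y) / F y)) (at y)"
    by (rule DERIV_inverse_function[where f = h and a = 0 and b = "y + 1"])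
      (use s assms dp_pos[OF s] cont in \<open>auto intro!: enthalpy_deriv simp: h_F\<close>)
  then show ?thesis by simp
qed

lemma F_at_right_0: "filterlim F (at_right 0) (at_right 0)"
proof (rule filterlim_at_withinI)
  show "(F \<longlongrightarrow> 0) (at_right 0)"
  proof (rule order_tendstoI)
    fix e :: real assume "e > 0"
    then show "\<forall>\<^sub>F y in at_right 0. F y < e"
      using F_less enthalpy_pos[of e]
      by (auto simp: eventually_at_right_field intro!: exI[of _ "h e"])
  next
    fix e :: real assume "e < 0"
    then show "\<forall>\<^sub>F y in at_right 0. e < F y" by (intro always_eventually allI) (rule less_le_trans[OF _ F_nonneg])
  qed
  show "\<forall>\<^sub>F y in at_right 0. F y \<in> {0<..} - {0}"
    using F_pos by (auto simp: eventually_at_right_field intro!: exI[of _ 1])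
qed

lemma F'_null: "((\<lambda>y. F y / deriv p (F y)) \<longlongrightarrow> 0) (at_right 0)"
  using filterlim_compose[OF ratio_null F_at_right_0] .

text \<open>The point 0 is the delicate one: there \<open>p'(F y) < h(F y) = y\<close> squeezes the
  quotient \<open>F y / y\<close> between 0 and \<open>F y / p'(F y)\<close>, which tends to 0 from
  the right, while from the left it is 0.\<close>

lemma F_deriv: "(F has_real_derivative F' y) (at y)"
proof -
  consider "y > 0" | "y = 0" | "y < 0" by linarith
  then show ?thesis
  proof cases
    case 2
    have right: "((\<lambda>y. F y / y) \<longlongrightarrow> 0) (at_right 0)"
    proof (rule tendsto_sandwich[OF _ _ tendsto_const F'_null])
      show "\<forall>\<^sub>F y in at_right 0. 0 \<le> F y / y"
        using F_nonneg by (auto simp: eventually_at_right_field intro!: exI[of _ 1])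
      have "F y / y \<le> F y / deriv p (F y)" if "y > 0" for y
        using dp_less[OF F_pos[OF that]] dp_pos[OF F_pos[OF that]] F_pos[OF that] h_F[of y] that
        by (intro divide_left_mono) auto
      then show "\<forall>\<^sub>F y in at_right 0. F y / y \<le> F y / deriv p (F y)"
        by (auto simp: eventually_at_right_field intro!: exI[of _ 1])
    qed
    have "((\<lambda>y. F y / y) \<longlongrightarrow> 0) (at_left 0)"
      by (rule tendsto_eventually)
        (auto simp: eventually_at_left_field F_nonpos intro!: exI[of _ "-1"])
    with right have "((\<lambda>y. F y / y) \<longlongrightarrow> 0) (at 0)" by (simp add: filterlim_split_at)
    then show ?thesis using 2 by (simp add: has_field_derivative_iff F'_def F_nonpos)
  next
    case 3
    have "((\<lambda>_. 0) has_real_derivative 0) (at y)" by simp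
    then have "(F has_real_derivative 0) (at y)"
      by (rule has_field_derivative_transform_within_open[of _ _ _ "{..<0}"])
        (use 3 F_nonpos in auto)
    then show ?thesis using 3 by (simp add: F'_def)
  qed (use F_deriv_pos F'_def in auto)
qed

lemma F'_cont: "continuous_on UNIV F'"
proof -
  have "isCont F' y" for y
  proof -
    consider "y > 0" | "y = 0" | "y < 0" by linarith
    then show ?thesis
    proof cases
      case 1
      have "isCont (deriv p) (F y)"
        using dp_cont F_pos[OF 1] by (simp add: continuous_on_eq_continuous_at)
      then have "isCont (\<lambda>y. deriv p (F y)) y"
        by (rule isCont_o2[OF DERIV_isCont[OF F_deriv]])
      then have "isCont (\<lambda>y. F y / deriv p (F y)) y"
        using DERIV_isCont[OF F_deriv] dp_pos[OF F_pos[OF 1]] by (intro continuous_intros) auto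
      moreover have "\<forall>\<^sub>F x in nhds y. F x / deriv p (F x) = F' x"
        using eventually_nhds_in_open[of "{0<..}" y] 1 by (auto elim!: eventually_mono simp: F'_def)
      ultimately show ?thesis by (simp add: isCont_cong)
    next
      case 2
      have "(F' \<longlongrightarrow> 0) (at_right 0)"
        using F'_null by (rule Lim_transform_eventually)
          (auto simp: eventually_at_right_field F'_def intro!: exI[of _ 1])
      moreover have "(F' \<longlongrightarrow> 0) (at_left 0)"
        by (rule tendsto_eventually)
          (auto simp: eventually_at_left_field F'_def intro!: exI[of _ "-1"])
      ultimately show ?thesis using 2 by (simp add: isCont_def filterlim_split_at F'_def)
    next
      case 3
      have "\<forall>\<^sub>F x in nhds y. 0 = F' x"
        using eventually_nhds_in_open[of "{..<0}" y] 3 by (auto elim!: eventually_mono simp: F'_def)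
      then show ?thesis using isCont_cong[of "\<lambda>_. 0" F' y] by simp
    qed
  qed
  then show ?thesis by (simp add: continuous_at_imp_continuous_on)
qed

text \<open>The logarithmic derivative \<open>y F' / F\<close> is the ratio \<open>h / p'\<close> at
  the density \<open>F y\<close>; hence bounds on that ratio become growth bounds for
  \<open>F\<close>.\<close>

lemma F'_ident: "y > 0 \<Longrightarrow> y * F' y = h (F y) / deriv p (F y) * F y"
  by (simp add: F'_def h_F)

lemma F_superlinear: assumes "y > 0" shows "F y < y * F' y"
proof -
  have "1 < h (F y) / deriv p (F y)"
    using dp_less[OF F_pos[OF assms]] dp_pos[OF F_pos[OF assms]] by simp
  then show ?thesis
    using mult_strict_right_mono[OF _ F_pos[OF assms]] by (force simp: F'_ident assms)
qed

lemma F_growth: assumes "y > 0" shows "y * F' y \<le> K * F y"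
proof -
  have "h (F y) / deriv p (F y) \<le> K"
    using enthalpy_le[OF F_pos[OF assms]] dp_pos[OF F_pos[OF assms]] by (simp add: divide_le_eq)
  then show ?thesis unfolding F'_ident[OF assms] by (rule mult_right_mono) (rule F_nonneg)
qed

end

section \<open>Consequences of the standing assumptions\<close>

lemma powr_at_top:
  fixes e :: real assumes "e > 0" shows "filterlim (\<lambda>x. x powr e) at_top at_top"
proof -
  have "filterlim (\<lambda>x. exp (e * ln x)) at_top at_top"
    by (rule filterlim_compose[OF exp_at_top
          filterlim_tendsto_pos_mult_at_top[OF tendsto_const assms ln_at_top]])
  moreover have "\<forall>\<^sub>F x in at_top. exp (e * ln x) = x powr e"
    using eventually_gt_at_top[of 0] by eventually_elim (simp add: powr_def)
  ultimately show ?thesis by (rule filterlim_cong[OF refl refl, THEN iffD1, rotated])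
qed

text \<open>The behaviour of \<open>p'''\<close> at 0 integrates to
  \<open>p'' \<rightarrow> \<infinity>\<close> because \<open>\<gamma> < 2\<close>, and
  \<open>p' < h\<close> forces \<open>p' \<rightarrow> 0\<close> there; l'Hopital then gives
  \<open>p'(s) / s \<rightarrow> \<infinity>\<close>. At infinity \<open>h > p'\<close> transfers
  the growth of \<open>p'\<close>, of order \<open>s powr (\<gamma>s - 1)\<close>, to
  \<open>h\<close>.\<close>

lemma admissible_soft_pressure:
  assumes adm: "admissible_pressure p \<gamma>"
    and h: "\<And>s. s > 0 \<Longrightarrow> deriv p s < enthalpy p s" "\<And>s. s > 0 \<Longrightarrow> enthalpy p s \<le> K * deriv p s"
  shows "soft_pressure p K"
proof -
  have diff: "((deriv ^^ k) p) differentiable_on {0<..}" if "k < 3" for k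
    using adm that by (simp add: admissible_pressure_def)
  have der: "((deriv ^^ k) p has_real_derivative (deriv ^^ Suc k) p s) (at s)" if "k < 3" "s > 0" for k s
  proof -
    have "(deriv ^^ k) p differentiable (at s)"
      using diff[OF that(1)] that(2) by (simp add: differentiable_on_eq_differentiable_at)
    then show ?thesis by (simp add: DERIV_deriv_iff_real_differentiable)
  qed
  have d1: "(deriv p has_real_derivative (deriv ^^ 2) p s) (at s)" if "s > 0" for s
    using der[of 1 s] that by (simp add: numeral_2_eq_2)
  have d2: "((deriv ^^ 2) p has_real_derivative (deriv ^^ 3) p s) (at s)" if "s > 0" for s
    using der[of 2 s] that by (simp add: numeral_3_eq_3)
  have pos: "deriv p s > 0" if "s > 0" for s using adm that by (simp add: admissible_pressure_def)
  have int: "(\<lambda>\<alpha>. deriv p \<alpha> / \<alpha>) integrable_on {0..\<rho>}" if "\<rho> > 0" for \<rho>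
    using adm that by (simp add: admissible_pressure_def)
  have g: "1 < \<gamma>" "\<gamma> < 2" using adm by (auto simp: admissible_pressure_def)
  have null: "(deriv p \<longlongrightarrow> 0) (at_right 0)"
  proof (rule tendsto_sandwich[OF _ _ tendsto_const])
    have "continuous_on {0..1} (enthalpy p)"
      unfolding enthalpy_def using int[of 1] by (intro indefinite_integral_continuous_1) auto
    then have "(enthalpy p \<longlongrightarrow> enthalpy p 0) (at 0 within {0..1})"
      by (simp add: continuous_on_def)
    moreover have "at 0 within {0..1} = at_right (0::real)"
      by (rule at_within_Icc_at_right) simp
    ultimately show "(enthalpy p \<longlongrightarrow> 0) (at_right 0)" by (simp add: enthalpy_def)
    show "\<forall>\<^sub>F s in at_right 0. deriv p s \<le> enthalpy p s"
      using h(1) by (auto simp: eventually_at_right_field intro!: exI[of _ 1] less_imp_le)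
    show "\<forall>\<^sub>F s in at_right 0. 0 \<le> deriv p s"
      using pos by (auto simp: eventually_at_right_field intro!: exI[of _ 1] less_imp_le)
  qed
  have blowup: "filterlim ((deriv ^^ 2) p) at_top (at_right 0)"
  proof -
    obtain c where c: "c > 0" "((\<lambda>s. s powr (3 - \<gamma>) * (deriv ^^ 3) p s) \<longlongrightarrow> - c) (at_right 0)"
      using adm by (auto simp: admissible_pressure_def)
    then have "\<forall>\<^sub>F s in at_right 0. s powr (3 - \<gamma>) * (deriv ^^ 3) p s < - (c / 2)"
      by (intro order_tendstoD(2)) auto
    then obtain b where b: "b > 0" "\<And>s. 0 < s \<Longrightarrow> s < b \<Longrightarrow> s powr (3 - \<gamma>) * (deriv ^^ 3) p s < - (c / 2)"
      by (auto simp: eventually_at_right_field)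
    \<comment> \<open>The subtracted power is the antiderivative of
      \<open>- (c/2) s powr (\<gamma> - 3)\<close>, which lies above \<open>p'''\<close> near 0. So
      \<open>D\<close> is nonincreasing there, and \<open>p''\<close> grows at least like
      \<open>s powr (\<gamma> - 2)\<close> as \<open>s\<close> decreases to 0.\<close>
    define D where "D = (\<lambda>s. (deriv ^^ 2) p s - c / 2 / (2 - \<gamma>) * s powr (\<gamma> - 2))"
    have D_der: "(D has_real_derivative (deriv ^^ 3) p s + c / 2 * s powr (\<gamma> - 3)) (at s)" if "s > 0" for s
    proof -
      have "((\<lambda>s. s powr (\<gamma> - 2)) has_real_derivative (\<gamma> - 2) * s powr (\<gamma> - 3)) (at s)"
        using that by (auto intro!: derivative_eq_intros)
      then have "(D has_real_derivative (deriv ^^ 3) p s - c / 2 / (2 - \<gamma>) * ((\<gamma> - 2) * s powr (\<gamma> - 3))) (at s)"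
        unfolding D_def by (intro DERIV_diff DERIV_cmult d2 that)
      moreover have "c / 2 / (2 - \<gamma>) * (\<gamma> - 2) = - (c / 2)" using g by (simp add: field_simps)
      then have "c / 2 / (2 - \<gamma>) * ((\<gamma> - 2) * s powr (\<gamma> - 3)) = - (c / 2 * s powr (\<gamma> - 3))"
        by (metis mult.assoc mult_minus_left)
      ultimately show ?thesis by simp
    qed
    have "D (b / 2) \<le> D s" if s: "0 < s" "s < b / 2" for s
    proof (rule DERIV_nonpos_imp_nonincreasing[of s "b / 2" D])
      fix t assume t: "s \<le> t" "t \<le> b / 2"
      have "t powr (3 - \<gamma>) * ((deriv ^^ 3) p t + c / 2 * t powr (\<gamma> - 3)) < 0"
        using b(2)[of t] t s b(1) by (simp add: algebra_simps flip: powr_add)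
      moreover have "t powr (3 - \<gamma>) > 0" using t s by simp
      ultimately have "(deriv ^^ 3) p t + c / 2 * t powr (\<gamma> - 3) < 0"
        by (simp add: mult_less_0_iff)
      then show "\<exists>y. (D has_real_derivative y) (at t) \<and> y \<le> 0"
        using D_der[of t] t s by (intro exI conjI) auto
    qed (use s in auto)
    then have "\<forall>\<^sub>F s in at_right 0. D (b / 2) + c / 2 / (2 - \<gamma>) * s powr (\<gamma> - 2) \<le> (deriv ^^ 2) p s"
      using b(1) by (auto simp: eventually_at_right_field D_def algebra_simps intro!: exI[of _ "b / 2"])
    moreover have "filterlim (\<lambda>s. D (b / 2) + c / 2 / (2 - \<gamma>) * s powr (\<gamma> - 2)) at_top (at_right 0)"
    proof (rule filterlim_tendsto_add_at_top[OF tendsto_const],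
        rule filterlim_tendsto_pos_mult_at_top[OF tendsto_const])
      show "c / 2 / (2 - \<gamma>) > 0" using c g by simp
      have "filterlim (\<lambda>s. inverse s powr (2 - \<gamma>)) at_top (at_right (0::real))"
        by (rule filterlim_compose[OF powr_at_top filterlim_inverse_at_top_right]) (use g in auto)
      moreover have "inverse s powr (2 - \<gamma>) = s powr (\<gamma> - 2)" if "s > 0" for s :: real
        using that powr_minus[of s "2 - \<gamma>"] by (simp add: inverse_powr)
      then have "\<forall>\<^sub>F s in at_right (0::real). inverse s powr (2 - \<gamma>) = s powr (\<gamma> - 2)"
        by (auto simp: eventually_at_right_field intro!: exI[of _ 1])
      ultimately show "filterlim (\<lambda>s. s powr (\<gamma> - 2)) at_top (at_right (0::real))"
        by (rule filterlim_cong[OF refl refl, THEN iffD1, rotated])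
    qed
    ultimately show ?thesis by (rule filterlim_at_top_mono[rotated])
  qed
  show ?thesis
  proof
    show "continuous_on {0<..} (deriv p)"
      using d1 by (auto intro!: continuous_at_imp_continuous_on DERIV_isCont)
    show "filterlim (enthalpy p) at_top at_top"
    proof -
      obtain gs c where c: "6/5 < gs" "c > 0" "((\<lambda>s. s powr (1 - gs) * deriv p s) \<longlongrightarrow> c) at_top"
        using adm by (auto simp: admissible_pressure_def)
      have "filterlim (\<lambda>s. s powr (gs - 1)) at_top (at_top :: real filter)"
        using c by (intro powr_at_top) auto
      then have "filterlim (\<lambda>s. (s powr (1 - gs) * deriv p s) * s powr (gs - 1)) at_top at_top"
        by (rule filterlim_tendsto_pos_mult_at_top[OF c(3) c(2)])
      then show ?thesis
      proof (rule filterlim_at_top_mono)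
        show "\<forall>\<^sub>F s in at_top. (s powr (1 - gs) * deriv p s) * s powr (gs - 1) \<le> enthalpy p s"
          using eventually_gt_at_top[of 0]
        proof eventually_elim
          case (elim s)
          then have "(s powr (1 - gs) * deriv p s) * s powr (gs - 1) = deriv p s"
            by (simp add: mult.commute mult.left_commute flip: powr_add)
          then show ?case using h(1)[OF elim] by linarith
        qed
      qed
    qed
    have "filterlim (\<lambda>s. deriv p s / s) at_top (at_right 0)"
    proof (rule lhopital_right_0[OF null])
      show "((\<lambda>s. s) \<longlongrightarrow> 0) (at_right (0::real))" by (simp add: tendsto_ident_at)
      show "\<forall>\<^sub>F s in at_right 0. (deriv p has_real_derivative (deriv ^^ 2) p s) (at s)"
        using d1 by (auto simp: eventually_at_right_field intro!: exI[of _ 1])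
      show "filterlim (\<lambda>s. (deriv ^^ 2) p s / 1) at_top (at_right 0)" using blowup by simp
    qed (auto simp: eventually_at_right_field intro!: exI[of _ 1])
    then have "((\<lambda>s. inverse (deriv p s / s)) \<longlongrightarrow> 0) (at_right 0)"
      by (rule filterlim_compose[OF tendsto_inverse_0_at_top[OF filterlim_ident]])
    then show "((\<lambda>s. s / deriv p s) \<longlongrightarrow> 0) (at_right 0)" by simp
  qed (use pos int h in auto)
qed

section \<open>Power-law pressures\<close>

lemma deriv_powr_scaled:
  assumes "\<And>s. s > 0 \<Longrightarrow> q s = c * s powr e" "s > 0"
  shows "(q has_real_derivative c * e * s powr (e - 1)) (at s)"
proof -
  have "((\<lambda>s. c * s powr e) has_real_derivative c * e * s powr (e - 1)) (at s)"
    using assms(2) by (auto intro!: derivative_eq_intros)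
  then show ?thesis
    by (rule has_field_derivative_transform_within_open[of _ _ _ "{0<..}"]) (use assms in auto)
qed

context
  fixes p :: "real \<Rightarrow> real" and \<gamma> :: real
  assumes gamma: "6/5 < \<gamma>" "\<gamma> < 2" and p: "\<And>s. s > 0 \<Longrightarrow> p s = s powr \<gamma>"
begin

lemma polytrope_deriv: "s > 0 \<Longrightarrow> deriv p s = \<gamma> * s powr (\<gamma> - 1)"
  using deriv_powr_scaled[of p 1 \<gamma> s] p by (simp add: DERIV_imp_deriv)

lemma polytrope_enthalpy_has_integral:
  assumes "s > 0"
  shows "((\<lambda>\<alpha>. deriv p \<alpha> / \<alpha>) has_integral \<gamma> / (\<gamma> - 1) * s powr (\<gamma> - 1)) {0..s}"
proof -
  have "((\<lambda>\<alpha>. \<alpha> powr (\<gamma> - 2)) has_integral s powr (\<gamma> - 2 + 1) / (\<gamma> - 2 + 1)) {0..s}"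
    using assms gamma by (intro has_integral_powr_from_0) auto
  then have "((\<lambda>\<alpha>. \<gamma> * \<alpha> powr (\<gamma> - 2)) has_integral \<gamma> * (s powr (\<gamma> - 2 + 1) / (\<gamma> - 2 + 1))) {0..s}"
    by (rule has_integral_mult_right)
  moreover have "deriv p \<alpha> / \<alpha> = \<gamma> * \<alpha> powr (\<gamma> - 2)" if "\<alpha> \<in> {0..s} - {0}" for \<alpha>
    using that powr_diff[of \<alpha> "\<gamma> - 1" 1] by (simp add: polytrope_deriv)
  ultimately show ?thesis
    by (intro has_integral_spike[of "{0}" "{0..s}" "\<lambda>\<alpha>. deriv p \<alpha> / \<alpha>" "\<lambda>\<alpha>. \<gamma> * \<alpha> powr (\<gamma> - 2)"]) auto
qed

lemma polytrope_enthalpy: "s > 0 \<Longrightarrow> enthalpy p s = deriv p s / (\<gamma> - 1)"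
  using polytrope_enthalpy_has_integral[of s]
  by (simp add: enthalpy_def integral_unique polytrope_deriv)

lemma polytrope_admissible: "admissible_pressure p \<gamma>"
proof -
  \<comment> \<open>Falling factorials of \<open>\<gamma>\<close>;
    \<open>C 3 = \<gamma> (\<gamma> - 1) (\<gamma> - 2)\<close> is negative for
    \<open>1 < \<gamma> < 2\<close>, as the limit at 0 demands. Both limits are limits of constant
    functions, the exponent at infinity being \<open>\<gamma>\<close> again.\<close>
  define C where "C = (\<lambda>k. \<Prod>i<k. \<gamma> - real i)"
  have iter: "(deriv ^^ k) p s = C k * s powr (\<gamma> - k)" if "s > 0" for k s
    using that
  proof (induction k arbitrary: s)
    case (Suc k)
    have "((deriv ^^ k) p has_real_derivative C k * (\<gamma> - k) * s powr (\<gamma> - k - 1)) (at s)"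
      using Suc by (intro deriv_powr_scaled) auto
    then show ?case by (simp add: DERIV_imp_deriv C_def algebra_simps)
  qed (simp add: p C_def)
  have C3: "C 3 < 0" using gamma
    by (simp add: C_def numeral_3_eq_3 mult_pos_neg)
  show ?thesis
    unfolding admissible_pressure_def
  proof (intro conjI allI impI)
    fix k :: nat
    show "((deriv ^^ k) p) differentiable_on {0<..}"
      using deriv_powr_scaled[OF iter]
      by (auto simp: differentiable_on_eq_differentiable_at real_differentiable_def)
  next
    show "continuous_on {0<..} ((deriv ^^ 3) p)"
      using deriv_powr_scaled[OF iter]
      by (auto intro!: continuous_at_imp_continuous_on DERIV_isCont)
  next
    fix s :: real assume "s > 0"
    then show "deriv p s > 0" using gamma by (simp add: polytrope_deriv)
  next
    have "\<forall>\<^sub>F s in at_right 0. s powr (3 - \<gamma>) * (deriv ^^ 3) p s = C 3"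
      by (auto simp: eventually_at_right_field iter mult.left_commute intro!: exI[of _ 1] simp flip: powr_add)
    then show "\<exists>c\<^sub>0>0. ((\<lambda>s. s powr (3 - \<gamma>) * (deriv ^^ 3) p s) \<longlongrightarrow> - c\<^sub>0) (at_right 0)"
      using C3 by (intro exI[of _ "- C 3"]) (auto intro!: tendsto_eventually)
  next
    have "\<forall>\<^sub>F s in at_top. s powr (1 - \<gamma>) * deriv p s = \<gamma>"
      using eventually_gt_at_top[of 0]
      by eventually_elim (simp add: polytrope_deriv mult.left_commute flip: powr_add)
    then show "\<exists>\<gamma>s c\<^sub>1. 6/5 < \<gamma>s \<and> \<gamma>s < 2 \<and> c\<^sub>1 > 0 \<and> ((\<lambda>s. s powr (1 - \<gamma>s) * deriv p s) \<longlongrightarrow> c\<^sub>1) at_top"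
      using gamma by (intro exI[of _ \<gamma>]) (auto intro!: tendsto_eventually)
  next
    fix \<rho> :: real assume "\<rho> > 0"
    then show "(\<lambda>\<alpha>. deriv p \<alpha> / \<alpha>) integrable_on {0..\<rho>}"
      using polytrope_enthalpy_has_integral by blast
  qed (use gamma in auto)
qed

lemma polytrope_soft_pressure: "soft_pressure p (1 / (\<gamma> - 1))"
proof (rule admissible_soft_pressure[OF polytrope_admissible])
  fix s :: real assume s: "s > 0"
  then have "deriv p s > 0" using gamma by (simp add: polytrope_deriv)
  then show "deriv p s < enthalpy p s"
    using gamma s by (simp add: polytrope_enthalpy less_divide_eq)
  show "enthalpy p s \<le> 1 / (\<gamma> - 1) * deriv p s" using s by (simp add: polytrope_enthalpy)
qed

lemma polytrope_F': "y > 0 \<Longrightarrow> y * soft_pressure.F' p y = enthalpy_inv p y / (\<gamma> - 1)"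
proof -
  interpret soft_pressure p "1 / (\<gamma> - 1)" by (rule polytrope_soft_pressure)
  assume y: "y > 0"
  then have "h (F y) / deriv p (F y) = 1 / (\<gamma> - 1)"
    using F_pos[OF y] dp_pos[OF F_pos[OF y]] by (simp add: polytrope_enthalpy)
  then show "y * F' y = F y / (\<gamma> - 1)" using F'_ident[OF y] by simp
qed

end

section \<open>Newton's shell theorem\<close>

text \<open>The third coordinate comes first, so that the nested product reads as axis times
  orthogonal plane.\<close>

definition vec3 :: "real \<times> real \<times> real \<Rightarrow> real^3" where
  "vec3 u = (\<chi> i. if i = 1 then fst (snd u) else if i = 2 then snd (snd u) else fst u)"

lemma vec3_nth [simp]: "vec3 u $ 1 = fst (snd u)" "vec3 u $ 2 = snd (snd u)" "vec3 u $ 3 = fst u"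
  by (simp_all add: vec3_def)

lemma vec3_measurable [measurable]: "vec3 \<in> borel_measurable borel"
proof (rule borel_measurable_continuous_onI)
  show "continuous_on UNIV vec3"
    unfolding vec3_def continuous_on_def
  proof (intro ballI vec_tendstoI)
    fix x :: "real \<times> real \<times> real" and i :: 3
    show "((\<lambda>u. (\<chi> i. if i = 1 then fst (snd u) else if i = 2 then snd (snd u) else fst u) $ i)
        \<longlongrightarrow> (\<chi> i. if i = 1 then fst (snd x) else if i = 2 then snd (snd x) else fst x) $ i) (at x within UNIV)"
      by (auto intro!: tendsto_intros)
  qed
qed

lemma prod_Basis_3: "(\<Prod>b\<in>Basis. (x::real^3) \<bullet> b) = x $ 1 * x $ 2 * x $ 3"
proof -
  have Basis: "(Basis :: (real^3) set) = range (\<lambda>i. axis i 1)" by (auto simp: Basis_vec_def)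
  have "(\<Prod>b\<in>Basis. x \<bullet> b) = prod ((\<bullet>) x \<circ> (\<lambda>i. axis i 1)) UNIV"
    unfolding Basis by (rule prod.reindex) (simp add: inj_on_def axis_eq_axis)
  also have "\<dots> = (\<Prod>i\<in>UNIV. x $ i)" by (simp add: inner_axis)
  also have "\<dots> = x $ 1 * x $ 2 * x $ 3" unfolding UNIV_3 by simp
  finally show ?thesis .
qed

lemma norm_axis_3: "norm (axis 3 c :: real^3) = \<bar>c\<bar>"
  by (simp add: norm_vec_def L2_set_def sum_3 axis_def)

lemma bounded_linear_axis_3: "bounded_linear (\<lambda>c. axis 3 c :: real^3)"
proof (rule bounded_linear_intro)
  show "norm (axis 3 c :: real^3) \<le> norm c * 1" for c by (simp add: norm_axis_3)
qed (simp_all add: vec_eq_iff axis_def)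

lemma continuous_on_axis_sqrt:
  assumes "continuous_on UNIV (\<rho> :: real^3 \<Rightarrow> real)"
  shows "continuous_on A (\<lambda>S. \<rho> (axis 3 (sqrt S)))"
  by (rule continuous_on_compose2[OF assms], rule continuous_on_compose2[OF
        linear_continuous_on[OF bounded_linear_axis_3, of UNIV]]) (auto intro!: continuous_intros)

lemma emeasure_lborel_Times:
  fixes A :: "'a::euclidean_space set" and B :: "'b::euclidean_space set"
  assumes "A \<in> sets borel" "B \<in> sets borel"
  shows "emeasure lborel (A \<times> B) = emeasure lborel A * emeasure lborel B"
  using assms by (simp add: lborel_prod[symmetric] lborel.emeasure_pair_measure_Times)

text \<open>A measure giving every box its volume is Lebesgue measure, and \<open>vec3\<close> only
  permutes coordinates. This splits integrals over space into axis and plane.\<close>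

lemma lborel_vec3: "lborel = distr lborel borel vec3"
proof (rule lborel_eqI)
  fix l u :: "real^3"
  assume "\<And>b. b \<in> Basis \<Longrightarrow> l \<bullet> b \<le> u \<bullet> b"
  then have le: "l $ i \<le> u $ i" for i by (simp add: cart_eq_inner_axis)
  have "vec3 -` box l u = {l $ 3<..<u $ 3} \<times> {l $ 1<..<u $ 1} \<times> {l $ 2<..<u $ 2}"
    by (auto simp: mem_box_cart forall_3)
  then have "emeasure (distr lborel borel vec3) (box l u)
      = emeasure lborel ({l $ 3<..<u $ 3} \<times> {l $ 1<..<u $ 1} \<times> {l $ 2<..<u $ 2})"
    by (simp add: emeasure_distr)
  also have "\<dots> = ennreal (u $ 3 - l $ 3) * (ennreal (u $ 1 - l $ 1) * ennreal (u $ 2 - l $ 2))"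
    using le by (simp add: emeasure_lborel_Times borel_open open_Times)
  also have "\<dots> = (\<Prod>b\<in>Basis. (u - l) \<bullet> b)"
    using le by (simp add: prod_Basis_3 ac_simps flip: ennreal_mult)
  finally show "emeasure (distr lborel borel vec3) (box l u) = (\<Prod>b\<in>Basis. (u - l) \<bullet> b)" .
qed simp

text \<open>The disc of radius \<open>sqrt t\<close> has area \<open>\<pi> t\<close>, linear in
  \<open>t\<close>: the squared planar radius is distributed as \<open>\<pi>\<close> times Lebesgue
  measure on the half-line. This replaces polar coordinates.\<close>

lemma distr_norm_square:
  "distr (lborel :: (real \<times> real) measure) borel (\<lambda>u. (norm u)\<^sup>2)
    = density lborel (\<lambda>t. ennreal pi * indicator {0..} t)" (is "?M = ?N")
proof (rule measure_eqI_generator_eq[where \<Omega> = UNIV and E = "range atMost" and A = "\<lambda>i. {..real i}"])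
  show "Int_stable (range (atMost :: real \<Rightarrow> real set))"
    by (auto simp: Int_stable_def)
  have M: "emeasure ?M {..t} = ennreal (pi * max 0 t)" for t
  proof -
    have "emeasure ?M {..t} = emeasure lborel ((\<lambda>u::real \<times> real. (norm u)\<^sup>2) -` {..t})"
      by (simp add: emeasure_distr)
    also have "\<dots> = ennreal (pi * max 0 t)"
    proof (cases "t < 0")
      case True
      have "(norm u)\<^sup>2 > t" for u :: "real \<times> real" using True zero_le_power2[of "norm u"] by linarith
      then have "(\<lambda>u::real \<times> real. (norm u)\<^sup>2) -` {..t} = {}"
        by (simp add: vimage_def not_le)
      then show ?thesis using True by simp
    next
      case False
      have "(norm u)\<^sup>2 \<le> t \<longleftrightarrow> norm u \<le> sqrt t" for u :: "real \<times> real"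
        using False by (metis norm_ge_zero not_less real_le_rsqrt real_sqrt_pow2 power_mono)
      then have "(\<lambda>u::real \<times> real. (norm u)\<^sup>2) -` {..t} = cball 0 (sqrt t)" by auto
      then show ?thesis using False by (simp add: emeasure_cball unit_ball_vol_2)
    qed
    finally show ?thesis .
  qed
  have N: "emeasure ?N {..t} = ennreal (pi * max 0 t)" for t
  proof -
    have "emeasure ?N {..t} = (\<integral>\<^sup>+x. ennreal pi * indicator {0..t} x \<partial>lborel)"
      by (subst emeasure_density) (auto intro!: nn_integral_cong simp: indicator_def)
    also have "\<dots> = ennreal pi * emeasure lborel {0..t}" by (simp add: nn_integral_cmult)
    also have "\<dots> = ennreal (pi * max 0 t)" by (cases "t \<ge> 0") (auto simp: ennreal_mult)
    finally show ?thesis .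
  qed
  show "emeasure ?M X = emeasure ?N X" if "X \<in> range atMost" for X using that M N by auto
  show "emeasure ?M {..real i} \<noteq> \<infinity>" for i by (simp add: M)
  show "sets ?M = sigma_sets UNIV (range atMost)" "sets ?N = sigma_sets UNIV (range atMost)"
    by (simp_all add: borel_eq_atMost)
  show "(\<Union>i. {..real i}) = UNIV" using real_arch_simple by auto
qed auto

text \<open>With \<open>z\<close> the height and \<open>S\<close> the squared distance from the
  origin, \<open>S - z^2\<close> is the squared planar radius. Tonelli exchanges the order so that
  the inner integral runs over one sphere, on which the height is uniformly distributed.\<close>

lemma nn_integral_axial:
  fixes G :: "real \<Rightarrow> real \<Rightarrow> ennreal"
  assumes [measurable]: "(\<lambda>(z, S). G z S) \<in> borel_measurable borel"
  shows "(\<integral>\<^sup>+y. G (y $ 3) ((norm y)\<^sup>2) \<partial>(lborel :: (real^3) measure))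
    = (\<integral>\<^sup>+S. \<integral>\<^sup>+z. ennreal pi * indicator {0..} (S - z\<^sup>2) * G z S \<partial>lborel \<partial>lborel)"
proof -
  have [measurable]: "(\<lambda>y::real^3. y $ 3) \<in> borel_measurable borel"
    by (intro borel_measurable_continuous_onI continuous_intros)
  have [measurable]: "(\<lambda>(z, S). G z S) \<in> borel_measurable (borel \<Otimes>\<^sub>M borel)"
    using assms by (simp add: borel_prod)
  have meas: "(\<lambda>(z, u). G z (z\<^sup>2 + (norm u)\<^sup>2)) \<in> borel_measurable (lborel \<Otimes>\<^sub>M (lborel :: (real \<times> real) measure))"
    by measurable
  have nrm: "(norm (vec3 (z, u)))\<^sup>2 = z\<^sup>2 + (norm u)\<^sup>2" for z u
    by (simp add: norm_vec_def L2_set_def sum_3 norm_prod_def)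
  have "(\<integral>\<^sup>+y. G (y $ 3) ((norm y)\<^sup>2) \<partial>(lborel :: (real^3) measure))
      = (\<integral>\<^sup>+u. G (vec3 u $ 3) ((norm (vec3 u))\<^sup>2) \<partial>lborel)"
    by (subst lborel_vec3) (simp add: nn_integral_distr)
  also have "\<dots> = (\<integral>\<^sup>+u. (case u of (z, u) \<Rightarrow> G z (z\<^sup>2 + (norm u)\<^sup>2)) \<partial>(lborel \<Otimes>\<^sub>M (lborel :: (real \<times> real) measure)))"
    unfolding lborel_prod by (intro nn_integral_cong) (auto simp: nrm)
  also have "\<dots> = (\<integral>\<^sup>+z. \<integral>\<^sup>+u. G z (z\<^sup>2 + (norm u)\<^sup>2) \<partial>(lborel :: (real \<times> real) measure) \<partial>lborel)"
    using lborel.nn_integral_fst[OF meas] by simp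
  also have "\<dots> = (\<integral>\<^sup>+z. \<integral>\<^sup>+S. ennreal pi * indicator {0..} (S - z\<^sup>2) * G z S \<partial>lborel \<partial>lborel)"
  proof (rule nn_integral_cong)
    fix z :: real
    have "(\<integral>\<^sup>+u. G z (z\<^sup>2 + (norm u)\<^sup>2) \<partial>(lborel :: (real \<times> real) measure))
        = (\<integral>\<^sup>+t. G z (z\<^sup>2 + t) \<partial>distr (lborel :: (real \<times> real) measure) borel (\<lambda>u. (norm u)\<^sup>2))"
      by (subst nn_integral_distr) auto
    also have "\<dots> = (\<integral>\<^sup>+t. ennreal pi * indicator {0..} t * G z (z\<^sup>2 + t) \<partial>lborel)"
      unfolding distr_norm_square by (subst nn_integral_density) auto
    also have "\<dots> = (\<integral>\<^sup>+S. ennreal pi * indicator {0..} (S - z\<^sup>2) * G z S \<partial>lborel)"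
      by (subst nn_integral_real_affine[where c = 1 and t = "z\<^sup>2"]) auto
    finally show "(\<integral>\<^sup>+u. G z (z\<^sup>2 + (norm u)\<^sup>2) \<partial>(lborel :: (real \<times> real) measure))
        = (\<integral>\<^sup>+S. ennreal pi * indicator {0..} (S - z\<^sup>2) * G z S \<partial>lborel)" .
  qed
  also have "\<dots> = (\<integral>\<^sup>+S. \<integral>\<^sup>+z. ennreal pi * indicator {0..} (S - z\<^sup>2) * G z S \<partial>lborel \<partial>lborel)"
    by (rule lborel_pair.Fubini'[symmetric]) simp
  finally show ?thesis .
qed

text \<open>The integrand has the antiderivative \<open>- c sqrt(...) / r\<close>, and the square
  root takes the values \<open>\<bar>a - r\<bar>\<close> and \<open>a + r\<close> at the ends, whose
  difference is \<open>2 min a r\<close>. The condition \<open>a \<noteq> r\<close> keeps the root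
  positive on the closed segment.\<close>

lemma coulomb_segment:
  fixes a r c :: real
  assumes "0 < a" "0 < r" "a \<noteq> r" "0 \<le> c"
  shows "(\<integral>\<^sup>+z. ennreal (c / sqrt (a\<^sup>2 - 2 * z * r + r\<^sup>2)) * indicator {-a..a} z \<partial>lborel)
    = ennreal (c * (2 * min a r / r))"
proof -
  have pos: "a\<^sup>2 - 2 * z * r + r\<^sup>2 > 0" if "z \<le> a" for z
  proof -
    have "(a - r)\<^sup>2 > 0" using assms by simp
    moreover have "z * r \<le> a * r" using that assms by (intro mult_right_mono) auto
    ultimately show ?thesis by (simp add: power2_diff)
  qed
  have "(\<integral>\<^sup>+z. ennreal (c / sqrt (a\<^sup>2 - 2 * z * r + r\<^sup>2)) * indicator {-a..a} z \<partial>lborel)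
      = ennreal (- c * sqrt (a\<^sup>2 - 2 * a * r + r\<^sup>2) / r - - c * sqrt (a\<^sup>2 - 2 * (-a) * r + r\<^sup>2) / r)"
  proof (rule nn_integral_FTC_Icc[where F = "\<lambda>z. - c * sqrt (a\<^sup>2 - 2 * z * r + r\<^sup>2) / r"])
    fix z assume "z \<in> {-a..a}"
    then have z: "-a \<le> z" "z \<le> a" by auto
    show "((\<lambda>z. - c * sqrt (a\<^sup>2 - 2 * z * r + r\<^sup>2) / r) has_real_derivative
        c / sqrt (a\<^sup>2 - 2 * z * r + r\<^sup>2)) (at z)"
      using pos[OF z(2)] assms by (auto intro!: derivative_eq_intros simp: field_simps)
    show "0 \<le> c / sqrt (a\<^sup>2 - 2 * z * r + r\<^sup>2)" using pos[OF z(2)] assms by simp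
  qed (use assms in auto)
  also have "a\<^sup>2 - 2 * a * r + r\<^sup>2 = (a - r)\<^sup>2" by (simp add: power2_diff)
  also have "a\<^sup>2 - 2 * (-a) * r + r\<^sup>2 = (a + r)\<^sup>2" by (simp add: power2_sum)
  also have "- c * sqrt ((a - r)\<^sup>2) / r - - c * sqrt ((a + r)\<^sup>2) / r = c * (2 * min a r / r)"
    using assms by (simp add: min_def field_simps abs_if)
  finally show ?thesis .
qed

text \<open>The variable of integration \<open>S\<close> is the squared radius.\<close>

lemma newton_potential_radial:
  fixes \<rho> :: "real^3 \<Rightarrow> real" and R r :: real
  defines "q \<equiv> \<lambda>S. \<rho> (axis 3 (sqrt S))"
  assumes radial: "\<And>x y. norm x = norm y \<Longrightarrow> \<rho> x = \<rho> y"
    and cont: "continuous_on UNIV \<rho>" and nonneg: "\<And>x. \<rho> x \<ge> 0"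
    and supp: "\<And>x. x \<notin> ball 0 R \<Longrightarrow> \<rho> x = 0"
    and r: "0 < r" "r < R"
  shows "newton_potential \<rho> (axis 3 r)
    = 2 * pi * (integral {0..r\<^sup>2} (\<lambda>S. q S * sqrt S) / r + integral {r\<^sup>2..R\<^sup>2} q)"
proof -
  have q_cont: "continuous_on A q" for A
    unfolding q_def by (rule continuous_on_axis_sqrt[OF cont])
  have [measurable]: "q \<in> borel_measurable borel"
    by (intro borel_measurable_continuous_onI q_cont)
  have \<rho>_q: "\<rho> y = q ((norm y)\<^sup>2)" for y
    unfolding q_def by (rule radial) (simp add: norm_axis_3)
  have q0: "q S \<ge> 0" for S by (simp add: q_def nonneg)
  define G where "G = (\<lambda>z S. ennreal (q S / sqrt (S - 2 * z * r + r\<^sup>2)))"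
  have dist: "norm (axis 3 r - y) = sqrt ((norm y)\<^sup>2 - 2 * (y $ 3) * r + r\<^sup>2)" for y :: "real^3"
    by (simp add: norm_vec_def L2_set_def sum_3 axis_def power2_eq_square algebra_simps)
  have [measurable]: "(\<lambda>(z, S). G z S) \<in> borel_measurable borel"
    unfolding G_def borel_prod[symmetric] by measurable
  have [measurable]: "\<rho> \<in> borel_measurable borel"
    by (rule borel_measurable_continuous_onI[OF cont])
  define k where "k = (\<lambda>S. 2 * pi * (q S * min (sqrt S) r / r))"
  \<comment> \<open>The sphere \<open>S = r\<^sup>2\<close> passes through the evaluation point and
    \<open>S = 0\<close> is a single point; both values form a null set. For \<open>S < 0\<close>
    there is no admissible height, and for \<open>S > R\<^sup>2\<close> the density
    vanishes.\<close>
  have inner: "(\<integral>\<^sup>+z. ennreal pi * indicator {0..} (S - z\<^sup>2) * G z S \<partial>lborel) = ennreal (k S) * indicator {0..R\<^sup>2} S"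
    if "S \<noteq> 0" "S \<noteq> r\<^sup>2" for S
  proof (cases "S > 0")
    case False
    then have "indicator {0..} (S - z\<^sup>2) = (0 :: ennreal)" for z
    proof -
      have "S - z\<^sup>2 < 0" using that False zero_le_power2[of z] by linarith
      then show ?thesis by simp
    qed
    then show ?thesis using False that by simp
  next
    case True
    define a where "a = sqrt S"
    have a: "a > 0" "a\<^sup>2 = S" "a \<noteq> r" using True that r by (auto simp: a_def)
    have seg: "0 \<le> S - z\<^sup>2 \<longleftrightarrow> z \<in> {-a..a}" for z
      using abs_le_square_iff[of z a] a by (auto simp: abs_le_iff)
    have "(\<integral>\<^sup>+z. ennreal pi * indicator {0..} (S - z\<^sup>2) * G z S \<partial>lborel)
        = (\<integral>\<^sup>+z. ennreal (pi * q S / sqrt (a\<^sup>2 - 2 * z * r + r\<^sup>2)) * indicator {-a..a} z \<partial>lborel)"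
      using seg by (intro nn_integral_cong) (auto simp: G_def indicator_def a ennreal_mult'[symmetric])
    also have "\<dots> = ennreal (pi * q S * (2 * min a r / r))"
      using a r q0 by (intro coulomb_segment) auto
    also have "pi * q S * (2 * min a r / r) = k S" by (simp add: k_def a_def)
    also have "ennreal (k S) = ennreal (k S) * indicator {0..R\<^sup>2} S"
    proof (cases "S \<le> R\<^sup>2")
      case False
      then have "sqrt S > R" using r by (intro real_less_rsqrt) auto
      then have "q S = 0" unfolding q_def by (intro supp) (simp add: norm_axis_3)
      then show ?thesis by (simp add: k_def)
    qed (use True in simp)
    finally show ?thesis .
  qed
  have k_cont: "continuous_on A k" for A
    unfolding k_def using r by (intro continuous_intros q_cont) auto
  have k0: "k S \<ge> 0" if "S \<ge> 0" for S unfolding k_def using that r q0[of S] by simp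
  have k_int: "k integrable_on {a..b}" for a b
    by (intro integrable_continuous_interval k_cont)
  have "newton_potential \<rho> (axis 3 r) = enn2real (\<integral>\<^sup>+y. ennreal (\<rho> y / norm (axis 3 r - y)) \<partial>lborel)"
    unfolding newton_potential_def
    by (rule integral_eq_nn_integral) (auto simp: nonneg)
  also have "(\<integral>\<^sup>+y. ennreal (\<rho> y / norm (axis 3 r - y)) \<partial>lborel)
      = (\<integral>\<^sup>+y. G (y $ 3) ((norm y)\<^sup>2) \<partial>(lborel :: (real^3) measure))"
    by (simp add: G_def dist \<rho>_q)
  also have "\<dots> = (\<integral>\<^sup>+S. \<integral>\<^sup>+z. ennreal pi * indicator {0..} (S - z\<^sup>2) * G z S \<partial>lborel \<partial>lborel)"
    by (rule nn_integral_axial) simp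
  also have "\<dots> = (\<integral>\<^sup>+S. ennreal (k S) * indicator {0..R\<^sup>2} S \<partial>lborel)"
  proof (rule nn_integral_cong_AE)
    have "AE S in lborel. S \<noteq> 0 \<and> S \<noteq> r\<^sup>2" using AE_lborel_singleton by auto
    then show "AE S in lborel. (\<integral>\<^sup>+z. ennreal pi * indicator {0..} (S - z\<^sup>2) * G z S \<partial>lborel)
        = ennreal (k S) * indicator {0..R\<^sup>2} S"
      by eventually_elim (use inner in blast)
  qed
  also have "\<dots> = ennreal (integral {0..R\<^sup>2} k)"
    by (rule nn_integral_has_integral_lebesgue') (use k0 k_int in \<open>auto simp: has_integral_integral[symmetric]\<close>)
  also have "enn2real \<dots> = integral {0..R\<^sup>2} k"
    using k_int k0 by (intro enn2real_ennreal integral_nonneg) auto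
  also have "\<dots> = integral {0..r\<^sup>2} k + integral {r\<^sup>2..R\<^sup>2} k"
    using r k_int by (intro Henstock_Kurzweil_Integration.integral_combine[symmetric]) (auto intro: power_mono)
  also have "integral {0..r\<^sup>2} k = integral {0..r\<^sup>2} (\<lambda>S. 2 * pi / r * (q S * sqrt S))"
  proof (rule integral_cong)
    fix S assume "S \<in> {0..r\<^sup>2}"
    then have "sqrt S \<le> r" using r real_sqrt_le_mono[of S "r\<^sup>2"] by simp
    then show "k S = 2 * pi / r * (q S * sqrt S)" by (simp add: k_def min_def)
  qed
  also have "integral {r\<^sup>2..R\<^sup>2} k = integral {r\<^sup>2..R\<^sup>2} (\<lambda>S. 2 * pi * q S)"
  proof (rule integral_cong)
    fix S assume "S \<in> {r\<^sup>2..R\<^sup>2}"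
    then have "r \<le> sqrt S" using r by (intro real_le_rsqrt) auto
    then show "k S = 2 * pi * q S" using r by (simp add: k_def min_def)
  qed
  also have "integral {0..r\<^sup>2} (\<lambda>S. 2 * pi / r * (q S * sqrt S)) + integral {r\<^sup>2..R\<^sup>2} (\<lambda>S. 2 * pi * q S)
      = 2 * pi * (integral {0..r\<^sup>2} (\<lambda>S. q S * sqrt S) / r + integral {r\<^sup>2..R\<^sup>2} q)"
    by (simp only: integral_mult_right) (simp add: algebra_simps)
  finally show ?thesis .
qed

text \<open>Differentiating the shell formula, the boundary terms of the inner and the outer
  integral cancel. \<open>\<mu>\<close> is the mass inside radius \<open>r\<close>: substituting
  \<open>S = t^2\<close> turns it into the integral of \<open>4 \<pi> t^2\<close> times the
  density.\<close>

lemma newton_potential_radial_deriv: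
  fixes \<rho> :: "real^3 \<Rightarrow> real" and R r :: real
  defines "\<mu> \<equiv> \<lambda>r. 2 * pi * integral {0..r\<^sup>2} (\<lambda>S. \<rho> (axis 3 (sqrt S)) * sqrt S)"
  assumes radial: "\<And>x y. norm x = norm y \<Longrightarrow> \<rho> x = \<rho> y"
    and cont: "continuous_on UNIV \<rho>" and nonneg: "\<And>x. \<rho> x \<ge> 0"
    and supp: "\<And>x. x \<notin> ball 0 R \<Longrightarrow> \<rho> x = 0"
    and r: "0 < r" "r < R"
  shows "((\<lambda>r. newton_potential \<rho> (axis 3 r)) has_real_derivative - \<mu> r / r\<^sup>2) (at r)"
    and "(\<mu> has_real_derivative 4 * pi * r\<^sup>2 * \<rho> (axis 3 r)) (at r)"
proof -
  define q where "q = (\<lambda>S. \<rho> (axis 3 (sqrt S)))"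
  have q_cont: "continuous_on A q" for A
    unfolding q_def by (rule continuous_on_axis_sqrt[OF cont])
  have r2: "0 < r\<^sup>2" "r\<^sup>2 < R\<^sup>2" using r by (auto intro: power_strict_mono)
  have qr: "q (r\<^sup>2) = \<rho> (axis 3 r)" using r by (simp add: q_def)
  define I where "I = (\<lambda>t. integral {0..t} (\<lambda>S. q S * sqrt S))"
  define J where "J = (\<lambda>t. integral {0..t} q)"
  have "(I has_real_derivative q (r\<^sup>2) * sqrt (r\<^sup>2)) (at (r\<^sup>2) within {0..R\<^sup>2})"
    unfolding I_def using r2 by (intro integral_has_real_derivative continuous_intros q_cont) auto
  then have I: "(I has_real_derivative \<rho> (axis 3 r) * r) (at (r\<^sup>2))"
    using r2 r by (simp add: at_within_Icc_at qr)
  have "(J has_real_derivative q (r\<^sup>2)) (at (r\<^sup>2) within {0..R\<^sup>2})"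
    unfolding J_def using r2 by (intro integral_has_real_derivative q_cont) auto
  then have J: "(J has_real_derivative \<rho> (axis 3 r)) (at (r\<^sup>2))"
    using r2 by (simp add: at_within_Icc_at qr)
  have sq: "((\<lambda>r. r\<^sup>2) has_real_derivative 2 * r) (at r)" by (auto intro!: derivative_eq_intros)
  note I' = DERIV_chain2[OF I sq] and J' = DERIV_chain2[OF J sq]
  have \<mu>: "\<mu> = (\<lambda>r. 2 * pi * I (r\<^sup>2))" by (simp add: \<mu>_def I_def q_def)
  show "(\<mu> has_real_derivative 4 * pi * r\<^sup>2 * \<rho> (axis 3 r)) (at r)"
    unfolding \<mu> using DERIV_cmult[OF I', of "2 * pi"]
    by (rule DERIV_cong) (simp add: power2_eq_square)
  have "((\<lambda>r. 2 * pi * (I (r\<^sup>2) / r + (J (R\<^sup>2) - J (r\<^sup>2)))) has_real_derivative - \<mu> r / r\<^sup>2) (at r)"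
    using DERIV_cmult[OF DERIV_add[OF DERIV_divide[OF I' DERIV_ident less_imp_neq[OF r(1), symmetric]] DERIV_diff[OF DERIV_const[of "J (R\<^sup>2)"] J']], of "2 * pi"]
    by (rule DERIV_cong) (use r in \<open>auto simp: \<mu> field_simps power2_eq_square\<close>)
  then show "((\<lambda>r. newton_potential \<rho> (axis 3 r)) has_real_derivative - \<mu> r / r\<^sup>2) (at r)"
  proof (rule has_field_derivative_transform_within_open[of _ _ _ "{0<..<R}"])
    fix t assume t: "t \<in> {0<..<R}"
    have "t\<^sup>2 \<le> R\<^sup>2" using t by (auto intro: power_mono)
    then have "J (t\<^sup>2) + integral {t\<^sup>2..R\<^sup>2} q = J (R\<^sup>2)"
      unfolding J_def
      by (intro Henstock_Kurzweil_Integration.integral_combine integrable_continuous_interval q_cont) auto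
    then have "integral {t\<^sup>2..R\<^sup>2} q = J (R\<^sup>2) - J (t\<^sup>2)" by simp
    then show "2 * pi * (I (t\<^sup>2) / t + (J (R\<^sup>2) - J (t\<^sup>2))) = newton_potential \<rho> (axis 3 t)"
      using newton_potential_radial[OF radial cont nonneg supp, of R t] t
      by (simp add: I_def q_def)
  qed (use r in auto)
qed

section \<open>The mass as a function of the central density\<close>

context soft_pressure
begin

section \<open>Existence and monotonicity of the profile\<close>

lemma F_cont: "continuous_on A F"
  using F_deriv by (meson DERIV_isCont continuous_at_imp_continuous_on)

text \<open>A bound from one side suffices: profiles never exceed their central value, and
  \<open>F'\<close> vanishes on negative arguments.\<close>

lemma F'_bounded: obtains L where "L \<ge> 0" "\<And>y. y \<le> A \<Longrightarrow> \<bar>4 * pi * F' y\<bar> \<le> L"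
proof -
  have "continuous_on {0..A} (\<lambda>y. 4 * pi * F' y)"
    by (intro continuous_intros continuous_on_subset[OF F'_cont]) auto
  then obtain L where L: "L > 0" "\<And>y. 0 \<le> y \<Longrightarrow> y \<le> A \<Longrightarrow> \<bar>4 * pi * F' y\<bar> \<le> L"
    using continuous_on_Icc_bounded by blast
  have "\<bar>4 * pi * F' y\<bar> \<le> L" if "y \<le> A" for y
    using L(1) L(2)[of y] that by (cases "y \<ge> 0") (auto simp: F'_def)
  then show thesis using L(1) that[of L] by simp
qed

lemma F_lipschitz:
  assumes "\<And>y. y \<le> A \<Longrightarrow> \<bar>4 * pi * F' y\<bar> \<le> L" "x \<le> A" "y \<le> A"
  shows "\<bar>4 * pi * F x - 4 * pi * F y\<bar> \<le> L * \<bar>x - y\<bar>"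
proof -
  have "norm (4 * pi * F x - 4 * pi * F y) \<le> L * norm (x - y)"
    by (rule field_differentiable_bound[of "{..A}" _ "\<lambda>y. 4 * pi * F' y"])
      (use assms in \<open>auto intro!: derivative_eq_intros has_field_derivative_at_within[OF F_deriv]\<close>)
  then show ?thesis by simp
qed

text \<open>Picard iteration needs a globally Lipschitz source, so the argument of \<open>F\<close>
  is truncated at \<open>a\<close>. The solution decreases from \<open>a\<close> and never meets the
  truncation.\<close>

lemma profile_ivp_exists: "\<exists>v. solves_profile_ivp p a v"
proof -
  obtain L where L: "L \<ge> 0" "\<And>y. y \<le> a \<Longrightarrow> \<bar>4 * pi * F' y\<bar> \<le> L" using F'_bounded by blast
  define G where "G = (\<lambda>(r::real) y. 4 * pi * F (min y a))"
  obtain v v' where v: "v 0 = a" "\<And>T. radial_sol T (\<lambda>r. G r (v r)) v v'"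
    "\<And>r. r \<ge> 0 \<Longrightarrow> (v has_real_derivative v' r) (at r within {0..})"
  proof (rule radial_ivp_exists[of G L])
    fix x :: "real \<Rightarrow> real" assume "continuous_on {0..} x"
    then show "continuous_on {0..} (\<lambda>r. G r (x r))"
      unfolding G_def by (intro continuous_intros continuous_on_compose2[OF F_cont[of UNIV]]) auto
  next
    fix r x y :: real
    have "\<bar>4 * pi * F (min x a) - 4 * pi * F (min y a)\<bar> \<le> L * \<bar>min x a - min y a\<bar>"
      using F_lipschitz[of a L "min x a" "min y a"] L(2) by simp
    also have "\<dots> \<le> L * \<bar>x - y\<bar>" using L(1) by (intro mult_left_mono) (auto simp: min_def)
    finally show "\<bar>G r x - G r y\<bar> \<le> L * \<bar>x - y\<bar>" by (simp add: G_def)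
  qed blast
  have le: "v r \<le> a" if "r \<ge> 0" for r
    using radial_sol_decreasing(2)[OF v(2)[of "r + 1"], of 0 r] that v(1) F_nonneg by (simp add: G_def)
  have "solves_profile_ivp p a v"
    unfolding solves_profile_ivp_def
  proof (intro exI conjI allI impI)
    fix r :: real assume r: "r > 0"
    show "(v' has_real_derivative - (2 / r * v' r) - G r (v r)) (at r)"
      using v(2)[of "r + 1"] r by (auto simp: radial_sol_def)
    show "- (2 / r * v' r) - G r (v r) + 2 / r * v' r + 4 * pi * F (v r) = 0"
      using le[of r] r by (simp add: G_def)
  qed (use v v(2)[of 1] in \<open>auto simp: radial_sol_def\<close>)
  then show ?thesis by blast
qed

lemma profile_radial_sol:
  obtains v' where "profile p a 0 = a" "\<And>T. radial_sol T (\<lambda>r. 4 * pi * F (profile p a r)) (profile p a) v'"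
proof -
  have "solves_profile_ivp p a (profile p a)"
    unfolding profile_def using profile_ivp_exists by (rule someI_ex)
  then obtain v' v'' where v: "\<And>r. r \<ge> 0 \<Longrightarrow> (profile p a has_real_derivative v' r) (at r within {0..})"
      "\<And>r. r > 0 \<Longrightarrow> (v' has_real_derivative v'' r) (at r)"
      "\<And>r. r > 0 \<Longrightarrow> v'' r + 2 / r * v' r + 4 * pi * F (profile p a r) = 0"
      "profile p a 0 = a" "v' 0 = 0"
    unfolding solves_profile_ivp_def by blast
  have cont: "continuous_on {0..} (profile p a)"
    using v(1) by (auto simp: continuous_on_eq_continuous_within intro!: DERIV_continuous)
  have "radial_sol T (\<lambda>r. 4 * pi * F (profile p a r)) (profile p a) v'" for T
  proof (rule radial_sol_of_derivs[OF v(1) v(5)])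
    fix r :: real assume "r > 0"
    then have "v'' r = - (2 / r * v' r) - 4 * pi * F (profile p a r)" using v(3)[of r] by linarith
    then show "(v' has_real_derivative - (2 / r * v' r) - 4 * pi * F (profile p a r)) (at r)"
      using v(2)[of r] \<open>r > 0\<close> by simp
  qed (auto intro!: continuous_intros continuous_on_compose2[OF F_cont[of UNIV] cont])
  with v(4) that show thesis by blast
qed

text \<open>A chosen function instead of \<open>deriv\<close>: values of \<open>profile p a\<close>
  on negative arguments are arbitrary, and one function has to serve every \<open>T\<close>.\<close>

definition slope :: "real \<Rightarrow> real \<Rightarrow> real" where
  "slope a = (SOME v'. \<forall>T. radial_sol T (\<lambda>r. 4 * pi * F (profile p a r)) (profile p a) v')"

lemma slope_sol: "radial_sol T (\<lambda>r. 4 * pi * F (profile p a r)) (profile p a) (slope a)"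
proof -
  have "\<exists>v'. \<forall>T. radial_sol T (\<lambda>r. 4 * pi * F (profile p a r)) (profile p a) v'"
    using profile_radial_sol[of a] by blast
  then have "\<forall>T. radial_sol T (\<lambda>r. 4 * pi * F (profile p a r)) (profile p a) (slope a)"
    unfolding slope_def by (rule someI_ex)
  then show ?thesis by blast
qed

lemma profile_0: "profile p a 0 = a"
  using profile_radial_sol[of a] by blast

lemma profile_antimono: "0 \<le> x \<Longrightarrow> x \<le> y \<Longrightarrow> profile p a y \<le> profile p a x"
  by (rule radial_sol_decreasing(2)[OF slope_sol[of "y + 1"]]) (auto simp: F_nonneg)

lemma profile_le: "0 \<le> r \<Longrightarrow> profile p a r \<le> a"
  using profile_antimono[of 0 r a] by (simp add: profile_0)

lemma profile_cont: "A \<subseteq> {0..} \<Longrightarrow> continuous_on A (profile p a)"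
proof -
  have "continuous_on {0..T} (profile p a)" for T
    using slope_sol[of "T + 1" a] by (auto simp: radial_sol_def intro: continuous_on_subset)
  then show "A \<subseteq> {0..} \<Longrightarrow> continuous_on A (profile p a)"
    by (rule continuous_on_subset[OF continuous_on_halfline])
qed

lemma slope_cont: "A \<subseteq> {0..} \<Longrightarrow> continuous_on A (slope a)"
proof -
  have "continuous_on {0..T} (slope a)" for T
    using slope_sol[of "T + 1" a] by (auto simp: radial_sol_def intro: continuous_on_subset)
  then show "A \<subseteq> {0..} \<Longrightarrow> continuous_on A (slope a)"
    by (rule continuous_on_subset[OF continuous_on_halfline])
qed

lemma profile_deriv: "r > 0 \<Longrightarrow> (profile p a has_real_derivative slope a r) (at r)"
  using slope_sol[of "r + 1" a] by (auto simp: radial_sol_def)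

lemma flux_deriv:
  "r > 0 \<Longrightarrow> ((\<lambda>r. r\<^sup>2 * slope a r) has_real_derivative - (r\<^sup>2 * (4 * pi * F (profile p a r)))) (at r)"
  by (rule radial_sol_flux_deriv[OF slope_sol[of "r + 1"]]) auto

text \<open>Near the centre the density is positive, which makes the flux strictly negative; from
  there on it cannot increase. Strictness makes the zero of the profile unique and the slope at the
  surface nonzero.\<close>

lemma slope_neg: assumes "a > 0" "r > 0" shows "slope a r < 0"
proof -
  have "\<exists>d>0. \<forall>x. 0 \<le> x \<and> x < d \<longrightarrow> profile p a x > 0"
  proof -
    have "(profile p a \<longlongrightarrow> profile p a 0) (at 0 within {0..})"
      using profile_cont[of "{0..}" a] by (auto simp: continuous_on_def)
    then have "(profile p a \<longlongrightarrow> a) (at 0 within {0..})" by (simp add: profile_0)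
    then have "\<forall>\<^sub>F x in at 0 within {0..}. profile p a x > 0"
      using assms by (intro order_tendstoD(1)) auto
    then obtain d where "d > 0" "\<And>x. x \<ge> 0 \<Longrightarrow> x \<noteq> 0 \<Longrightarrow> dist x 0 < d \<Longrightarrow> profile p a x > 0"
      by (auto simp: eventually_at)
    then show ?thesis using assms profile_0[of a]
      by (intro exI[of _ d]) (metis abs_of_nonneg dist_0_norm dist_commute real_norm_def)
  qed
  then obtain d where d: "d > 0" "\<And>x. 0 \<le> x \<Longrightarrow> x < d \<Longrightarrow> profile p a x > 0" by blast
  define b where "b = min d r"
  have b: "0 < b" "b \<le> r" "b \<le> d" using d assms by (auto simp: b_def)
  let ?q = "\<lambda>r. r\<^sup>2 * slope a r"
  have q_cont: "continuous_on {x..y} ?q" if "0 \<le> x" for x y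
    using that by (intro continuous_intros slope_cont) auto
  have "?q b < ?q 0"
  proof (rule DERIV_neg_imp_decreasing_open[of 0 b ?q])
    fix t assume t: "0 < t" "t < b"
    then have "F (profile p a t) > 0" using d(2)[of t] b by (intro F_pos) auto
    then show "\<exists>y. (?q has_real_derivative y) (at t) \<and> y < 0"
      using flux_deriv[of t a] t by (intro exI[of _ "- (t\<^sup>2 * (4 * pi * F (profile p a t)))"]) auto
  qed (use b q_cont in auto)
  moreover have "?q r \<le> ?q b"
  proof (rule DERIV_nonpos_imp_decreasing_open[of b r ?q])
    fix t assume t: "b < t" "t < r"
    then show "\<exists>y. (?q has_real_derivative y) (at t) \<and> y \<le> 0"
      using flux_deriv[of t a] b F_nonneg
      by (intro exI[of _ "- (t\<^sup>2 * (4 * pi * F (profile p a t)))"]) auto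
  qed (use b q_cont in auto)
  ultimately have "r\<^sup>2 * slope a r < 0" by simp
  then show ?thesis using assms by (simp add: mult_less_0_iff)
qed

lemma profile_strict: assumes "a > 0" "0 \<le> x" "x < y" shows "profile p a y < profile p a x"
proof (rule DERIV_neg_imp_decreasing_open[OF assms(3)])
  fix t assume "x < t" "t < y"
  then show "\<exists>d. (profile p a has_real_derivative d) (at t) \<and> d < 0"
    using profile_deriv[of t a] slope_neg[OF assms(1), of t] assms by (intro exI[of _ "slope a t"]) auto
qed (use assms in \<open>auto intro: profile_cont\<close>)

section \<open>The mass as a flux and its dependence on the central value\<close>

lemma total_mass_eq_flux:
  assumes s: "s > 0" and T: "T > 0" "profile p (h s) T \<le> 0"
  shows "total_mass p s = - (T\<^sup>2 * slope (h s) T)"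
proof -
  define a where "a = h s"
  have a: "a > 0" using s by (simp add: a_def enthalpy_pos)
  obtain b where b: "0 \<le> b" "b \<le> T" "profile p a b = 0"
    using IVT2'[of "profile p a" T 0 0] T a profile_cont[of "{0..T}" a] by (auto simp: profile_0 a_def)
  have b0: "b > 0" using b a profile_0[of a] by (cases "b = 0") auto
  have "star_radius p a = b"
    unfolding star_radius_def
  proof (rule Least_equality)
    fix y assume "0 < y \<and> profile p a y = 0"
    then show "b \<le> y" using profile_strict[OF a, of y b] b by (cases "b \<le> y") auto
  qed (use b0 b in auto)
  let ?q = "\<lambda>r. r\<^sup>2 * slope a r"
  have q_cont: "continuous_on {x..y} ?q" if "0 \<le> x" for x y
    using that by (intro continuous_intros slope_cont) auto
  have "((\<lambda>r. 4 * pi * F (profile p a r) * r\<^sup>2) has_integral (- ?q b - - ?q 0)) {0..b}"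
  proof (rule fundamental_theorem_of_calculus_interior)
    show "continuous_on {0..b} (\<lambda>r. - ?q r)" by (intro continuous_on_minus q_cont) simp
    fix r assume "r \<in> {0<..<b}"
    then show "((\<lambda>r. - ?q r) has_vector_derivative 4 * pi * F (profile p a r) * r\<^sup>2) (at r)"
      using DERIV_minus[OF flux_deriv[of r a]]
      by (simp add: has_real_derivative_iff_has_vector_derivative[symmetric] mult_ac)
  qed (use b0 in auto)
  then have "integral {0..b} (\<lambda>r. 4 * pi * F (profile p a r) * r\<^sup>2) = - ?q b"
    by (simp add: integral_unique)
  moreover have "?q T = ?q b"
  proof (cases "b = T")
    case False
    show ?thesis
    proof (rule DERIV_isconst_end[of b T ?q])
      fix x assume x: "b < x" "x < T"
      then have "profile p a x \<le> 0" using profile_antimono[of b x a] b by simp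
      then show "(?q has_real_derivative 0) (at x)"
        using flux_deriv[of x a] x b0 by (simp add: F_nonpos)
    qed (use b b0 False q_cont in auto)
  qed simp
  ultimately show ?thesis
    using \<open>star_radius p a = b\<close> by (simp add: total_mass_def Let_def a_def)
qed

text \<open>The difference of two profiles is a radial solution with a source Lipschitz in that
  difference, so the energy estimate applies without forcing; the square root halves the
  exponent.\<close>

lemma profile_continuous_dependence:
  assumes L: "\<And>y. y \<le> A \<Longrightarrow> \<bar>4 * pi * F' y\<bar> \<le> L" "L \<ge> 0" and ab: "a \<le> A" "b \<le> A" and r: "0 \<le> r" "r \<le> T"
  shows "\<bar>profile p a r - profile p b r\<bar> \<le> exp ((2 + L) * T / 2) * \<bar>a - b\<bar>"
proof -
  let ?d = "\<lambda>r. profile p a r - 1 * profile p b r"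
  have "(?d r)\<^sup>2 + (slope a r - 1 * slope b r)\<^sup>2 \<le> exp ((2 + L) * r) * ((?d 0)\<^sup>2 + 0\<^sup>2)"
  proof (rule radial_energy[OF radial_sol_diff[OF slope_sol[of "T + 1"] slope_sol[of "T + 1"]]])
    fix t assume "0 < t" "t < T + 1"
    then show "\<bar>4 * pi * F (profile p a t) - 1 * (4 * pi * F (profile p b t))\<bar> \<le> L * \<bar>?d t\<bar> + 0"
      using F_lipschitz[of A L "profile p a t" "profile p b t"] L(1) profile_le[of t a] profile_le[of t b] ab
      by simp
  qed (use L r in auto)
  also have "\<dots> \<le> exp ((2 + L) * T) * (a - b)\<^sup>2"
    using r L by (auto simp: profile_0 intro!: mult_right_mono mult_left_mono)
  also have "\<dots> = (exp ((2 + L) * T / 2) * (a - b))\<^sup>2"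
    by (simp add: power_mult_distrib power2_eq_square flip: exp_add)
  finally have "(?d r)\<^sup>2 \<le> (exp ((2 + L) * T / 2) * (a - b))\<^sup>2"
    using zero_le_power2[of "slope a r - 1 * slope b r"] by linarith
  then show ?thesis by (simp add: abs_le_square_iff[symmetric] abs_mult)
qed

text \<open>The remainder \<open>v_a - v_b - (a - b) w\<close> starts at 0 and solves the linearized
  equation up to the Taylor remainder of \<open>F\<close> along the profile. That is a forcing of
  order \<open>o(a - b)\<close>, and the energy estimate passes it on to the derivative at
  \<open>T\<close>.\<close>

lemma slope_differentiable:
  assumes w: "\<And>T. radial_sol T (\<lambda>r. 4 * pi * F' (profile p b r) * w r) w w'" and w0: "w 0 = 1"
    and T: "T > 0"
  shows "((\<lambda>a. slope a T) has_real_derivative w' T) (at b)"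
proof -
  obtain L where L: "L \<ge> 0" "\<And>y. y \<le> b + 1 \<Longrightarrow> \<bar>4 * pi * F' y\<bar> \<le> L" using F'_bounded by blast
  define E where "E = exp ((2 + L) * (T + 1) / 2)"
  have E: "E > 0" by (simp add: E_def)
  \<comment> \<open>\<open>m\<close> is the least value of the unperturbed profile on
    \<open>[0, T + 1]\<close>. Profiles within distance 1 of it take values in
    \<open>[m - 1, b + 1]\<close>, where \<open>F'\<close> is uniformly continuous.\<close>
  define m where "m = profile p b (T + 1)"
  have "continuous_on {m - 1..b + 1} (\<lambda>y. 4 * pi * F' y)"
    by (intro continuous_intros continuous_on_subset[OF F'_cont]) auto
  then have unif: "uniformly_continuous_on {m - 1..b + 1} (\<lambda>y. 4 * pi * F' y)"
    by (intro compact_uniformly_continuous) auto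
  have "\<exists>d>0. \<forall>a. \<bar>a - b\<bar> < d \<longrightarrow> \<bar>slope a T - slope b T - w' T * (a - b)\<bar> \<le> e * \<bar>a - b\<bar>" if e: "e > 0" for e
  proof -
    \<comment> \<open>One factor \<open>E\<close> is lost in bounding the difference of the
      profiles, the other in the energy estimate for the remainder.\<close>
    define k where "k = e / E\<^sup>2"
    have k: "k > 0" using e E by (simp add: k_def)
    obtain d where d: "d > 0" "\<And>x y. x \<in> {m - 1..b + 1} \<Longrightarrow> y \<in> {m - 1..b + 1} \<Longrightarrow> \<bar>x - y\<bar> < d \<Longrightarrow>
        \<bar>4 * pi * F' x - 4 * pi * F' y\<bar> < k"
      using unif k unfolding uniformly_continuous_on_def dist_real_def by meson
    have "\<bar>slope a T - slope b T - w' T * (a - b)\<bar> \<le> e * \<bar>a - b\<bar>" if a: "\<bar>a - b\<bar> < min 1 (min (d / E) (1 / E))" for a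
    proof -
      have close: "\<bar>profile p a t - profile p b t\<bar> \<le> E * \<bar>a - b\<bar>" if "0 \<le> t" "t \<le> T + 1" for t
        unfolding E_def using L a that by (intro profile_continuous_dependence[of "b + 1"]) auto
      have small: "E * \<bar>a - b\<bar> < d" "E * \<bar>a - b\<bar> < 1" using a E by (auto simp: field_simps)
      let ?S = "\<lambda>r. (4 * pi * F (profile p a r) - 1 * (4 * pi * F (profile p b r))) - (a - b) * (4 * pi * F' (profile p b r) * w r)"
      let ?d = "\<lambda>r. (profile p a r - 1 * profile p b r) - (a - b) * w r"
      let ?d' = "\<lambda>r. (slope a r - 1 * slope b r) - (a - b) * w' r"
      have sol: "radial_sol (T + 1) ?S ?d ?d'"
        by (rule radial_sol_diff[OF radial_sol_diff[OF slope_sol slope_sol] w])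
      have "(?d T)\<^sup>2 + (?d' T)\<^sup>2 \<le> exp ((2 + L) * T) * ((?d 0)\<^sup>2 + (k * (E * \<bar>a - b\<bar>))\<^sup>2)"
      proof (rule radial_energy[OF sol L(1)])
        fix t assume t: "0 < t" "t < T + 1"
        define x y where "x = profile p a t" and "y = profile p b t"
        have xy: "\<bar>x - y\<bar> \<le> E * \<bar>a - b\<bar>" using close[of t] t by (simp add: x_def y_def)
        have y: "m \<le> y" "y \<le> b" using profile_antimono[of t "T + 1" b] profile_le[of t b] t by (auto simp: y_def m_def)
        have x: "x \<le> b + 1" using profile_le[of t a] t a by (simp add: x_def abs_if split: if_splits)
        have "\<bar>4 * pi * F x - 4 * pi * F y - 4 * pi * F' y * (x - y)\<bar> \<le> k * \<bar>x - y\<bar>"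
        proof -
          \<comment> \<open>The mean value theorem for \<open>F\<close> minus its linear part at
            \<open>y\<close>, whose derivative is at most \<open>k\<close> on the segment.\<close>
          have "norm ((4 * pi * F x - 4 * pi * F' y * x) - (4 * pi * F y - 4 * pi * F' y * y)) \<le> k * norm (x - y)"
          proof (rule field_differentiable_bound[of "closed_segment x y"
                "\<lambda>u. 4 * pi * F u - 4 * pi * F' y * u" "\<lambda>u. 4 * pi * F' u - 4 * pi * F' y"])
            fix u assume u: "u \<in> closed_segment x y"
            then have u': "\<bar>u - y\<bar> \<le> \<bar>x - y\<bar>" "u \<in> {min x y..max x y}"
              by (auto simp: closed_segment_eq_real_ivl split: if_splits)
            have "u \<in> {m - 1..b + 1}" "y \<in> {m - 1..b + 1}" using u' x y xy small by auto
            then show "norm (4 * pi * F' u - 4 * pi * F' y) \<le> k"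
              using d(2)[of u y] u' xy small by (simp add: less_imp_le)
            show "((\<lambda>u. 4 * pi * F u - 4 * pi * F' y * u) has_real_derivative 4 * pi * F' u - 4 * pi * F' y)
                (at u within closed_segment x y)"
              by (auto intro!: derivative_eq_intros has_field_derivative_at_within[OF F_deriv])
          qed auto
          then show ?thesis by (simp add: algebra_simps)
        qed
        also have "\<dots> \<le> k * (E * \<bar>a - b\<bar>)" using xy k by simp
        finally have rem: "\<bar>4 * pi * F x - 4 * pi * F y - 4 * pi * F' y * (x - y)\<bar> \<le> k * (E * \<bar>a - b\<bar>)" .
        have "\<bar>4 * pi * F' y * (x - y - (a - b) * w t)\<bar> \<le> L * \<bar>x - y - (a - b) * w t\<bar>"
          using L(2)[of y] y by (simp only: abs_mult) (intro mult_right_mono, auto)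
        moreover have "?S t = (4 * pi * F x - 4 * pi * F y - 4 * pi * F' y * (x - y))
            + 4 * pi * F' y * (x - y - (a - b) * w t)"
          by (simp add: x_def y_def algebra_simps)
        ultimately show "\<bar>?S t\<bar> \<le> L * \<bar>?d t\<bar> + k * (E * \<bar>a - b\<bar>)"
          using rem by (simp add: x_def y_def)
      qed (use k E T in auto)
      also have "\<dots> \<le> E\<^sup>2 * (k * (E * \<bar>a - b\<bar>))\<^sup>2"
      proof -
        have "exp ((2 + L) * T) \<le> exp ((2 + L) * (T + 1))" using L(1) by simp
        also have "\<dots> = E\<^sup>2" by (simp add: E_def power2_eq_square flip: exp_add)
        finally show ?thesis by (simp add: profile_0 w0 mult_right_mono)
      qed
      also have "\<dots> = (e * \<bar>a - b\<bar>)\<^sup>2" using E by (simp add: k_def power_mult_distrib field_simps power2_eq_square)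
      finally have "(?d' T)\<^sup>2 \<le> (e * \<bar>a - b\<bar>)\<^sup>2" using zero_le_power2[of "?d T"] by linarith
      then have "\<bar>?d' T\<bar> \<le> \<bar>e * \<bar>a - b\<bar>\<bar>" by (simp only: abs_le_square_iff)
      then show ?thesis using e by (simp add: mult.commute abs_mult)
    qed
    then show ?thesis using d E by (intro exI[of _ "min 1 (min (d / E) (1 / E))"]) auto
  qed
  then show ?thesis
    unfolding has_field_derivative_def has_derivative_within_alt
    by (auto intro!: bounded_linear_mult_right)
qed

lemma linearized_exists:
  obtains w w' where "w 0 = 1" "\<And>T. radial_sol T (\<lambda>r. 4 * pi * F' (profile p b r) * w r) w w'"
proof -
  obtain L where L: "L \<ge> 0" "\<And>y. y \<le> b \<Longrightarrow> \<bar>4 * pi * F' y\<bar> \<le> L" using F'_bounded by blast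
  define G where "G = (\<lambda>r y. 4 * pi * F' (profile p b r) * y)"
  obtain w w' where "w 0 = 1" "\<And>T. radial_sol T (\<lambda>r. G r (w r)) w w'"
  proof (rule radial_ivp_exists[of G L])
    fix x :: "real \<Rightarrow> real" assume "continuous_on {0..} x"
    then show "continuous_on {0..} (\<lambda>r. G r (x r))"
      unfolding G_def
      by (intro continuous_intros continuous_on_compose2[OF F'_cont profile_cont]) auto
  next
    fix r x y :: real assume "r \<ge> 0"
    then have "\<bar>4 * pi * F' (profile p b r)\<bar> * \<bar>x - y\<bar> \<le> L * \<bar>x - y\<bar>"
      using L(2) profile_le by (intro mult_right_mono) auto
    then show "\<bar>G r x - G r y\<bar> \<le> L * \<bar>x - y\<bar>"
      by (simp add: G_def abs_mult flip: right_diff_distrib)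
  qed blast
  then show thesis by (intro that[of w w']) (simp_all add: G_def)
qed

lemma total_mass_deriv:
  assumes s: "s > 0" and R: "R > 0" "profile p (h s) R = 0"
    and w: "\<And>T. radial_sol T (\<lambda>r. 4 * pi * F' (profile p (h s) r) * w r) w w'" and w0: "w 0 = 1"
  shows "(total_mass p has_real_derivative - (R\<^sup>2 * w' R) * (deriv p s / s)) (at s)"
proof -
  define T where "T = R + 1"
  have a: "h s > 0" using s by (rule enthalpy_pos)
  have neg: "profile p (h s) T < 0" using profile_strict[OF a, of R T] R by (simp add: T_def)
  obtain L where L: "L \<ge> 0" "\<And>y. y \<le> h s + 1 \<Longrightarrow> \<bar>4 * pi * F' y\<bar> \<le> L" using F'_bounded by blast
  define E where "E = exp ((2 + L) * T / 2)"
  have E: "E > 0" by (simp add: E_def)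
  \<comment> \<open>For central values within \<open>e\<close> the profile is still negative at
    \<open>T\<close>, so the flux formula for the mass holds in a whole neighbourhood of
    \<open>s\<close>.\<close>
  define e where "e = min 1 (- profile p (h s) T / E)"
  have e: "e > 0" using divide_neg_pos[OF neg E] by (simp add: e_def)
  have "\<forall>\<^sub>F x in nhds s. \<bar>h x - h s\<bar> < e"
  proof -
    have "(h \<longlongrightarrow> h s) (nhds s)"
      using DERIV_isCont[OF enthalpy_deriv[OF s]] by (simp add: isCont_def tendsto_at_iff_tendsto_nhds)
    then have "\<forall>\<^sub>F x in nhds s. dist (h x) (h s) < e" using e by (rule tendstoD)
    then show ?thesis by (simp add: dist_real_def)
  qed
  moreover have "\<forall>\<^sub>F x in nhds s. x > 0"
    using eventually_nhds_in_open[of "{0<..}" s] s by auto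
  ultimately have ev: "\<forall>\<^sub>F x in nhds s. - (T\<^sup>2 * slope (h x) T) = total_mass p x"
  proof eventually_elim
    case (elim x)
    then have close: "\<bar>h x - h s\<bar> < 1" "\<bar>h x - h s\<bar> < - profile p (h s) T / E" by (auto simp: e_def)
    have "h x \<le> h s + 1" using close(1) by linarith
    then have "\<bar>profile p (h x) T - profile p (h s) T\<bar> \<le> E * \<bar>h x - h s\<bar>"
      unfolding E_def using L R by (intro profile_continuous_dependence[of "h s + 1"]) (auto simp: T_def)
    also have "\<dots> < - profile p (h s) T" using mult_strict_left_mono[OF close(2) E] E by simp
    finally have "profile p (h x) T < 0" by linarith
    then show ?case using total_mass_eq_flux[of x T] elim R by (simp add: T_def)
  qed
  \<comment> \<open>Outside the star \<open>F'\<close> vanishes along the profile, so the linearized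
    flux is constant from \<open>R\<close> to \<open>T\<close>.\<close>
  have flux: "T\<^sup>2 * w' T = R\<^sup>2 * w' R"
  proof (rule DERIV_isconst_end[of R T "\<lambda>r. r\<^sup>2 * w' r"])
    show "continuous_on {R..T} (\<lambda>r. r\<^sup>2 * w' r)"
      by (rule radial_sol_flux_cont[OF w[of "T + 1"]]) (use R in \<open>auto simp: T_def\<close>)
    fix x assume x: "R < x" "x < T"
    then have "profile p (h s) x \<le> 0" using profile_antimono[of R x "h s"] R by simp
    then show "((\<lambda>r. r\<^sup>2 * w' r) has_real_derivative 0) (at x)"
      using radial_sol_flux_deriv[OF w[of T], of x] x R by (simp add: F'_def)
  qed (simp add: T_def)
  have "((\<lambda>x. slope (h x) T) has_real_derivative w' T * (deriv p s / s)) (at s)"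
    by (rule DERIV_chain2[OF slope_differentiable[OF w w0] enthalpy_deriv[OF s]]) (use R in \<open>simp add: T_def\<close>)
  then have "((\<lambda>x. - (T\<^sup>2 * slope (h x) T)) has_real_derivative - (T\<^sup>2 * (w' T * (deriv p s / s)))) (at s)"
    by (intro DERIV_minus DERIV_cmult)
  then have "((\<lambda>x. - (T\<^sup>2 * slope (h x) T)) has_real_derivative - (R\<^sup>2 * w' R) * (deriv p s / s)) (at s)"
    by (rule DERIV_cong) (simp add: flux[symmetric] mult.assoc)
  then show ?thesis using DERIV_cong_ev[OF refl ev refl] by blast
qed

section \<open>Identification of the given density with the profile\<close>

lemma radial_solution_profile:
  assumes sol: "radial_solution p \<gamma> R \<rho>" and R: "R > 0"
  shows "\<rho> 0 > 0" "\<And>r. 0 \<le> r \<Longrightarrow> r < R \<Longrightarrow> profile p (h (\<rho> 0)) r > 0" "profile p (h (\<rho> 0)) R = 0"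
proof -
  have radial: "\<And>x y. norm x = norm y \<Longrightarrow> \<rho> x = \<rho> y"
    and pos: "\<And>x. x \<in> ball 0 R \<Longrightarrow> \<rho> x > 0"
    and supp: "\<And>x. x \<notin> ball 0 R \<Longrightarrow> \<rho> x = 0"
    and holder: "C1_Holder (min ((2 - \<gamma>) / (\<gamma> - 1)) 1) \<rho>"
    and crit: "\<And>x. x \<in> ball 0 R \<Longrightarrow>
        ((\<lambda>z. newton_potential \<rho> z - h (\<rho> z)) has_derivative (\<lambda>u. 0)) (at x)"
    using sol unfolding radial_solution_def by blast+
  have nonneg: "\<rho> x \<ge> 0" for x using pos[of x] supp[of x] by (cases "x \<in> ball 0 R") auto
  obtain g where "\<And>x. (\<rho> has_derivative (\<lambda>u. g x \<bullet> u)) (at x)" using holder by (auto simp: C1_Holder_def)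
  then have cont: "continuous_on UNIV \<rho>"
    by (meson continuous_at_imp_continuous_on has_derivative_continuous)
  show "\<rho> 0 > 0" using pos[of 0] R by simp
  define q where "q = (\<lambda>r. \<rho> (axis 3 r))"
  \<comment> \<open>Along a ray the equilibrium condition makes the derivatives of the potential and
    of \<open>u\<close> equal; the shell theorem evaluates the former, so \<open>u\<close> solves
    the profile equation and uniqueness identifies it.\<close>
  define u where "u = (\<lambda>r. h (q r))"
  define \<mu> where "\<mu> = (\<lambda>r. 2 * pi * integral {0..r\<^sup>2} (\<lambda>S. \<rho> (axis 3 (sqrt S)) * sqrt S))"
  define u' where "u' = (\<lambda>r. - (\<mu> r / r\<^sup>2))"
  have q_cont: "continuous_on A q" for A
    unfolding q_def
    by (rule continuous_on_compose2[OF cont linear_continuous_on[OF bounded_linear_axis_3]]) auto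
  have q_nonneg: "q r \<ge> 0" for r by (simp add: q_def nonneg)
  have u_cont: "continuous_on A u" for A
    unfolding u_def by (rule continuous_on_compose2[OF enthalpy_cont q_cont]) (auto simp: q_nonneg)
  have F_u: "F (u r) = q r" for r by (simp add: u_def F_h q_nonneg)
  have u_deriv: "(u has_real_derivative u' r) (at r)" if r: "0 < r" "r < R" for r
  proof -
    have "((\<lambda>t. newton_potential \<rho> (axis 3 t) - u t) has_derivative (\<lambda>_. 0)) (at r)"
      using has_derivative_compose[OF bounded_linear_imp_has_derivative[OF bounded_linear_axis_3], of "\<lambda>z. newton_potential \<rho> z - h (\<rho> z)" "\<lambda>u. 0" r UNIV]
        crit[of "axis 3 r"] r by (simp add: u_def q_def norm_axis_3)
    then have "((\<lambda>t. newton_potential \<rho> (axis 3 t) - u t) has_real_derivative 0) (at r)"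
      by (simp add: has_field_derivative_def lambda_zero)
    from DERIV_diff[OF newton_potential_radial_deriv(1)[OF radial cont nonneg supp r] this]
    show ?thesis by (simp add: u'_def \<mu>_def)
  qed
  have \<mu>_deriv: "(\<mu> has_real_derivative 4 * pi * r\<^sup>2 * q r) (at r)" if r: "0 < r" "r < R" for r
    unfolding \<mu>_def q_def by (rule newton_potential_radial_deriv(2)[OF radial cont nonneg supp r])
  have u'_deriv: "(u' has_real_derivative - (2 / r * u' r) - 4 * pi * F (u r)) (at r)" if r: "0 < r" "r < R" for r
    unfolding u'_def using r
    by (auto intro!: derivative_eq_intros \<mu>_deriv simp: F_u u'_def field_simps power2_eq_square)
  \<comment> \<open>Uniqueness requires continuity of \<open>u'\<close> at the centre; it follows
    because a bounded density has mass of order \<open>r^3\<close>.\<close>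
  have u'_cont: "continuous_on {0..<R} u'"
  proof -
    obtain B where B: "B > 0" "\<And>s. 0 \<le> s \<Longrightarrow> s \<le> 1 \<Longrightarrow> \<bar>q s\<bar> \<le> B"
      using continuous_on_Icc_bounded[OF q_cont] by blast
    have bound: "\<bar>\<mu> r\<bar> \<le> 2 * pi * B * r ^ 3" if r: "0 < r" "r < 1" for r
    proof -
      have "norm (integral {0..r\<^sup>2} (\<lambda>S. q (sqrt S) * sqrt S)) \<le> (B * r) * (r\<^sup>2 - 0)"
      proof (rule integral_bound)
        show "continuous_on {0..r\<^sup>2} (\<lambda>S. q (sqrt S) * sqrt S)"
          by (intro continuous_intros continuous_on_compose2[OF q_cont[of UNIV]]) auto
        fix S assume S: "S \<in> {0..r\<^sup>2}"
        then have sq: "sqrt S \<le> r" using r real_sqrt_le_mono[of S "r\<^sup>2"] by simp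
        have "0 \<le> sqrt S" "sqrt S \<le> 1" using S order_trans[OF sq less_imp_le[OF r(2)]] by (simp_all only: atLeastAtMost_iff real_sqrt_ge_zero)
        then have "\<bar>q (sqrt S)\<bar> \<le> B" by (rule B(2))
        then have "\<bar>q (sqrt S)\<bar> * sqrt S \<le> B * r"
          using S B(1) sq by (intro mult_mono) auto
        then show "norm (q (sqrt S) * sqrt S) \<le> B * r" using S by (simp add: abs_mult)
      qed simp
      then have "\<bar>\<mu> r\<bar> \<le> 2 * pi * ((B * r) * r\<^sup>2)" by (simp add: \<mu>_def q_def abs_mult)
      then show ?thesis by (simp add: power2_eq_square power3_eq_cube ac_simps)
    qed
    have "continuous (at r within {0..<R}) u'" if r: "0 \<le> r" "r < R" for r
    proof (cases "r = 0")
      case True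
      have "((\<lambda>t. 2 * pi * B * t) \<longlongrightarrow> 2 * pi * B * 0) (at 0 within {0..<R})" by (intro tendsto_intros)
      then have lim: "((\<lambda>t. 2 * pi * B * t) \<longlongrightarrow> 0) (at 0 within {0..<R})" by simp
      have "\<forall>\<^sub>F t in at 0 within {0..<R}. norm (u' t) \<le> 2 * pi * B * t"
        unfolding eventually_at
      proof (intro exI[of _ "1::real"] conjI ballI impI)
        fix t :: real assume t: "t \<in> {0..<R}" "t \<noteq> 0 \<and> dist t 0 < 1"
        then show "norm (u' t) \<le> 2 * pi * B * t" using bound[of t]
          by (simp add: u'_def divide_le_eq power2_eq_square power3_eq_cube mult.assoc)
      qed simp
      then have "(u' \<longlongrightarrow> 0) (at 0 within {0..<R})" by (rule Lim_null_comparison[OF _ lim])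
      then show ?thesis using True by (simp add: continuous_within u'_def)
    next
      case False
      then show ?thesis using r DERIV_isCont[OF u'_deriv[of r]]
        by (simp add: continuous_at_imp_continuous_at_within)
    qed
    then show ?thesis by (simp add: continuous_on_eq_continuous_within)
  qed
  have u_sol: "radial_sol R (\<lambda>r. 4 * pi * F (u r)) u u'"
    unfolding radial_sol_def using u_cont u'_cont u_deriv u'_deriv by (auto simp: u'_def)
  have q0: "q 0 = \<rho> 0" unfolding q_def by (rule radial) (simp add: norm_axis_3)
  define a where "a = h (\<rho> 0)"
  obtain L where L: "L \<ge> 0" "\<And>y. y \<le> a \<Longrightarrow> \<bar>4 * pi * F' y\<bar> \<le> L" using F'_bounded by blast
  have eq: "profile p a r = u r" if r: "0 \<le> r" "r < R" for r
  proof -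
    have "profile p a r - 1 * u r = 0"
    proof (rule radial_unique(1)[OF radial_sol_diff[OF slope_sol u_sol] _ r])
      show "profile p a 0 - 1 * u 0 = 0" by (simp add: profile_0 u_def q0 a_def)
      fix t assume t: "0 < t" "t < R"
      have "u t \<le> a"
        using radial_sol_decreasing(2)[OF u_sol, of 0 t] t F_nonneg by (simp add: u_def q0 a_def)
      then show "\<bar>4 * pi * F (profile p a t) - 1 * (4 * pi * F (u t))\<bar> \<le> L * \<bar>profile p a t - 1 * u t\<bar>"
        using F_lipschitz[of a L "profile p a t" "u t"] L(2) profile_le[of t a] t by simp
    qed
    then show ?thesis by simp
  qed
  show "profile p (h (\<rho> 0)) r > 0" if r: "0 \<le> r" "r < R" for r
    using eq[OF r] pos[of "axis 3 r"] r by (simp add: a_def u_def q_def norm_axis_3 enthalpy_pos)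
  \<comment> \<open>The equation for \<open>u\<close> holds only inside the ball; equality with the
    profile reaches the surface by continuity.\<close>
  have "((\<lambda>r. profile p a r - u r) \<longlongrightarrow> profile p a R - u R) (at R within {0..R})"
  proof -
    have "continuous_on {0..R} (\<lambda>r. profile p a r - u r)"
      by (intro continuous_intros profile_cont u_cont) auto
    then show ?thesis using R by (auto simp: continuous_on_def)
  qed
  moreover have "((\<lambda>r. profile p a r - u r) \<longlongrightarrow> 0) (at R within {0..R})"
    by (rule tendsto_eventually) (auto simp: eventually_at_filter eq intro!: always_eventually)
  moreover have "at R within {0..R} \<noteq> bot" using R by (simp add: at_within_Icc_at_left)
  ultimately have "profile p a R - u R = 0" using tendsto_unique by blast
  moreover have "u R = 0" using supp[of "axis 3 R"] R by (simp add: u_def q_def norm_axis_3 enthalpy_0)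
  ultimately show "profile p (h (\<rho> 0)) R = 0" by (simp add: a_def)
qed

text \<open>Differentiability is stated as well because \<open>deriv\<close> has an unspecified
  value where no derivative exists. The chain-rule factor \<open>deriv p s / s\<close> is positive,
  so only \<open>w' R\<close> decides.\<close>

lemma total_mass_conclusion:
  assumes s: "s > 0" and R: "R > 0" "profile p (h s) R = 0"
    and w: "\<And>T. radial_sol T (\<lambda>r. 4 * pi * F' (profile p (h s) r) * w r) w w'" and w0: "w 0 = 1"
    and w': "w' R \<noteq> 0"
  shows "total_mass p differentiable (at s) \<and> deriv (total_mass p) s \<noteq> 0"
proof -
  note D = total_mass_deriv[OF s R w w0]
  have "- (R\<^sup>2 * w' R) * (deriv p s / s) \<noteq> 0" using R w' s dp_pos[OF s] by simp
  with D show ?thesis by (auto simp: DERIV_imp_deriv real_differentiable_def)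
qed

end

section \<open>The two cases of the theorem\<close>

lemma mass_derivative_subquadratic:
  assumes "soft_pressure p 2" and sol: "radial_solution p \<gamma> R \<rho>" and R: "R > 0"
  shows "total_mass p differentiable (at (\<rho> 0)) \<and> deriv (total_mass p) (\<rho> 0) \<noteq> 0"
proof -
  interpret soft_pressure p 2 by fact
  note prof = radial_solution_profile[OF sol R]
  define a where "a = h (\<rho> 0)"
  obtain w w' where w0: "w 0 = 1" and w: "\<And>T. radial_sol T (\<lambda>r. 4 * pi * F' (profile p a r) * w r) w w'"
    using linearized_exists[of a] by blast
  have wD: "(w has_real_derivative w' r) (at r)" if "r > 0" for r
    using w[of "r + 1"] that by (auto simp: radial_sol_def)
  interpret star_variation "\<lambda>y. 4 * pi * F y" "\<lambda>y. 4 * pi * F' y" "profile p a"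
    "\<lambda>r. - (r\<^sup>2 * slope a r)" R w "\<lambda>r. r\<^sup>2 * w' r"
  proof
    fix y :: real
    show "((\<lambda>y. 4 * pi * F y) has_real_derivative 4 * pi * F' y) (at y)"
      by (intro DERIV_cmult F_deriv)
    show "4 * pi * F y > 0" if "y > 0" using that F_pos by simp
    show "4 * pi * F y < y * (4 * pi * F' y)" if "y > 0"
      using mult_strict_left_mono[OF F_superlinear[OF that], of "4 * pi"] by (simp add: ac_simps)
    \<comment> \<open>The hypothesis \<open>h \<le> 2 p'\<close> enters here, as the growth bound
      with \<open>K = 2\<close>.\<close>
    show "y * (4 * pi * F' y) \<le> 2 * (4 * pi * F y)" if "y > 0"
      using mult_left_mono[OF F_growth[OF that], of "4 * pi"] by (simp add: ac_simps)
  next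
    fix r assume r: "0 < r" "r < R"
    show "(profile p a has_real_derivative - (- (r\<^sup>2 * slope a r)) / r\<^sup>2) (at r)"
      using profile_deriv[of r a] r by simp
    show "((\<lambda>r. - (r\<^sup>2 * slope a r)) has_real_derivative r\<^sup>2 * (4 * pi * F (profile p a r))) (at r)"
      using DERIV_minus[OF flux_deriv[of r a]] r by simp
    show "(w has_real_derivative (r\<^sup>2 * w' r) / r\<^sup>2) (at r)" using wD r by simp
    show "((\<lambda>r. r\<^sup>2 * w' r) has_real_derivative - (r\<^sup>2 * (4 * pi * F' (profile p a r)) * w r)) (at r)"
      using radial_sol_flux_deriv[OF w[of R] r] by (simp add: mult.assoc)
  next
    show "continuous_on {0..R} w"
      using w[of "R + 1"] by (auto simp: radial_sol_def intro: continuous_on_subset)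
    show "continuous_on {0..R} (\<lambda>r. r\<^sup>2 * w' r)"
      by (rule radial_sol_flux_cont[OF w[of "R + 1"]]) auto
    show "continuous_on {0..R} (\<lambda>r. - (r\<^sup>2 * slope a r))"
      by (intro continuous_intros slope_cont) auto
  qed (use R prof w0 in \<open>auto simp: a_def F_nonpos intro!: profile_cont\<close>)
  show ?thesis
    using total_mass_conclusion[OF prof(1) R prof(3) w[unfolded a_def] w0] mu_end_nonzero by auto
qed

text \<open>For a power law the scaling family gives the linearized solution explicitly.\<close>

lemma mass_derivative_polytrope:
  assumes gamma: "6/5 < \<gamma>" "\<gamma> < 2" "\<gamma> \<noteq> 4/3" and p: "\<And>s. s > 0 \<Longrightarrow> p s = s powr \<gamma>"
    and sol: "radial_solution p \<gamma> R \<rho>" and R: "R > 0"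
  shows "total_mass p differentiable (at (\<rho> 0)) \<and> deriv (total_mass p) (\<rho> 0) \<noteq> 0"
proof -
  interpret soft_pressure p "1 / (\<gamma> - 1)" by (rule polytrope_soft_pressure[OF gamma(1,2) p])
  note prof = radial_solution_profile[OF sol R]
  define a where "a = h (\<rho> 0)"
  have a: "a > 0" using prof(1) by (simp add: a_def enthalpy_pos)
  \<comment> \<open>If \<open>v\<close> is a solution then so is
    \<open>\<lambda>^k v(\<lambda> r)\<close>, provided \<open>F\<close> is homogeneous of degree
    \<open>(k + 2) / k\<close> on positive arguments. This degree is
    \<open>1 / (\<gamma> - 1)\<close>, which determines \<open>k\<close>.\<close>
  define k where "k = 2 * (\<gamma> - 1) / (2 - \<gamma>)"
  have k: "k > 0" "k \<noteq> 1" using gamma by (auto simp: k_def field_simps)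
  \<comment> \<open>Euler's identity for a function of degree \<open>(k + 2) / k\<close>.\<close>
  have hom: "k * (y * F' y) = (k + 2) * F y" for y
  proof (cases "y > 0")
    case True
    have "k / (\<gamma> - 1) = (2 / (2 - \<gamma>)) * ((\<gamma> - 1) / (\<gamma> - 1))"
      by (simp only: k_def times_divide_times_eq divide_divide_eq_left)
    also have "\<dots> = 2 / (2 - \<gamma>)" using gamma by simp
    also have "\<dots> = k + 2" using gamma by (simp add: k_def field_simps)
    finally have "k / (\<gamma> - 1) = k + 2" .
    then show ?thesis using polytrope_F'[OF gamma(1,2) p True]
      by (metis times_divide_eq_left times_divide_eq_right)
  qed (simp add: F'_def F_nonpos)
  define w where "w = (\<lambda>r. (r * slope a r + k * profile p a r) / (k * a))"
  define w' where "w' = (\<lambda>r. ((k - 1) * slope a r - r * (4 * pi * F (profile p a r))) / (k * a))"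
  have w: "radial_sol T (\<lambda>r. 4 * pi * F' (profile p a r) * w r) w w'" for T
    unfolding radial_sol_def
  proof (intro conjI allI impI)
    have pc: "continuous_on {0..<T} (profile p a)" "continuous_on {0..<T} (slope a)"
      by (auto intro: profile_cont slope_cont)
    have Fc: "continuous_on {0..<T} (\<lambda>r. F (profile p a r))"
      by (rule continuous_on_compose2[OF F_cont[of UNIV] pc(1)]) auto
    show "continuous_on {0..<T} w" "continuous_on {0..<T} w'"
      unfolding w_def w'_def using k a by (auto intro!: continuous_intros pc Fc)
    show "w' 0 = 0" using slope_sol[of 1 a] by (simp add: w'_def radial_sol_def)
  next
    fix r assume "0 < r \<and> r < T"
    then have r: "r > 0" by simp
    define V V' where "V = profile p a r" and "V' = slope a r"
    have V: "(profile p a has_real_derivative V') (at r)"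
      using profile_deriv[OF r] by (simp add: V'_def)
    have V': "(slope a has_real_derivative - (2 / r * V') - 4 * pi * F V) (at r)"
      using slope_sol[of "r + 1" a] r by (simp add: radial_sol_def V_def V'_def)
    have FV: "((\<lambda>r. F (profile p a r)) has_real_derivative F' V * V') (at r)"
      using DERIV_chain2[OF F_deriv V] by (simp add: V_def)
    have "(w has_real_derivative (1 * V' + (- (2 / r * V') - 4 * pi * F V) * r + k * V') / (k * a)) (at r)"
      unfolding w_def V'_def[symmetric]
      using DERIV_cdivide[OF DERIV_add[OF DERIV_mult[OF DERIV_ident V'] DERIV_cmult[OF V, of k]], of "k * a"]
      by (simp add: V'_def)
    also have "1 * V' + (- (2 / r * V') - 4 * pi * F V) * r + k * V' = (k - 1) * V' - r * (4 * pi * F V)"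
      using r by (simp add: field_simps)
    finally show "(w has_real_derivative w' r) (at r)" by (simp add: w'_def V_def V'_def)
    have distrib: "(- (2 / r * x) - c * y) / z = - (2 / r * (x / z)) - c * (y / z)" for c x y z :: real
      by (simp add: diff_divide_distrib)
    have "(w' has_real_derivative ((k - 1) * (- (2 / r * V') - 4 * pi * F V)
        - (1 * (4 * pi * F V) + 4 * pi * (F' V * V') * r)) / (k * a)) (at r)"
      unfolding w'_def
      using DERIV_cdivide[OF DERIV_diff[OF DERIV_cmult[OF V', of "k - 1"]
          DERIV_mult[OF DERIV_ident DERIV_cmult[OF FV, of "4 * pi"]]], of "k * a"]
      by (simp add: V_def)
    also have "(k - 1) * (- (2 / r * V') - 4 * pi * F V) - (1 * (4 * pi * F V) + 4 * pi * (F' V * V') * r)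
        = - (2 / r * ((k - 1) * V' - r * (4 * pi * F V))) - 4 * pi * F' V * (r * V' + k * V)"
    proof -
      have "4 * pi * F' V * (k * V) = 4 * pi * (k * (V * F' V))" by (simp only: ac_simps)
      also have "\<dots> = 4 * pi * ((k + 2) * F V)" by (simp only: hom)
      finally have "4 * pi * F' V * (k * V) = 4 * pi * ((k + 2) * F V)" .
      then show ?thesis using r by (simp add: field_simps)
    qed
    finally show "(w' has_real_derivative - (2 / r * w' r) - 4 * pi * F' (profile p a r) * w r) (at r)"
      unfolding distrib by (simp only: w_def w'_def V_def V'_def)
  qed
  have "w 0 = 1" using k a by (simp add: w_def profile_0)
  moreover have "w' R \<noteq> 0"
    using slope_neg[OF a R] k a prof(3) by (simp add: w'_def a_def F_nonpos)
  ultimately show ?thesis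
    using total_mass_conclusion[OF prof(1) R prof(3) w[unfolded a_def]] by blast
qed

theorem theorem2p2:
  fixes R \<gamma> :: real and p :: "real \<Rightarrow> real" and \<rho>\<^sub>0 :: "real^3 \<Rightarrow> real"
  assumes "R > 0"
  shows "(6/5 < \<gamma> \<and> \<gamma> < 2 \<and> \<gamma> \<noteq> 4/3 \<and> (\<forall>s>0. p s = s powr \<gamma>) \<longrightarrow>
            admissible_pressure p \<gamma> \<and>
            (radial_solution p \<gamma> R \<rho>\<^sub>0 \<longrightarrow>
               total_mass p differentiable (at (\<rho>\<^sub>0 0)) \<and> deriv (total_mass p) (\<rho>\<^sub>0 0) \<noteq> 0)) \<and>
         (admissible_pressure p \<gamma> \<and>
            (\<forall>s>0. deriv p s < enthalpy p s \<and> enthalpy p s \<le> 2 * deriv p s) \<and>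
            radial_solution p \<gamma> R \<rho>\<^sub>0 \<longrightarrow>
               total_mass p differentiable (at (\<rho>\<^sub>0 0)) \<and> deriv (total_mass p) (\<rho>\<^sub>0 0) \<noteq> 0)"
  using polytrope_admissible[of \<gamma> p] mass_derivative_polytrope[of \<gamma> p R \<rho>\<^sub>0]
    mass_derivative_subquadratic[of p \<gamma> R \<rho>\<^sub>0] admissible_soft_pressure[of p \<gamma> 2] assms
  by blast

end
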